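(* Let $\phi(x)=\pi^{-d/4}e^{-|x|^2/2}$, $x\in\mathbf R^d$, let $\chi\in\mathcal R^\infty(\mathbf C^d)$, $s\in(0,\frac12)$, and let $f\in\mathscr S'(\mathbf R^d)$. Then the following conditions are equivalent: (1) $f\in\mathcal H_s(\mathbf R^d)$ (respectively $f\in\mathcal H_{0,s}(\mathbf R^d)$); (2) $f=V_\phi^*F$ for some $F\in\mathscr E'(\mathbf R^{2d})\cap L^\infty(\mathbf R^{2d})$ which satisfies $$F(x,\xi)=F_0(x-i\xi)\,e^{-i\langle x,\xi\rangle}\chi(x,\xi)$$ for some $F_0\in\mathcal A_s(\mathbf C^d)$ (respectively $F_0\in\mathcal A_{0,s}(\mathbf C^d)$).
   Context: Notation: $\mathbf R_+=(0,\infty)$, $\mathbf N=\{0,1,2,\dots\}$. Inequalities between vectors are coordinatewise. $D_r(0)=\{z\in\mathbf C^d: |z_j|<r_j,\ j=1,\dots,d\}$; functions on $\mathbf C^d$ are regarded as functions on $\mathbf R^{2d}$ via $z=x+i\xi$. $\langle x,\xi\rangle=\sum_jx_j\xi_j$. $g\lesssim h$ means $g\le Ch$ with $C>0$ independent of the variable. $\mathscr E'$ denotes compactly supported distributions. For $r\in\mathbf R_+^d$ put $\vartheta_r(\alpha)=\exp\bigl(-\sum_{j=1}^d\frac1{r_j}\alpha_j^{1/(2s)}\bigr)$, $\alpha\in\mathbf N^d$. Hermite functions: $h_\alpha(x)=\pi^{-d/4}(-1)^{|\alpha|}(2^{|\alpha|}\alpha!)^{-1/2}e^{|x|^2/2}\partial^\alpha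 e^{-|x|^2}$, $\alpha\in\mathbf N^d$; $c_h(f,\alpha)=(f,h_\alpha)_{L^2}$. $\mathcal H_s(\mathbf R^d)$ (respectively $\mathcal H_{0,s}(\mathbf R^d)$) is the set of $f\in L^2(\mathbf R^d)$ with $|c_h(f,\alpha)|\lesssim\vartheta_r(\alpha)$ for some (respectively every) $r\in\mathbf R_+^d$. Power series are written $G(z)=\sum_{\alpha\in\mathbf N^d}c(G,\alpha)z^\alpha/\sqrt{\alpha!}$. $\mathcal A_s(\mathbf C^d)$ (respectively $\mathcal A_{0,s}(\mathbf C^d)$) is the set of $G$ with $|c(G,\alpha)|\lesssim\vartheta_r(\alpha)$ for some (respectively every) $r\in\mathbf R_+^d$; these are entire functions. For $t_1\le t_2$ in $\mathbf R_+^d$, $\mathcal R^\infty_{t_1,t_2}(\mathbf C^d)$ is the set of non-negative $\chi\in L^\infty(\mathbf C^d)$ with support in $\overline{D_{t_2}(0)}$, of the form $\chi(z)=\chi_0(|z_1|,\dots,|z_d|)$ for some function $\chi_0$, and such that $\chi\ge c$ on $D_{t_1}(0)$ for some constant $c>0$. $\mathcal R^\infty(\mathbf C^d)=\bigcup_{t_1\le t_2}\mathcal R^\infty_{t_1,t_2}(\mathbf C^d)$. $V_\phi^*$ is the adjoint of the short-time Fourier transform $V_\phi f(x,\xi)=\langle f,\overline{\phi(\cdot-x)}e^{-i\langle\cdot,\xi\rangle}\rangle$; for $F\in L^\infty\cap\mathscr E'$, $(V_\phi^*F)(x)=\iint F(y,\eta)\phi(x-y)e^{i\langle x,\eta\rangle}\,dy\,d\eta$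 (constant normalising factors are immaterial here).
   Formalization: The factor e^{-i<x,xi>} in (2) is replaced by e^{-i<x,xi>/2}: with the stated V_phi^* and z = x+i xi, the printed factor makes the equivalence false, e.g. F_0 = 1 gives an f whose Hermite coefficients decay only like m^{-2m} at order 2m, so f is not in H_s for s < 1/2. *)

theory Defs
  imports "HOL-Analysis.Analysis"
begin

text \<open>The dimension \<open>d\<close> is \<open>CARD('d)\<close> for a finite index type \<open>'d\<close>. Elements of
  \<open>L\<^sup>2\<close> and \<open>L\<^sup>\<infinity>\<close> are represented by Lebesgue measurable functions, and all
  conditions on them are read modulo null sets.\<close>

type_synonym 'd multi_index = "nat ^ 'd"

definition mi_length :: "'d::finite multi_index \<Rightarrow> nat" where
  "mi_length \<alpha> = (\<Sum>j\<in>UNIV. \<alpha> $ j)"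

definition mi_fact :: "'d::finite multi_index \<Rightarrow> real" where
  "mi_fact \<alpha> = (\<Prod>j\<in>UNIV. fact (\<alpha> $ j))"

definition monomial :: "('a::comm_monoid_mult) ^ 'd::finite \<Rightarrow> 'd multi_index \<Rightarrow> 'a" where
  "monomial z \<alpha> = (\<Prod>j\<in>UNIV. (z $ j) ^ (\<alpha> $ j))"

definition pos_vec :: "real ^ 'd \<Rightarrow> bool" where
  "pos_vec r \<longleftrightarrow> (\<forall>j. 0 < r $ j)"


subsection \<open>Partial derivatives, Schwartz functions, tempered distributions\<close>

definition partial_deriv ::
  "'d::finite \<Rightarrow> (real ^ 'd \<Rightarrow> 'b::real_normed_vector) \<Rightarrow> real ^ 'd \<Rightarrow> 'b" where
  "partial_deriv j f x = vector_derivative (\<lambda>t. f (x + t *\<^sub>R axis j 1)) (at 0)"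

primrec partial_derivs ::
  "'d::finite list \<Rightarrow> (real ^ 'd \<Rightarrow> 'b::real_normed_vector) \<Rightarrow> real ^ 'd \<Rightarrow> 'b" where
  "partial_derivs [] f = f"
| "partial_derivs (j # js) f = partial_deriv j (partial_derivs js f)"

definition smooth :: "(real ^ 'd::finite \<Rightarrow> 'b::real_normed_vector) \<Rightarrow> bool" where
  "smooth f \<longleftrightarrow> (\<forall>js. partial_derivs js f differentiable_on UNIV)"

text \<open>The order in which the derivatives are taken is left unspecified; it is immaterial
  for smooth functions, the only ones to which this is applied.\<close>

definition multi_deriv ::
  "'d::finite multi_index \<Rightarrow> (real ^ 'd \<Rightarrow> 'b::real_normed_vector) \<Rightarrow> real ^ 'd \<Rightarrow> 'b" where
  "multi_deriv \<alpha> f = partial_derivs (SOME js. \<forall>j. count_list js j = \<alpha> $ j) f"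

definition schwartz :: "(real ^ 'd::finite \<Rightarrow> complex) set" where
  "schwartz = {\<psi>. smooth \<psi> \<and>
     (\<forall>\<alpha> \<beta>. bounded (range (\<lambda>x. monomial x \<alpha> *\<^sub>R multi_deriv \<beta> \<psi> x)))}"

definition schwartz_seminorm :: "nat \<Rightarrow> (real ^ 'd::finite \<Rightarrow> complex) \<Rightarrow> real" where
  "schwartz_seminorm N \<psi> =
     (\<Sum>\<alpha> | mi_length \<alpha> \<le> N. \<Sum>\<beta> | mi_length \<beta> \<le> N.
        SUP x. norm (monomial x \<alpha> *\<^sub>R multi_deriv \<beta> \<psi> x))"

text \<open>A tempered distribution is a functional of which only the values on
  \<open>schwartz\<close> matter; hence equality is \<open>distr_eq\<close> below.\<close>

definition tempered_distr :: "((real ^ 'd::finite \<Rightarrow> complex) \<Rightarrow> complex) set" where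
  "tempered_distr = {u.
     (\<forall>\<psi>\<in>schwartz. \<forall>\<psi>'\<in>schwartz. u (\<lambda>x. \<psi> x + \<psi>' x) = u \<psi> + u \<psi>') \<and>
     (\<forall>a. \<forall>\<psi>\<in>schwartz. u (\<lambda>x. a * \<psi> x) = a * u \<psi>) \<and>
     (\<exists>C N. \<forall>\<psi>\<in>schwartz. norm (u \<psi>) \<le> C * schwartz_seminorm N \<psi>)}"

definition distr_eq ::
  "((real ^ 'd::finite \<Rightarrow> complex) \<Rightarrow> complex) \<Rightarrow> ((real ^ 'd \<Rightarrow> complex) \<Rightarrow> complex) \<Rightarrow> bool" where
  "distr_eq u v \<longleftrightarrow> (\<forall>\<psi>\<in>schwartz. u \<psi> = v \<psi>)"

definition fun_distr :: "(real ^ 'd::finite \<Rightarrow> complex) \<Rightarrow> (real ^ 'd \<Rightarrow> complex) \<Rightarrow> complex" where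
  "fun_distr g \<psi> = (LINT x|lebesgue. g x * \<psi> x)"


subsection \<open>Hermite expansions\<close>

definition theta :: "real \<Rightarrow> real ^ 'd::finite \<Rightarrow> 'd multi_index \<Rightarrow> real" where
  "theta s r \<alpha> = exp (- (\<Sum>j\<in>UNIV. (1 / r $ j) * real (\<alpha> $ j) powr (1 / (2 * s))))"

definition hermite_fun :: "'d::finite multi_index \<Rightarrow> real ^ 'd \<Rightarrow> real" where
  "hermite_fun \<alpha> x =
     pi powr (- real CARD('d) / 4) * (-1) ^ mi_length \<alpha>
       * (2 ^ mi_length \<alpha> * mi_fact \<alpha>) powr (- 1 / 2)
       * exp ((norm x)\<^sup>2 / 2) * multi_deriv \<alpha> (\<lambda>y. exp (- (norm y)\<^sup>2)) x"

definition square_integrable :: "('a::euclidean_space \<Rightarrow> complex) \<Rightarrow> bool" where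
  "square_integrable f \<longleftrightarrow>
     f \<in> borel_measurable lebesgue \<and> integrable lebesgue (\<lambda>x. (norm (f x))\<^sup>2)"

definition hermite_coeff :: "(real ^ 'd::finite \<Rightarrow> complex) \<Rightarrow> 'd multi_index \<Rightarrow> complex" where
  "hermite_coeff f \<alpha> = (LINT x|lebesgue. f x * cnj (of_real (hermite_fun \<alpha> x)))"

definition H_space :: "real \<Rightarrow> (real ^ 'd::finite \<Rightarrow> complex) set" where
  "H_space s = {f. square_integrable f \<and>
     (\<exists>r. pos_vec r \<and> (\<exists>C>0. \<forall>\<alpha>. norm (hermite_coeff f \<alpha>) \<le> C * theta s r \<alpha>))}"

definition H0_space :: "real \<Rightarrow> (real ^ 'd::finite \<Rightarrow> complex) set" where
  "H0_space s = {f. square_integrable f \<and>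
     (\<forall>r. pos_vec r \<longrightarrow> (\<exists>C>0. \<forall>\<alpha>. norm (hermite_coeff f \<alpha>) \<le> C * theta s r \<alpha>))}"

definition distr_in ::
  "((real ^ 'd::finite \<Rightarrow> complex) \<Rightarrow> complex) \<Rightarrow> (real ^ 'd \<Rightarrow> complex) set \<Rightarrow> bool" where
  "distr_in u X \<longleftrightarrow> (\<exists>g\<in>X. distr_eq u (fun_distr g))"


subsection \<open>Spaces of power series\<close>

definition has_coeffs ::
  "(complex ^ 'd::finite \<Rightarrow> complex) \<Rightarrow> ('d multi_index \<Rightarrow> complex) \<Rightarrow> bool" where
  "has_coeffs G c \<longleftrightarrow>
     (\<forall>z. ((\<lambda>\<alpha>. c \<alpha> * monomial z \<alpha> / of_real (sqrt (mi_fact \<alpha>))) has_sum G z) UNIV)"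

definition A_space :: "real \<Rightarrow> (complex ^ 'd::finite \<Rightarrow> complex) set" where
  "A_space s = {G. \<exists>c. has_coeffs G c \<and>
     (\<exists>r. pos_vec r \<and> (\<exists>C>0. \<forall>\<alpha>. norm (c \<alpha>) \<le> C * theta s r \<alpha>))}"

definition A0_space :: "real \<Rightarrow> (complex ^ 'd::finite \<Rightarrow> complex) set" where
  "A0_space s = {G. \<exists>c. has_coeffs G c \<and>
     (\<forall>r. pos_vec r \<longrightarrow> (\<exists>C>0. \<forall>\<alpha>. norm (c \<alpha>) \<le> C * theta s r \<alpha>))}"


subsection \<open>Bounded cut-off functions\<close>

definition polydisc :: "real ^ 'd::finite \<Rightarrow> (complex ^ 'd) set" where
  "polydisc r = {z. \<forall>j. norm (z $ j) < r $ j}"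

definition ess_bounded :: "('a::euclidean_space \<Rightarrow> 'b::real_normed_vector) \<Rightarrow> bool" where
  "ess_bounded f \<longleftrightarrow> (\<exists>B. AE x in lebesgue. norm (f x) \<le> B)"

definition R_infty_between :: "real ^ 'd::finite \<Rightarrow> real ^ 'd \<Rightarrow> (complex ^ 'd \<Rightarrow> real) set" where
  "R_infty_between t1 t2 = {k.
     k \<in> borel_measurable lebesgue \<and> ess_bounded k \<and>
     (AE z in lebesgue. 0 \<le> k z) \<and>
     (AE z in lebesgue. z \<notin> closure (polydisc t2) \<longrightarrow> k z = 0) \<and>
     (\<exists>k0 :: real ^ 'd \<Rightarrow> real. AE z in lebesgue. k z = k0 (\<chi> j. norm (z $ j))) \<and>
     (\<exists>c>0. AE z in lebesgue. z \<in> polydisc t1 \<longrightarrow> c \<le> k z)}"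

definition R_infty :: "(complex ^ 'd::finite \<Rightarrow> real) set" where
  "R_infty = (\<Union>(t1, t2) \<in> {(t1, t2). pos_vec t1 \<and> pos_vec t2 \<and> (\<forall>j. t1 $ j \<le> t2 $ j)}.
     R_infty_between t1 t2)"

text \<open>A bounded function is a compactly supported distribution iff it vanishes almost
  everywhere outside some compact set.\<close>

definition Linfty_compact :: "('a::euclidean_space \<Rightarrow> complex) set" where
  "Linfty_compact = {F. F \<in> borel_measurable lebesgue \<and> ess_bounded F \<and>
     (\<exists>K. compact K \<and> (AE x in lebesgue. x \<notin> K \<longrightarrow> F x = 0))}"


subsection \<open>The adjoint short-time Fourier transform\<close>

definition cvec :: "real ^ 'd \<Rightarrow> real ^ 'd \<Rightarrow> complex ^ 'd" where
  "cvec x \<xi> = (\<chi> j. Complex (x $ j) (\<xi> $ j))"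

definition gauss :: "real ^ 'd::finite \<Rightarrow> complex" where
  "gauss x = of_real (pi powr (- real CARD('d) / 4) * exp (- (norm x)\<^sup>2 / 2))"

definition stft_adj ::
  "(real ^ 'd::finite \<Rightarrow> complex) \<Rightarrow> ((real ^ 'd) \<times> (real ^ 'd) \<Rightarrow> complex) \<Rightarrow> real ^ 'd \<Rightarrow> complex" where
  "stft_adj \<phi> F x =
     (LINT p|lebesgue. F p * \<phi> (x - fst p) * exp (\<i> * of_real (x \<bullet> snd p)))"

text \<open>With these conventions the phase that makes a rotation invariant cut-off act
  diagonally on monomials is \<open>exp (- \<i> (x \<bullet> \<xi>) / 2)\<close>: with \<open>w = y + \<i>\<eta>\<close>, the Bargmann
  transform of \<open>x \<mapsto> \<phi> (x - y) exp (\<i> (x \<bullet> \<eta>))\<close> for the Gaussian \<open>\<phi>\<close> is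
  \<open>z \<mapsto> exp (\<langle>z, w\<rangle> / sqrt 2 - \<bar>w\<bar>\<^sup>2 / 4 + \<i> (y \<bullet> \<eta>) / 2)\<close>, where \<open>\<langle>z, w\<rangle>\<close> is bilinear.
  The source prints the phase as \<open>exp (- \<i> (x \<bullet> \<xi>))\<close>, which is right only in the variables
  rescaled by \<open>sqrt 2\<close>; in the unscaled variables the equivalence would fail, already for
  \<open>F0 = 1\<close>. The halved phase is used in the theorem.\<close>

end

theory Submission
  imports Defs "HOL-Probability.Probability" "HOL-Real_Asymp.Real_Asymp"
begin

text \<open>Write \<open>w = y + \<i>\<eta>\<close>. The Gaussian shifted in phase space by \<open>w\<close> has Hermite coefficients
  \<open>(w / sqrt 2)\<^sup>\<alpha> / sqrt (\<alpha>!) exp (- \<bar>w\<bar>\<^sup>2 / 4 + \<i> (y \<bullet> \<eta>) / 2)\<close>, so by Fubini the coefficients of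
  \<open>V\<^sub>\<phi>\<^sup>* F\<close> are integrals of \<open>F0 (cnj w) w\<^sup>\<alpha>\<close> against a radial weight of compact support. Rotation
  invariance makes the monomials orthogonal for that weight, hence \<open>V\<^sub>\<phi>\<^sup>*\<close> multiplies the coefficients of
  \<open>F0\<close> by numbers between \<open>c A\<^bsup>\<bar>\<alpha>\<bar>\<^esup> / \<alpha>!\<close> and \<open>C B\<^bsup>\<bar>\<alpha>\<bar>\<^esup> / \<alpha>!\<close>. As \<open>1 / (2 s) > 1\<close>, such factors and
  their inverses only change \<open>r\<close> in the decay condition. Since the Hermite functions are complete, a
  function in \<open>L\<^sup>2\<close> is recovered by dividing its coefficients by these numbers.\<close>


subsection \<open>Hermite functions\<close>

text \<open>Completeness is the one step that is not a computation. Vanishing coefficients only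
  annihilate polynomials times \<open>exp (- |x|^2 / 2)\<close>, and polynomials are unbounded, so
  uniform approximation on the whole space cannot use them directly. Hence further Gaussian factors
  are brought in: expanding \<open>exp (- b |x|^2)\<close> in its Taylor series under the integral
  is legitimate while \<open>b\<close> stays below the exponent already present, so the exponents
  grow from 1/2 in steps of 1/4. The resulting products contain an algebra of bounded functions to
  which Stone-Weierstrass applies. A second constraint is that the data are given modulo null sets
  of completed Lebesgue measure, whereas Fubini and changes of variables are carried out for
  \<open>lborel\<close>. Therefore the cut-off, and the weighted function in the completeness proof,
  are first replaced by Borel representatives. The lower bound of the cut-off near the origin makes
  every multiplier positive, so that division by the multipliers is possible at all.\<close>

fun hpoly :: "nat \<Rightarrow> real \<Rightarrow> real" where
  "hpoly 0 x = 1"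
| "hpoly (Suc n) x = 2 * x * hpoly n x - 2 * real n * hpoly (n - 1) x"

text \<open>The recurrence generates the physicists' Hermite polynomials. It reaches back two
  indices, hence the strong induction; at \<open>n = 0\<close> the truncated \<open>n - 1\<close> is
  harmless because its factor \<open>n\<close> vanishes.\<close>

lemma hpoly_deriv: "(hpoly n has_real_derivative 2 * real n * hpoly (n - 1) x) (at x)"
proof (induction n rule: less_induct)
  case (less n)
  show ?case
  proof (cases n)
    case 0
    then have "hpoly n = (\<lambda>_. 1)" by auto
    then show ?thesis using 0 by simp
  next
    case (Suc m)
    have e: "hpoly n = (\<lambda>x. 2 * x * hpoly m x - 2 * real m * hpoly (m - 1) x)"
      using Suc by auto
    have "(hpoly n has_real_derivative
        2 * hpoly m x + 2 * x * (2 * real m * hpoly (m - 1) x)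
        - 2 * real m * (2 * real (m - 1) * hpoly (m - 1 - 1) x)) (at x)"
      unfolding e
      by (rule derivative_eq_intros less.IH refl | simp add: Suc)+
    \<comment> \<open>The bracket is the recurrence for index \<open>m\<close>; at
      \<open>m = 0\<close> both sides vanish.\<close>
    moreover have "2 * real m * (2 * x * hpoly (m - 1) x - 2 * real (m - 1) * hpoly (m - 1 - 1) x)
        = 2 * real m * hpoly m x"
      by (cases m) auto
    ultimately show ?thesis
      unfolding e[symmetric] using Suc
      by (simp add: algebra_simps del: hpoly.simps(2))
  qed
qed

lemma continuous_hpoly: "continuous_on A (hpoly n)"
  by (meson DERIV_continuous_on DERIV_subset hpoly_deriv subset_UNIV)

lemma borel_measurable_hpoly [measurable]: "hpoly n \<in> borel_measurable borel"
  by (rule borel_measurable_continuous_onI[OF continuous_hpoly])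

text \<open>Rodrigues' formula read backwards: this is the \<open>n\<close>-th derivative of
  \<open>exp (- t^2)\<close>.\<close>

definition gauss_deriv :: "nat \<Rightarrow> real \<Rightarrow> real" where
  "gauss_deriv n t = (-1) ^ n * hpoly n t * exp (- t\<^sup>2)"

lemma gauss_deriv_deriv: "(gauss_deriv n has_real_derivative gauss_deriv (Suc n) t) (at t)"
  unfolding gauss_deriv_def[abs_def]
  by (rule derivative_eq_intros hpoly_deriv refl)+ (simp add: algebra_simps)

lemma norm_power2_vec: "(norm (x :: real ^ 'd::finite))\<^sup>2 = (\<Sum>j\<in>UNIV. (x $ j)\<^sup>2)"
  by (simp add: power2_norm_eq_inner inner_vec_def) (simp add: power2_eq_square)

text \<open>The Gaussian is a product over the coordinates, so only the multiplicity of each index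
  in \<open>js\<close> matters. This removes the dependence on the order left open in
  \<open>multi_deriv\<close>.\<close>

lemma partial_derivs_gauss:
  "partial_derivs js (\<lambda>y :: real ^ 'd::finite. exp (- (norm y)\<^sup>2))
    = (\<lambda>x. \<Prod>j\<in>UNIV. gauss_deriv (count_list js j) (x $ j))"
proof (induction js)
  case Nil
  show ?case
    by (auto simp: gauss_deriv_def norm_power2_vec sum_negf[symmetric] exp_sum)
next
  case (Cons k js)
  show ?case
  proof
    fix x :: "real ^ 'd"
    let ?G = "\<lambda>j. gauss_deriv (count_list js j)"
    let ?P = "\<Prod>j\<in>UNIV - {k}. ?G j (x $ j)"
    have e: "(\<Prod>j\<in>UNIV. ?G j ((x + t *\<^sub>R axis k 1) $ j)) = ?G k (x $ k + t) * ?P" for t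
      by (subst prod.remove[of _ k]) (auto simp: axis_def intro!: prod.cong)
    have "((\<lambda>t. ?G k (x $ k + t)) has_real_derivative gauss_deriv (Suc (count_list js k)) (x $ k)) (at 0)"
      using DERIV_shift[of "?G k" _ 0 "x $ k"] gauss_deriv_deriv[of "count_list js k" "x $ k"]
      by (simp add: add.commute)
    then have "((\<lambda>t. \<Prod>j\<in>UNIV. ?G j ((x + t *\<^sub>R axis k 1) $ j)) has_real_derivative
        gauss_deriv (Suc (count_list js k)) (x $ k) * ?P) (at 0)"
      unfolding e by (rule DERIV_cmult_right)
    then have "partial_deriv k (\<lambda>x. \<Prod>j\<in>UNIV. ?G j (x $ j)) x
       = gauss_deriv (Suc (count_list js k)) (x $ k) * ?P"
      unfolding partial_deriv_def
      by (intro vector_derivative_at) (simp add: has_real_derivative_iff_has_vector_derivative)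
    also have "\<dots> = (\<Prod>j\<in>UNIV. gauss_deriv (count_list (k # js) j) (x $ j))"
      by (subst prod.remove[of UNIV k]) (auto intro!: prod.cong)
    finally show "partial_derivs (k # js) (\<lambda>y :: real ^ 'd::finite. exp (- (norm y)\<^sup>2)) x = \<dots>"
      by (simp add: Cons.IH)
  qed
qed

lemma multi_deriv_gauss:
  "multi_deriv \<alpha> (\<lambda>y :: real ^ 'd::finite. exp (- (norm y)\<^sup>2)) x
    = (\<Prod>j\<in>UNIV. gauss_deriv (\<alpha> $ j) (x $ j))"
proof -
  \<comment> \<open>A list with the prescribed multiplicities exists, so the choice in
    \<open>multi_deriv\<close> is made among genuine candidates.\<close>
  obtain js where js: "mset js = (\<Sum>j\<in>UNIV. replicate_mset (\<alpha> $ j) j)"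
    using ex_mset by blast
  have "count_list js j = \<alpha> $ j" for j
    using arg_cong[OF js, of "\<lambda>M. count M j"] by (simp add: count_mset count_sum)
  then have "\<exists>js. \<forall>j. count_list js j = \<alpha> $ j"
    by blast
  from someI_ex[OF this] show ?thesis
    by (simp add: multi_deriv_def partial_derivs_gauss)
qed

text \<open>The normalised Hermite function of one variable. The sign of \<open>gauss_deriv\<close>
  has cancelled against the one in \<open>hermite_fun\<close>.\<close>

definition hfun :: "nat \<Rightarrow> real \<Rightarrow> real" where
  "hfun n t = pi powr (- 1 / 4) * (2 ^ n * fact n) powr (- 1 / 2) * (hpoly n t * exp (- t\<^sup>2 / 2))"

lemma mi_norm_prod:
  "2 ^ mi_length \<alpha> * mi_fact \<alpha> = (\<Prod>j\<in>UNIV. 2 ^ (\<alpha> $ j) * fact (\<alpha> $ j))"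
  by (simp add: mi_length_def mi_fact_def prod.distrib power_sum)

lemma hermite_fun_prod: "hermite_fun \<alpha> x = (\<Prod>j\<in>UNIV. hfun (\<alpha> $ j) (x $ (j::'d::finite)))"
proof -
  have 1: "pi powr (- real CARD('d) / 4) = (\<Prod>j\<in>(UNIV::'d set). pi powr (- 1 / 4))"
    by (simp add: powr_powr powr_realpow[symmetric])
  have 2: "(2 ^ mi_length \<alpha> * mi_fact \<alpha>) powr (- 1 / 2)
      = (\<Prod>j\<in>UNIV. (2 ^ (\<alpha> $ j) * fact (\<alpha> $ j)) powr (- 1 / 2))"
    unfolding mi_norm_prod by (simp add: prod_powr_distrib)
  have 3: "exp ((norm x)\<^sup>2 / 2) = (\<Prod>j\<in>UNIV. exp ((x $ j)\<^sup>2 / 2))"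
    by (simp add: norm_power2_vec sum_divide_distrib exp_sum)
  have 4: "(-1::real) ^ mi_length \<alpha> = (\<Prod>j\<in>UNIV. (-1) ^ (\<alpha> $ j))"
    by (simp add: mi_length_def power_sum)
  have 5: "exp (t\<^sup>2 / 2) * exp (- t\<^sup>2) = exp (- t\<^sup>2 / 2)" for t :: real
    by (simp add: exp_add[symmetric])
  have 6: "(-1) ^ n * (gauss_deriv n t * exp (t\<^sup>2 / 2)) = hpoly n t * exp (- (t\<^sup>2 / 2))" for n t
    using 5[of t] by (simp add: gauss_deriv_def mult_ac power_mult_distrib[symmetric])
  show ?thesis
    unfolding hermite_fun_def multi_deriv_gauss 1 2 3 4 prod.distrib[symmetric]
    by (intro prod.cong) (auto simp: hfun_def mult_ac 6)
qed

subsection \<open>Polynomials times Gaussians\<close>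

text \<open>The product measure behind \<open>lborel\<close> is indexed by \<open>Basis\<close>;
  \<open>inv\<close> recovers the coordinate that belongs to a unit vector.\<close>

lemma prod_Basis_vec:
  "(\<Prod>b\<in>Basis. F (inv (\<lambda>j :: 'd::finite. axis j (1::real)) b) (x \<bullet> b)) = (\<Prod>j\<in>UNIV. F j (x $ j))"
proof -
  have inj: "inj (\<lambda>j :: 'd. axis j (1::real))"
    by (auto simp: inj_on_def axis_eq_axis)
  have B: "(Basis :: (real ^ 'd) set) = range (\<lambda>j. axis j 1)"
    by (auto simp: Basis_vec_def)
  show ?thesis
    unfolding B by (subst prod.reindex[OF inj]) (simp add: inv_f_f[OF inj] inner_axis)
qed

text \<open>Since \<open>lborel\<close> is the image of a product measure under \<open>?T\<close>,
  integrals of products of functions of single coordinates factor. All Hermite integrals are thereby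
  reduced to one variable.\<close>

lemma
  fixes f :: "'d::finite \<Rightarrow> real \<Rightarrow> 'b::{real_normed_field,banach,second_countable_topology}"
  assumes f: "\<And>j. integrable lborel (f j)"
  shows integrable_prod_vec: "integrable lborel (\<lambda>x :: real ^ 'd. \<Prod>j\<in>UNIV. f j (x $ j))"
    and integral_prod_vec: "(LINT x|lborel. (\<Prod>j\<in>UNIV. f j ((x :: real ^ 'd) $ j))) = (\<Prod>j\<in>UNIV. (LINT t|lborel. f j t))"
proof -
  interpret product_sigma_finite "\<lambda>b :: real ^ 'd. lborel :: real measure" ..
  let ?i = "inv (\<lambda>j :: 'd. axis j (1::real))"
  let ?P = "\<Pi>\<^sub>M b\<in>(Basis :: (real ^ 'd) set). (lborel :: real measure)"
  let ?T = "\<lambda>f. \<Sum>b\<in>Basis. f b *\<^sub>R (b :: real ^ 'd)"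
  have [measurable]: "f j \<in> borel_measurable borel" for j
    using borel_measurable_integrable[OF f[of j]] by simp
  have [measurable]: "(\<lambda>x :: real ^ 'd. \<Prod>j\<in>UNIV. f j (x $ j)) \<in> borel_measurable borel"
    by measurable
  have T [measurable]: "?T \<in> ?P \<rightarrow>\<^sub>M borel" by measurable
  have e: "(\<Prod>j\<in>UNIV. f j (?T g $ j)) = (\<Prod>b\<in>Basis. f (?i b) (g b))" for g
    by (subst prod_Basis_vec[symmetric]) (auto intro!: prod.cong)
  have i: "integrable ?P (\<lambda>g. \<Prod>b\<in>Basis. f (?i b) (g b))"
    by (rule product_integrable_prod) (use f in auto)
  show "integrable lborel (\<lambda>x :: real ^ 'd. \<Prod>j\<in>UNIV. f j (x $ j))"
    unfolding lborel_eq[where 'a="real ^ 'd"]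
    by (subst integrable_distr_eq[OF T]) (use i in \<open>simp_all only: e, measurable\<close>)
  have "(LINT x|lborel. (\<Prod>j\<in>UNIV. f j ((x :: real ^ 'd) $ j))) = (LINT g|?P. (\<Prod>b\<in>Basis. f (?i b) (g b)))"
    unfolding lborel_eq[where 'a="real ^ 'd"]
    by (subst integral_distr[OF T]) (simp_all only: e, measurable)
  also have "\<dots> = (\<Prod>b\<in>(Basis :: (real ^ 'd) set). (LINT t|lborel. f (?i b) t))"
    by (rule product_integral_prod) (use f in auto)
  also have "\<dots> = (\<Prod>j\<in>UNIV. (LINT t|lborel. f j t))"
    using prod_Basis_vec[of "\<lambda>j _. LINT t|lborel. f j t" 0] by simp
  finally show "(LINT x|lborel. (\<Prod>j\<in>UNIV. f j ((x :: real ^ 'd) $ j))) = (\<Prod>j\<in>UNIV. (LINT t|lborel. f j t))" .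
qed

lemma integrable_gauss_real:
  assumes "0 < a"
  shows "integrable lborel (\<lambda>t :: real. exp (- a * t\<^sup>2))"
proof -
  \<comment> \<open>The centred normal density of variance \<open>1 / (2 * a)\<close>, freed of its
    normalisation.\<close>
  have "integrable lborel (\<lambda>t. sqrt (pi / a) * normal_density 0 (sqrt (1 / (2 * a))) t)"
    using assms by (intro integrable_mult_right integrable_normal_density) auto
  moreover have "sqrt (pi / a) * normal_density 0 (sqrt (1 / (2 * a))) t = exp (- a * t\<^sup>2)" for t
    using assms by (simp add: normal_density_def power_divide real_sqrt_divide[symmetric] mult_ac)
  ultimately show ?thesis by simp
qed

lemma integrable_gauss_vec:
  assumes "0 < a"
  shows "integrable lborel (\<lambda>x :: real ^ 'd::finite. exp (- a * (norm x)\<^sup>2))"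
proof -
  have "integrable lborel (\<lambda>x :: real ^ 'd. \<Prod>j\<in>UNIV. exp (- a * (x $ j)\<^sup>2))"
    using integrable_gauss_real[OF assms] by (intro integrable_prod_vec)
  then show ?thesis
    by (simp add: norm_power2_vec sum_distrib_left exp_sum flip: sum_negf)
qed

text \<open>A product shares \<open>\<delta>\<close> equally between its two factors, so the
  induction has to treat every \<open>\<delta>\<close> at once.\<close>

lemma poly_gauss_bound:
  assumes "real_polynomial_function p" "0 < \<delta>"
  shows "\<exists>C>0. \<forall>x. \<bar>p x\<bar> \<le> C * exp (\<delta> * (norm x)\<^sup>2)"
  using assms
proof (induction arbitrary: \<delta>)
  case (linear f)
  then obtain K where K: "K > 0" "\<And>x. norm (f x) \<le> norm x * K"
    using bounded_linear.pos_bounded by blast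
  show ?case
  proof (intro exI[of _ "K * (1 + 1 / \<delta>)"] conjI allI)
    fix x :: 'a
    have "0 \<le> (norm x - 1 / 2)\<^sup>2" by simp
    then have "norm x \<le> 1 + (norm x)\<^sup>2" by (simp add: power2_diff) (simp add: power2_eq_square)
    also have "\<dots> \<le> (1 + 1 / \<delta>) * (1 + \<delta> * (norm x)\<^sup>2)"
      using linear by (simp add: field_simps)
    also have "\<dots> \<le> (1 + 1 / \<delta>) * exp (\<delta> * (norm x)\<^sup>2)"
      using linear by (intro mult_left_mono) auto
    finally have "K * norm x \<le> K * ((1 + 1 / \<delta>) * exp (\<delta> * (norm x)\<^sup>2))"
      using K by (intro mult_left_mono) auto
    then show "\<bar>f x\<bar> \<le> K * (1 + 1 / \<delta>) * exp (\<delta> * (norm x)\<^sup>2)"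
      using K(2)[of x] by (simp add: mult_ac)
  qed (use K linear in \<open>auto simp: add_pos_pos\<close>)
next
  case (const c)
  show ?case
  proof (intro exI[of _ "\<bar>c\<bar> + 1"] conjI allI)
    fix x :: 'a
    have "\<bar>c\<bar> * 1 \<le> (\<bar>c\<bar> + 1) * exp (\<delta> * (norm x)\<^sup>2)"
      using const by (intro mult_mono) auto
    then show "\<bar>c\<bar> \<le> (\<bar>c\<bar> + 1) * exp (\<delta> * (norm x)\<^sup>2)" by simp
  qed auto
next
  case (add f g)
  obtain C C' where C: "C > 0" "\<And>x. \<bar>f x\<bar> \<le> C * exp (\<delta> * (norm x)\<^sup>2)"
    "C' > 0" "\<And>x. \<bar>g x\<bar> \<le> C' * exp (\<delta> * (norm x)\<^sup>2)"
    using add by metis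
  then show ?case
    by (intro exI[of _ "C + C'"]) (auto simp: distrib_right intro!: order_trans[OF abs_triangle_ineq] add_mono)
next
  case (mult f g)
  obtain C C' where C: "C > 0" "\<And>x. \<bar>f x\<bar> \<le> C * exp (\<delta> / 2 * (norm x)\<^sup>2)"
    "C' > 0" "\<And>x. \<bar>g x\<bar> \<le> C' * exp (\<delta> / 2 * (norm x)\<^sup>2)"
    using mult(3,4)[of "\<delta> / 2"] mult(5) by auto
  show ?case
  proof (intro exI[of _ "C * C'"] conjI allI)
    fix x :: 'a
    have "\<bar>f x * g x\<bar> \<le> (C * exp (\<delta> / 2 * (norm x)\<^sup>2)) * (C' * exp (\<delta> / 2 * (norm x)\<^sup>2))"
      unfolding abs_mult using C by (intro mult_mono) auto
    also have "\<dots> = C * C' * exp (\<delta> * (norm x)\<^sup>2)"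
      by (simp add: mult_exp_exp mult_ac)
    finally show "\<bar>f x * g x\<bar> \<le> C * C' * exp (\<delta> * (norm x)\<^sup>2)" .
  qed (use C in auto)
qed

lemma borel_measurable_rpf:
  "real_polynomial_function (p :: 'a::euclidean_space \<Rightarrow> real) \<Longrightarrow> p \<in> borel_measurable borel"
  by (rule borel_measurable_continuous_onI) (simp add: continuous_on_polymonial_function real_polynomial_function_eq)

text \<open>The product of two square integrable functions is dominated by the sum of their squares;
  this takes the place of the Cauchy-Schwarz inequality.\<close>

lemma square_integrable_gauss_integrable:
  fixes D v :: "real ^ 'd::finite \<Rightarrow> complex"
  assumes D: "square_integrable D" and v[measurable]: "v \<in> borel_measurable borel"
    and "0 < a" and vC: "\<And>x. norm (v x) \<le> C * exp (- a * (norm x)\<^sup>2)"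
  shows "integrable lebesgue (\<lambda>x. D x * v x)"
proof (rule Bochner_Integration.integrable_bound)
  have D': "D \<in> borel_measurable lebesgue" "integrable lebesgue (\<lambda>x. (norm (D x))\<^sup>2)"
    using D by (auto simp: square_integrable_def)
  have v': "v \<in> borel_measurable lebesgue"
    by (simp add: measurable_completion)
  show "(\<lambda>x. D x * v x) \<in> borel_measurable lebesgue"
    using D' v' by simp
  have "integrable lborel (\<lambda>x :: real ^ 'd. C\<^sup>2 * exp (- (2 * a) * (norm x)\<^sup>2))"
    using \<open>0 < a\<close> by (intro integrable_mult_right integrable_gauss_vec) simp
  then have "integrable lebesgue (\<lambda>x :: real ^ 'd. C\<^sup>2 * exp (- (2 * a) * (norm x)\<^sup>2))"
    by (subst integrable_completion) (auto dest: borel_measurable_integrable)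
  then show "integrable lebesgue (\<lambda>x. (norm (D x))\<^sup>2 + C\<^sup>2 * exp (- (2 * a) * (norm x)\<^sup>2))"
    using D' by simp
  show "AE x in lebesgue. norm (D x * v x) \<le> norm ((norm (D x))\<^sup>2 + C\<^sup>2 * exp (- (2 * a) * (norm x)\<^sup>2))"
  proof (rule AE_I2)
    fix x :: "real ^ 'd"
    let ?e = "C * exp (- a * (norm x)\<^sup>2)"
    have sq: "?e\<^sup>2 = C\<^sup>2 * exp (- (2 * a) * (norm x)\<^sup>2)"
      by (simp add: power_mult_distrib power2_eq_square[of "exp _"] mult_exp_exp)
    have "0 \<le> (norm (D x) - ?e)\<^sup>2" "0 \<le> norm (D x) ^ 2 + ?e\<^sup>2" by simp_all
    then have "norm (D x) * ?e \<le> (norm (D x))\<^sup>2 + ?e\<^sup>2"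
      unfolding power2_diff by linarith
    moreover have "norm (D x * v x) \<le> norm (D x) * ?e"
      unfolding norm_mult using vC by (intro mult_left_mono) auto
    ultimately show "norm (D x * v x) \<le> norm ((norm (D x))\<^sup>2 + C\<^sup>2 * exp (- (2 * a) * (norm x)\<^sup>2))"
      unfolding sq[symmetric] by simp
  qed
qed

lemma square_integrable_poly_gauss:
  fixes D :: "real ^ 'd::finite \<Rightarrow> complex"
  assumes D: "square_integrable D" and p: "real_polynomial_function p" and "0 < a"
  shows "integrable lebesgue (\<lambda>x. D x * of_real (p x * exp (- a * (norm x)\<^sup>2)))"
proof -
  \<comment> \<open>Half of the Gaussian decay is spent on the polynomial, the other half
    remains.\<close>
  obtain C where C: "\<And>x. \<bar>p x\<bar> \<le> C * exp (a / 2 * (norm x)\<^sup>2)"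
    using poly_gauss_bound[OF p, of "a / 2"] \<open>0 < a\<close> by auto
  have [measurable]: "p \<in> borel_measurable borel"
    by (rule borel_measurable_rpf[OF p])
  show ?thesis
  proof (rule square_integrable_gauss_integrable[OF D])
    fix x :: "real ^ 'd"
    have "\<bar>p x\<bar> * exp (- a * (norm x)\<^sup>2) \<le> (C * exp (a / 2 * (norm x)\<^sup>2)) * exp (- a * (norm x)\<^sup>2)"
      using C by (intro mult_right_mono) auto
    also have "\<dots> = C * exp (- (a / 2) * (norm x)\<^sup>2)"
      by (simp add: mult.assoc mult_exp_exp)
    finally show "norm (complex_of_real (p x * exp (- a * (norm x)\<^sup>2))) \<le> C * exp (- (a / 2) * (norm x)\<^sup>2)"
      by (simp add: norm_mult abs_mult)
  qed (use \<open>0 < a\<close> in auto)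
qed

lemma rpf_hpoly: "real_polynomial_function f \<Longrightarrow> real_polynomial_function (\<lambda>x. hpoly n (f x))"
proof (induction n rule: less_induct)
  case (less n)
  then show ?case
    by (cases n) (auto intro!: real_polynomial_function.intros(2) real_polynomial_function.intros(4) real_polynomial_function_diff)
qed

lemma rpf_vec_nth: "real_polynomial_function (\<lambda>x :: real ^ 'd::finite. x $ j)"
  by (intro real_polynomial_function.intros(1) bounded_linear_vec_nth)

lemma rpf_hpoly_prod: "real_polynomial_function (\<lambda>x :: real ^ 'd::finite. \<Prod>j\<in>UNIV. hpoly (\<alpha> $ j) (x $ j))"
  by (intro real_polynomial_function_prod rpf_hpoly rpf_vec_nth) auto

lemma hermite_fun_eq:
  fixes \<alpha> :: "'d::finite multi_index"
  shows "\<exists>K>0. \<forall>x. hermite_fun \<alpha> x = K * ((\<Prod>j\<in>UNIV. hpoly (\<alpha> $ j) (x $ j)) * exp (- (1 / 2) * (norm x)\<^sup>2))"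
proof -
  have "hermite_fun \<alpha> x = (\<Prod>j\<in>UNIV. pi powr (- 1 / 4) * (2 ^ (\<alpha> $ j) * fact (\<alpha> $ j)) powr (- 1 / 2))
      * ((\<Prod>j\<in>UNIV. hpoly (\<alpha> $ j) (x $ j)) * exp (- (1 / 2) * (norm x)\<^sup>2))" for x
    by (simp add: hermite_fun_prod hfun_def prod.distrib norm_power2_vec exp_sum sum_divide_distrib flip: sum_negf)
  then show ?thesis
    by (intro exI[of _ "\<Prod>j\<in>UNIV. pi powr (- 1 / 4) * (2 ^ (\<alpha> $ j) * fact (\<alpha> $ j)) powr (- 1 / 2)"])
      (auto intro!: prod_pos)
qed

text \<open>The span is generated inductively so that the vanishing of integrals passes by induction
  from Hermite polynomials to all polynomials.\<close>

inductive hermite_span :: "(real ^ 'd::finite \<Rightarrow> real) \<Rightarrow> bool" where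
  base: "hermite_span (\<lambda>x. c * (\<Prod>j\<in>UNIV. hpoly (\<alpha> $ j) (x $ j)))"
| add: "hermite_span v \<Longrightarrow> hermite_span w \<Longrightarrow> hermite_span (\<lambda>x. v x + w x)"

lemma hermite_span_cmult: "hermite_span v \<Longrightarrow> hermite_span (\<lambda>x. c * v x)"
proof (induction rule: hermite_span.induct)
  case (base c' \<alpha>)
  show ?case using hermite_span.base[of "c * c'" \<alpha>] by (simp add: mult.assoc)
qed (auto simp: distrib_left intro: hermite_span.add)

text \<open>The recurrence solved for the product: \<open>x H_n = H_{n+1} / 2 + n H_{n-1}\<close> in
  the coordinate \<open>i\<close>. The truncated index in \<open>\<alpha>2\<close> is again masked
  by a factor 0.\<close>

lemma hermite_span_nth: "hermite_span v \<Longrightarrow> hermite_span (\<lambda>x. x $ i * v x)"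
proof (induction rule: hermite_span.induct)
  case (base c \<alpha>)
  define \<alpha>1 where "\<alpha>1 = (\<chi> j. if j = i then \<alpha> $ i + 1 else \<alpha> $ j)"
  define \<alpha>2 where "\<alpha>2 = (\<chi> j. if j = i then \<alpha> $ i - 1 else \<alpha> $ j)"
  let ?P = "\<lambda>x :: real ^ 'a. \<Prod>j\<in>UNIV - {i}. hpoly (\<alpha> $ j) (x $ j)"
  have 1: "(\<Prod>j\<in>UNIV. hpoly (\<alpha>1 $ j) (x $ j)) = hpoly (\<alpha> $ i + 1) (x $ i) * ?P x" for x
    by (subst prod.remove[of _ i]) (auto simp: \<alpha>1_def intro!: prod.cong)
  have 2: "(\<Prod>j\<in>UNIV. hpoly (\<alpha>2 $ j) (x $ j)) = hpoly (\<alpha> $ i - 1) (x $ i) * ?P x" for x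
    by (subst prod.remove[of _ i]) (auto simp: \<alpha>2_def intro!: prod.cong)
  have 0: "(\<Prod>j\<in>UNIV. hpoly (\<alpha> $ j) (x $ j)) = hpoly (\<alpha> $ i) (x $ i) * ?P x" for x :: "real ^ 'a"
    by (subst prod.remove[of _ i]) auto
  have "x $ i * (c * (\<Prod>j\<in>UNIV. hpoly (\<alpha> $ j) (x $ j)))
     = c / 2 * (\<Prod>j\<in>UNIV. hpoly (\<alpha>1 $ j) (x $ j))
       + c * real (\<alpha> $ i) * (\<Prod>j\<in>UNIV. hpoly (\<alpha>2 $ j) (x $ j))" for x
    unfolding 0 1 2 by (simp add: algebra_simps)
  then show ?case
    using hermite_span.add[OF hermite_span.base[of "c / 2" \<alpha>1] hermite_span.base[of "c * real (\<alpha> $ i)" \<alpha>2]]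
    by (simp only:)
qed (auto simp: distrib_left intro: hermite_span.add)

lemma hermite_span_0: "hermite_span (\<lambda>x. 0)"
  using hermite_span.base[of 0] by simp

lemma hermite_span_sum: "finite I \<Longrightarrow> (\<And>i. i \<in> I \<Longrightarrow> hermite_span (f i)) \<Longrightarrow> hermite_span (\<lambda>x. \<Sum>i\<in>I. f i x)"
  by (induction I rule: finite_induct) (auto intro: hermite_span_0 hermite_span.add)

text \<open>Carrying the factor \<open>v\<close> along turns the product case into two successive
  multiplications; a linear form is a combination of coordinates.\<close>

lemma hermite_span_poly:
  assumes "real_polynomial_function p" and "hermite_span v"
  shows "hermite_span (\<lambda>x. p x * v x)"
  using assms
proof (induction arbitrary: v)
  case (linear f)
  have "f x * v x = (\<Sum>i\<in>UNIV. f (axis i 1) * (x $ i * v x))" for x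
  proof -
    have "f x = f (\<Sum>i\<in>UNIV. x $ i *\<^sub>R axis i 1)"
      using basis_expansion[of x] by (simp add: scalar_mult_eq_scaleR)
    also have "\<dots> = (\<Sum>i\<in>UNIV. x $ i * f (axis i 1))"
      using linear(1) by (simp add: bounded_linear.linear linear_sum linear_cmul)
    finally show ?thesis by (simp add: sum_distrib_left mult_ac)
  qed
  then show ?case
    by (auto intro!: hermite_span_sum hermite_span_cmult hermite_span_nth linear)
next
  case (const c)
  then show ?case by (rule hermite_span_cmult)
next
  case (add f g)
  then show ?case unfolding distrib_right by (intro hermite_span.add)
next
  case (mult f g)
  then show ?case unfolding mult.assoc by simp
qed

lemma poly_hermite_span: "real_polynomial_function p \<Longrightarrow> hermite_span p"
  using hermite_span_poly[of p "\<lambda>_. 1"] hermite_span.base[of 1 0] by simp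

lemma hermite_span_rpf: "hermite_span v \<Longrightarrow> real_polynomial_function v"
  by (induction rule: hermite_span.induct) (auto intro: rpf_hpoly_prod)

lemma hermite_zero_poly:
  assumes D: "square_integrable D" and 0: "\<And>\<alpha>. hermite_coeff D \<alpha> = 0"
    and p: "real_polynomial_function p"
  shows "(LINT x|lebesgue. D x * of_real (p x * exp (- (1 / 2) * (norm x)\<^sup>2))) = 0"
  using poly_hermite_span[OF p]
proof (induction rule: hermite_span.induct)
  case (base c \<alpha>)
  obtain K where K: "K > 0"
    "\<And>x. hermite_fun \<alpha> x = K * ((\<Prod>j\<in>UNIV. hpoly (\<alpha> $ j) (x $ j)) * exp (- (1 / 2) * (norm x)\<^sup>2))"
    using hermite_fun_eq by blast
  have "D x * of_real (c * (\<Prod>j\<in>UNIV. hpoly (\<alpha> $ j) (x $ j)) * exp (- (1 / 2) * (norm x)\<^sup>2))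
     = of_real (c / K) * (D x * cnj (of_real (hermite_fun \<alpha> x)))" for x
    using K(1) by (simp add: K(2) mult_ac)
  then have "(LINT x|lebesgue. D x * of_real (c * (\<Prod>j\<in>UNIV. hpoly (\<alpha> $ j) (x $ j)) * exp (- (1 / 2) * (norm x)\<^sup>2)))
     = of_real (c / K) * hermite_coeff D \<alpha>"
    unfolding hermite_coeff_def by (simp only: integral_mult_right_zero)
  then show ?case using 0 by simp
next
  case (add v w)
  note i = square_integrable_poly_gauss[OF D hermite_span_rpf, of _ "1 / 2"]
  have "(LINT x|lebesgue. D x * of_real (v x * exp (- (1 / 2) * (norm x)\<^sup>2)) + D x * of_real (w x * exp (- (1 / 2) * (norm x)\<^sup>2))) = 0"
    using add by (subst Bochner_Integration.integral_add[OF i i]) auto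
  then show ?case by (simp add: algebra_simps)
qed

subsection \<open>Completeness of the Hermite functions\<close>

text \<open>As \<open>b < a\<close>, the Taylor polynomials of \<open>exp (- b * (norm x)\<^sup>2)\<close> times \<open>exp (- a * (norm x)\<^sup>2)\<close>
  are dominated by a Gaussian.\<close>

lemma poly_gauss_zero_step:
  fixes D :: "real ^ 'd::finite \<Rightarrow> complex"
  assumes D: "square_integrable D" and ab: "0 < b" "b < a"
    and 0: "\<And>p. real_polynomial_function p \<Longrightarrow>
      (LINT x|lebesgue. D x * of_real (p x * exp (- a * (norm x)\<^sup>2))) = 0"
    and p: "real_polynomial_function p"
  shows "(LINT x|lebesgue. D x * of_real (p x * exp (- (a + b) * (norm x)\<^sup>2))) = 0"
proof -
  define q where "q n x = (\<Sum>i<n. (- b * (norm x)\<^sup>2) ^ i / fact i)" for n and x :: "real ^ 'd"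
  have rpf_norm: "real_polynomial_function (\<lambda>x :: real ^ 'd. (norm x)\<^sup>2)"
    unfolding norm_power2_vec unfolding power2_eq_square
    by (intro real_polynomial_function_sum real_polynomial_function.intros(4) rpf_vec_nth) auto
  have rpf_pow: "real_polynomial_function (\<lambda>x :: real ^ 'd. (- b * (norm x)\<^sup>2) ^ i)" for i
    using rpf_norm by (induction i) (auto intro!: real_polynomial_function.intros(2,4) simp flip: minus_mult_left)
  have rpf_q: "real_polynomial_function (q n)" for n
    unfolding q_def[abs_def] by (intro real_polynomial_function_sum real_polynomial_function_divide rpf_pow) auto
  let ?s = "\<lambda>n x. D x * of_real ((p x * q n x) * exp (- a * (norm x)\<^sup>2))"
  let ?w = "\<lambda>x. norm (D x * of_real (p x * exp (- (a - b) * (norm x)\<^sup>2)))"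
  have lim: "?s n x = D x * of_real (p x * exp (- a * (norm x)\<^sup>2)) * of_real (q n x)" for n x
    by simp
  have "(\<lambda>n. LINT x|lebesgue. ?s n x) \<longlonglongrightarrow> (LINT x|lebesgue. D x * of_real (p x * exp (- (a + b) * (norm x)\<^sup>2)))"
  proof (rule integral_dominated_convergence)
    have [measurable]: "D \<in> borel_measurable lebesgue"
      using D by (simp add: square_integrable_def)
    have [measurable]: "p \<in> borel_measurable lebesgue"
      using borel_measurable_rpf[OF p] by (simp add: measurable_completion)
    have [measurable]: "(norm :: real ^ 'd \<Rightarrow> real) \<in> borel_measurable lebesgue"
      by (simp add: measurable_completion)
    show "(\<lambda>x. D x * of_real (p x * exp (- (a + b) * (norm x)\<^sup>2))) \<in> borel_measurable lebesgue"
      by measurable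
    show "?s n \<in> borel_measurable lebesgue" for n
      unfolding q_def by measurable
    show "integrable lebesgue ?w"
      using ab by (intro integrable_norm square_integrable_poly_gauss[OF D p]) simp
    show "AE x in lebesgue. (\<lambda>n. ?s n x) \<longlonglongrightarrow> D x * of_real (p x * exp (- (a + b) * (norm x)\<^sup>2))"
    proof (rule AE_I2)
      fix x :: "real ^ 'd"
      have "(\<lambda>i. (- b * (norm x)\<^sup>2) ^ i / fact i) sums exp (- b * (norm x)\<^sup>2)"
        using exp_converges[of "- b * (norm x)\<^sup>2"] by (simp add: field_simps)
      then have "(\<lambda>n. q n x) \<longlonglongrightarrow> exp (- b * (norm x)\<^sup>2)"
        by (simp add: sums_def q_def)
      then have "(\<lambda>n. ?s n x) \<longlonglongrightarrow> D x * of_real (p x * exp (- a * (norm x)\<^sup>2)) * of_real (exp (- b * (norm x)\<^sup>2))"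
        unfolding lim by (intro tendsto_intros)
      moreover have "exp (- a * (norm x)\<^sup>2) * exp (- b * (norm x)\<^sup>2) = exp (- (a + b) * (norm x)\<^sup>2)"
        by (simp add: mult_exp_exp algebra_simps)
      ultimately show "(\<lambda>n. ?s n x) \<longlonglongrightarrow> D x * of_real (p x * exp (- (a + b) * (norm x)\<^sup>2))"
        by (simp add: mult.assoc flip: of_real_mult)
    qed
    show "AE x in lebesgue. norm (?s n x) \<le> ?w x" for n
    proof (rule AE_I2)
      fix x :: "real ^ 'd"
      have sm: "summable (\<lambda>i. (b * (norm x)\<^sup>2) ^ i / fact i)"
        using summable_exp[of "b * (norm x)\<^sup>2"] by (simp add: field_simps)
      have "\<bar>q n x\<bar> \<le> (\<Sum>i<n. (b * (norm x)\<^sup>2) ^ i / fact i)"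
        unfolding q_def using ab by (intro order_trans[OF sum_abs]) (auto simp: power_abs abs_mult)
      also have "\<dots> \<le> (\<Sum>i. (b * (norm x)\<^sup>2) ^ i / fact i)"
        using ab by (intro sum_le_suminf sm) auto
      also have "\<dots> = exp (b * (norm x)\<^sup>2)"
        by (simp add: exp_def field_simps)
      finally have "\<bar>q n x\<bar> \<le> exp (b * (norm x)\<^sup>2)" .
      then have "norm (?s n x) \<le> norm (D x) * (\<bar>p x\<bar> * exp (- a * (norm x)\<^sup>2)) * exp (b * (norm x)\<^sup>2)"
        unfolding lim norm_mult by (intro mult_mono) (auto simp: abs_mult norm_mult)
      also have "\<dots> = ?w x"
        by (simp add: norm_mult abs_mult mult.assoc mult_exp_exp algebra_simps)
      finally show "norm (?s n x) \<le> ?w x" .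
    qed
  qed
  moreover have "(LINT x|lebesgue. ?s n x) = 0" for n
    using p rpf_q by (intro 0 real_polynomial_function.intros(4))
  ultimately show ?thesis
    by (simp add: LIMSEQ_const_iff)
qed

text \<open>The exponent starts at 1/2 and never decreases, so an increment of 1/4 always meets the
  condition \<open>b < a\<close> of the single step.\<close>

lemma hermite_zero_poly_gauss:
  assumes D: "square_integrable D" and 0: "\<And>\<alpha>. hermite_coeff D \<alpha> = 0"
    and p: "real_polynomial_function p"
  shows "(LINT x|lebesgue. D x * of_real (p x * exp (- (1 / 2 + real k / 4) * (norm x)\<^sup>2))) = 0"
  using p
proof (induction k arbitrary: p)
  case 0
  then show ?case using hermite_zero_poly[OF D assms(2)] by simp
next
  case (Suc k)
  have "(LINT x|lebesgue. D x * of_real (p x * exp (- ((1 / 2 + real k / 4) + 1 / 4) * (norm x)\<^sup>2))) = 0"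
    by (rule poly_gauss_zero_step[OF D]) (use Suc in auto)
  then show ?case by (simp add: field_simps)
qed

section \<open>An algebra of polynomials times Gaussians\<close>

definition bell :: "real ^ 'd::finite \<Rightarrow> real" where
  "bell x = exp (- (1 / 4) * (norm x)\<^sup>2)"

text \<open>Together with the fixed weight \<open>exp (- |x|^2 / 2)\<close>, the power
  \<open>k\<close> of \<open>bell\<close> gives the exponent \<open>1 / 2 + k / 4\<close>, exactly
  the exponents reached above. Closure under products brings in every polynomial in
  \<open>bell x\<close> and \<open>bell x *\<^sub>R x\<close>.\<close>

inductive bell_span :: "(real ^ 'd::finite \<Rightarrow> real) \<Rightarrow> bool" where
  base: "real_polynomial_function p \<Longrightarrow> bell_span (\<lambda>x. bell x ^ k * p x)"
| add: "bell_span v \<Longrightarrow> bell_span w \<Longrightarrow> bell_span (\<lambda>x. v x + w x)"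

lemma bell_span_mult_base:
  "bell_span v \<Longrightarrow> real_polynomial_function p \<Longrightarrow> bell_span (\<lambda>x. bell x ^ k * p x * v x)"
proof (induction rule: bell_span.induct)
  case (base q l)
  then have "bell_span (\<lambda>x. bell x ^ (k + l) * (p x * q x))"
    by (intro bell_span.base) auto
  then show ?case by (simp add: power_add mult_ac)
next
  case (add v w)
  then show ?case by (auto simp: distrib_left intro: bell_span.add)
qed

lemma bell_span_mult: "bell_span v \<Longrightarrow> bell_span w \<Longrightarrow> bell_span (\<lambda>x. v x * w x)"
proof (induction rule: bell_span.induct)
  case (base p k)
  then show ?case by (intro bell_span_mult_base)
next
  case (add v w)
  then show ?case unfolding distrib_right by (intro bell_span.add)
qed

lemma bell_span_poly:
  fixes g :: "real \<times> (real ^ 'd::finite) \<Rightarrow> real"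
  assumes "real_polynomial_function g"
  shows "bell_span (\<lambda>x. g (bell x, bell x *\<^sub>R x))"
  using assms
proof (induction rule: real_polynomial_function.induct)
  case (linear f)
  then have lf: "linear f" by (rule bounded_linear.linear)
  have e: "f (bell x, bell x *\<^sub>R x) = bell x ^ 1 * f (1, 0) + bell x ^ 1 * f (0, x)" for x
  proof -
    have "(bell x, bell x *\<^sub>R x) = bell x *\<^sub>R (1, 0) + bell x *\<^sub>R (0, x)" by simp
    then show ?thesis by (simp only: linear_add[OF lf] linear_cmul[OF lf]) simp
  qed
  have "bounded_linear (\<lambda>x :: real ^ 'd. (0 :: real, x))"
    by (intro bounded_linear_Pair bounded_linear_zero bounded_linear_ident)
  then have "bounded_linear (\<lambda>x :: real ^ 'd. f (0, x))"
    by (rule bounded_linear_compose[OF linear])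
  then show ?case
    unfolding e by (intro bell_span.intros) auto
next
  case (const c)
  show ?case using bell_span.base[of "\<lambda>_. c" 0] by auto
next
  case (add f g)
  then show ?case by (intro bell_span.add)
next
  case (mult f g)
  then show ?case by (intro bell_span_mult)
qed

lemma bell_span_zero:
  assumes D: "square_integrable D" and 0: "\<And>\<alpha>. hermite_coeff D \<alpha> = 0" and v: "bell_span v"
  shows "integrable lebesgue (\<lambda>x. D x * of_real (exp (- (1 / 2) * (norm x)\<^sup>2)) * of_real (v x)) \<and>
    (LINT x|lebesgue. D x * of_real (exp (- (1 / 2) * (norm x)\<^sup>2)) * of_real (v x)) = 0"
  using v
proof (induction rule: bell_span.induct)
  case (base p k)
  have e: "exp (- (1 / 2) * (norm x)\<^sup>2) * (bell x ^ k * p x) = p x * exp (- (1 / 2 + real k / 4) * (norm x)\<^sup>2)" for x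
    by (simp add: bell_def exp_of_nat_mult[symmetric] mult_exp_exp algebra_simps)
  show ?case
    unfolding mult.assoc of_real_mult[symmetric] e
    using square_integrable_poly_gauss[OF D base, of "1 / 2 + real k / 4"] hermite_zero_poly_gauss[OF D 0 base, of k]
    by simp
next
  case (add v w)
  then show ?case by (simp add: distrib_left)
qed

text \<open>The crude chain \<open>|x| \<le> 1 + |x|^2 \<le> 4 exp (|x|^2 / 4)\<close> suffices; any
  finite bound would give the compact ball required later.\<close>

lemma bell_norm_le: "norm (bell x *\<^sub>R x) \<le> 4"
proof -
  have "0 \<le> (norm x - 1 / 2)\<^sup>2" by simp
  then have "norm x \<le> 1 + (norm x)\<^sup>2"
    by (simp add: power2_diff) (simp add: power2_eq_square)
  also have "\<dots> \<le> 4 * (1 + 1 / 4 * (norm x)\<^sup>2)" by simp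
  also have "\<dots> \<le> 4 * exp (1 / 4 * (norm x)\<^sup>2)"
    by (intro mult_left_mono exp_ge_add_one_self) auto
  finally show ?thesis
    by (simp add: bell_def exp_minus field_simps)
qed

text \<open>A compactly supported function factors through \<open>x \<mapsto> (bell x, bell x *\<^sub>R x)\<close>, whose
  range is relatively compact; this makes Stone-Weierstrass applicable on the whole space.\<close>

lemma hermite_zero_compact_support:
  fixes D :: "real ^ 'd::finite \<Rightarrow> complex" and u :: "real ^ 'd \<Rightarrow> real"
  assumes D: "square_integrable D" and 0: "\<And>\<alpha>. hermite_coeff D \<alpha> = 0"
    and u: "continuous_on UNIV u" and R: "\<And>x. norm x \<ge> R \<Longrightarrow> u x = 0"
  shows "(LINT x|lebesgue. D x * of_real (exp (- (1 / 2) * (norm x)\<^sup>2)) * of_real (u x)) = 0"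
proof -
  let ?W = "\<lambda>x. D x * of_real (exp (- (1 / 2) * (norm x)\<^sup>2))"
  \<comment> \<open>The value of \<open>bell\<close> on the sphere of radius \<open>R\<close>: where
    \<open>bell\<close> is smaller, \<open>u\<close> vanishes.\<close>
  define B where "B = exp (- (1 / 4) * R\<^sup>2)"
  have B: "B > 0" by (simp add: B_def)
  have R': "u x = 0" if "bell x < B" for x
  proof -
    have "R\<^sup>2 < (norm x)\<^sup>2" using that by (simp add: bell_def B_def)
    then have "\<bar>R\<bar> \<le> \<bar>norm x\<bar>" unfolding abs_le_square_iff by simp
    then show ?thesis using R[of x] by simp
  qed
  \<comment> \<open>At a point \<open>(t, y)\<close> of the range, \<open>x\<close> is recovered as
    \<open>y / t\<close>. The maximum keeps the denominator away from 0, which gives continuity;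
    where it differs from \<open>t\<close>, that is for \<open>t < B / 2\<close>, the last factor
    supplies the value 0.\<close>
  define U where "U = (\<lambda>(t, y). u ((1 / max t (B / 2)) *\<^sub>R y) * max 0 (min 1 ((t - B / 2) / (B / 2))))"
  let ?K = "{0..1::real} \<times> cball (0 :: real ^ 'd) 4"
  have K: "(bell x, bell x *\<^sub>R x) \<in> ?K" for x
    using bell_norm_le[of x] by (auto simp: bell_def)
  have Ux: "U (bell x, bell x *\<^sub>R x) = u x" for x
  proof -
    have b: "bell x > 0" by (simp add: bell_def)
    consider "bell x \<ge> B" | "B / 2 \<le> bell x" "bell x < B" | "bell x < B / 2" by linarith
    then show ?thesis
    proof cases
      case 1
      moreover have "(bell x - B / 2) / (B / 2) \<ge> 1" using 1 B by (simp add: field_simps)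
      ultimately show ?thesis using b B by (simp add: U_def max_def min_def)
    next
      case 2
      then show ?thesis using b R'[of x] by (simp add: U_def max_def)
    next
      case 3
      then have "(bell x - B / 2) / (B / 2) < 0" using B by (simp add: field_simps)
      then show ?thesis using 3 B R'[of x] by (simp add: U_def)
    qed
  qed
  have U: "continuous_on ?K U"
    unfolding U_def case_prod_unfold using B
    by (intro continuous_intros continuous_on_compose2[OF u]) (auto simp: max_def)
  have iW: "integrable lebesgue ?W"
    using square_integrable_poly_gauss[OF D real_polynomial_function.intros(2)[of 1], of "1 / 2"] by simp
  define M where "M = (LINT x|lebesgue. norm (?W x))"
  have M: "M \<ge> 0" by (simp add: M_def)
  have iu: "integrable lebesgue (\<lambda>x. ?W x * of_real (u x))"
  proof -
    have "continuous_on (cball 0 R) u" using u continuous_on_subset by blast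
    then obtain C where C: "\<And>x. x \<in> cball 0 R \<Longrightarrow> norm (u x) \<le> C"
      using compact_continuous_image[of "cball 0 R" u] compact_imp_bounded bounded_iff
      by (metis compact_cball image_eqI)
    have uC: "norm (u x) \<le> \<bar>C\<bar>" for x
      using C[of x] R[of x] by (cases "norm x \<ge> R") auto
    show ?thesis
    proof (rule Bochner_Integration.integrable_bound)
      show "integrable lebesgue (\<lambda>x. of_real \<bar>C\<bar> * ?W x)" using iW by (rule integrable_mult_right)
      have [measurable]: "u \<in> borel_measurable lebesgue"
        using borel_measurable_continuous_onI[OF u] by (simp add: measurable_completion)
      show "(\<lambda>x. ?W x * of_real (u x)) \<in> borel_measurable lebesgue"
        using borel_measurable_integrable[OF iW] by simp
      show "AE x in lebesgue. norm (?W x * of_real (u x)) \<le> norm (of_real \<bar>C\<bar> * ?W x)"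
        using uC by (intro AE_I2) (auto simp: norm_mult mult.commute[of "\<bar>C\<bar>"] intro!: mult_left_mono)
    qed
  qed
  \<comment> \<open>Replacing \<open>u\<close> by a polynomial in the two bounded maps costs at most
    \<open>e\<close> uniformly, and the integral with that polynomial vanishes.\<close>
  have le: "norm (LINT x|lebesgue. ?W x * of_real (u x)) \<le> e * M" if e: "e > 0" for e
  proof -
    have "compact ?K" by (intro compact_Times) auto
    then obtain g where g: "real_polynomial_function g" "\<And>z. z \<in> ?K \<Longrightarrow> \<bar>U z - g z\<bar> < e"
      using Stone_Weierstrass_real_polynomial_function[OF _ U e] by metis
    let ?v = "\<lambda>x. g (bell x, bell x *\<^sub>R x)"
    have v: "integrable lebesgue (\<lambda>x. ?W x * of_real (?v x))" "(LINT x|lebesgue. ?W x * of_real (?v x)) = 0"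
      using bell_span_zero[OF D 0 bell_span_poly[OF g(1)]] by auto
    have "norm (LINT x|lebesgue. ?W x * of_real (u x))
        = norm (LINT x|lebesgue. ?W x * of_real (u x) - ?W x * of_real (?v x))"
      using iu v by simp
    also have "\<dots> \<le> (LINT x|lebesgue. norm (?W x * of_real (u x) - ?W x * of_real (?v x)))"
      by (rule integral_norm_bound)
    also have "\<dots> \<le> (LINT x|lebesgue. e * norm (?W x))"
    proof (rule integral_mono)
      fix x :: "real ^ 'd"
      have "\<bar>u x - ?v x\<bar> \<le> e"
        using g(2)[OF K[of x]] by (simp add: Ux)
      then have "norm (?W x) * \<bar>u x - ?v x\<bar> \<le> norm (?W x) * e"
        by (intro mult_left_mono) auto
      then show "norm (?W x * of_real (u x) - ?W x * of_real (?v x)) \<le> e * norm (?W x)"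
        unfolding right_diff_distrib[symmetric] of_real_diff[symmetric] norm_mult[of "?W x"] norm_of_real
        by (simp only: mult.commute[of e])
    qed (use iu v iW in auto)
    also have "\<dots> = e * M" by (simp add: M_def)
    finally show ?thesis .
  qed
  have "norm (LINT x|lebesgue. ?W x * of_real (u x)) \<le> 0 + e" if "e > 0" for e
  proof -
    \<comment> \<open>The summand 1 avoids a division by 0 when \<open>M = 0\<close>.\<close>
    have "e / (M + 1) * M \<le> e" using M that by (simp add: field_simps)
    then show ?thesis
      using le[of "e / (M + 1)"] M that
      by simp
  qed
  then have "norm (LINT x|lebesgue. ?W x * of_real (u x)) \<le> 0"
    by (rule field_le_epsilon)
  then show ?thesis by simp
qed

section \<open>From compactly supported test functions to null sets\<close>

lemma completion_ex_borel_measurable_complex: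
  fixes g :: "'a::euclidean_space \<Rightarrow> complex"
  assumes "g \<in> borel_measurable lebesgue"
  shows "\<exists>g'\<in>borel_measurable borel. (AE x in lborel. g x = g' x)"
proof -
  obtain a where a: "a \<in> borel_measurable lborel" "AE x in lborel. Re (g x) = a x"
    using completion_ex_borel_measurable_real[of "\<lambda>x. Re (g x)" lborel] assms by auto
  obtain b where b: "b \<in> borel_measurable lborel" "AE x in lborel. Im (g x) = b x"
    using completion_ex_borel_measurable_real[of "\<lambda>x. Im (g x)" lborel] assms by auto
  have "AE x in lborel. g x = of_real (a x) + \<i> * of_real (b x)"
    using a(2) b(2) by eventually_elim (simp add: complex_eq_iff)
  then show ?thesis
    using a(1) b(1) by (intro bexI[of _ "\<lambda>x. of_real (a x) + \<i> * of_real (b x)"]) auto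
qed

text \<open>Dynkin's argument: boxes are stable under intersection and generate the Borel sets. The
  whole space is not a box, yet the step to complements uses its integral, hence the separate
  assumption \<open>UN\<close>.\<close>

lemma AE_zero_if_box_integrals_zero:
  fixes W :: "'a::euclidean_space \<Rightarrow> complex"
  assumes W: "integrable lborel W" and UN: "(LINT x|lborel. W x) = 0"
    and box: "\<And>a b. (LINT x:box a b|lborel. W x) = 0"
  shows "AE x in lborel. W x = 0"
proof (rule sigma_finite_measure.density_zero[OF sigma_finite_lborel W])
  have i: "set_integrable lborel A W" if "A \<in> sets borel" for A
    using that W unfolding set_integrable_def by (intro integrable_mult_indicator) auto
  fix A :: "'a set" assume "A \<in> sets lborel"
  then have A: "A \<in> sigma_sets UNIV (range (\<lambda>(a, b). box a b))"
    by (simp add: borel_eq_box)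
  have "Int_stable (range (\<lambda>(a, b). box a b :: 'a set))"
    by (auto simp: Int_stable_def box_Int_box)
  moreover have "range (\<lambda>(a, b). box a b :: 'a set) \<subseteq> Pow UNIV"
    by auto
  moreover note A
  ultimately show "(LINT x:A|lborel. W x) = 0"
  proof (induction rule: sigma_sets_induct_disjoint)
    case (basic A)
    then show ?case using box by auto
  next
    case empty
    show ?case by (simp add: set_lebesgue_integral_def)
  next
    case (compl A)
    then have Ab: "A \<in> sets borel" by (simp add: borel_eq_box)
    have "(LINT x|lborel. W x) = (LINT x:A \<union> (UNIV - A)|lborel. W x)"
      by (simp add: set_lebesgue_integral_def)
    also have "\<dots> = (LINT x:A|lborel. W x) + (LINT x:UNIV - A|lborel. W x)"
      using Ab by (intro set_integral_Un i) auto
    finally show ?case using compl UN by simp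
  next
    case (union A)
    then have Ab: "A i \<in> sets borel" for i by (simp add: borel_eq_box subset_eq)
    have "(LINT x:(\<Union>i. A i)|lborel. W x) = (\<Sum>i. (LINT x:A i|lborel. W x))"
      using Ab union(1) by (intro lebesgue_integral_countable_add i) (auto simp: disjoint_family_on_def)
    then show ?case using union by simp
  qed
qed

text \<open>The box is open, so the distance to its complement is positive inside and the minimum is
  eventually 1; outside the distance is 0. The approximants are continuous and vanish off the
  box.\<close>

lemma box_indicator_limit:
  fixes x :: "'a::euclidean_space"
  shows "(\<lambda>n. min 1 (real n * infdist x (- box a b))) \<longlonglongrightarrow> indicator (box a b) x"
proof (cases "x \<in> box a b")
  case True
  \<comment> \<open>The distance to the empty set is 0 by convention, which would spoil
    positivity.\<close>
  have "- box a b \<noteq> {}" using bounded_box[of a b] by (metis Compl_empty_eq bounded_empty double_compl not_bounded_UNIV)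
  then have pos: "infdist x (- box a b) > 0"
    using True in_closed_iff_infdist_zero[of "- box a b" x] infdist_nonneg[of x "- box a b"]
    by (auto simp: open_box less_le)
  have "eventually (\<lambda>n. real n * infdist x (- box a b) \<ge> 1) sequentially"
    using pos by real_asymp
  then have "eventually (\<lambda>n. min 1 (real n * infdist x (- box a b)) = 1) sequentially"
    by eventually_elim simp
  then show ?thesis using True by (simp add: tendsto_eventually)
qed simp

theorem hermite_complete:
  fixes D :: "real ^ 'd::finite \<Rightarrow> complex"
  assumes D: "square_integrable D" and 0: "\<And>\<alpha>. hermite_coeff D \<alpha> = 0"
  shows "AE x in lebesgue. D x = 0"
proof -
  let ?W = "\<lambda>x. D x * of_real (exp (- (1 / 2) * (norm x)\<^sup>2))"
  have iW: "integrable lebesgue ?W"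
    using square_integrable_poly_gauss[OF D real_polynomial_function.intros(2)[of 1], of "1 / 2"] by simp
  \<comment> \<open>A Borel representative, for which the integrals over Borel sets can be taken
    with \<open>lborel\<close>.\<close>
  obtain W where W [measurable]: "W \<in> borel_measurable borel" and eq: "AE x in lborel. ?W x = W x"
    using completion_ex_borel_measurable_complex[OF borel_measurable_integrable[OF iW]] by blast
  have eq': "AE x in lebesgue. ?W x = W x" using eq by (rule AE_completion)
  have W': "W \<in> borel_measurable lebesgue" by (simp add: measurable_completion)
  have "integrable lebesgue W"
    using integrable_cong_AE[OF borel_measurable_integrable[OF iW] W' eq'] iW by simp
  then have iWl: "integrable lborel W" by (simp add: integrable_completion)
  have cs: "(LINT x|lborel. W x * of_real (u x)) = 0"
    if u: "continuous_on UNIV u" and R: "\<And>x. norm x \<ge> R \<Longrightarrow> u x = 0" for u :: "real ^ 'd \<Rightarrow> real" and R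
  proof -
    have [measurable]: "u \<in> borel_measurable borel" using u by (rule borel_measurable_continuous_onI)
    then have u': "u \<in> borel_measurable lebesgue" by (simp add: measurable_completion)
    have "(LINT x|lborel. W x * of_real (u x)) = (LINT x|lebesgue. W x * of_real (u x))"
      by (rule integral_completion[symmetric]) measurable
    also have "\<dots> = (LINT x|lebesgue. ?W x * of_real (u x))"
    proof (rule integral_cong_AE)
      show "AE x in lebesgue. W x * of_real (u x) = ?W x * of_real (u x)"
        using eq' by eventually_elim simp
    qed (use W' u' borel_measurable_integrable[OF iW] in auto)
    also have "\<dots> = 0" by (rule hermite_zero_compact_support[OF D 0 u R])
    finally show ?thesis .
  qed
  have "AE x in lborel. W x = 0"
  proof (rule AE_zero_if_box_integrals_zero[OF iWl])
    have "(LINT x|lborel. W x) = (LINT x|lebesgue. W x)"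
      by (rule integral_completion[symmetric]) measurable
    also have "\<dots> = (LINT x|lebesgue. ?W x)"
    proof (rule integral_cong_AE)
      show "AE x in lebesgue. W x = ?W x"
        using eq' by eventually_elim simp
    qed (use W' borel_measurable_integrable[OF iW] in auto)
    also have "\<dots> = 0"
      using hermite_zero_poly[OF D 0 real_polynomial_function.intros(2)[of 1]] by simp
    finally show "(LINT x|lborel. W x) = 0" .
  next
    fix a b :: "real ^ 'd"
    let ?u = "\<lambda>n x. min 1 (real n * infdist x (- box a b))"
    have [measurable]: "(\<lambda>x. infdist x (- box a b)) \<in> borel_measurable borel"
      by (intro borel_measurable_continuous_onI continuous_intros)
    have "(\<lambda>n. LINT x|lborel. W x * of_real (?u n x)) \<longlonglongrightarrow> (LINT x|lborel. W x * of_real (indicator (box a b) x))"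
    proof (rule integral_dominated_convergence)
      show "integrable lborel (\<lambda>x. norm (W x))" using iWl by simp
      show "AE x in lborel. (\<lambda>n. W x * of_real (?u n x)) \<longlonglongrightarrow> W x * of_real (indicator (box a b) x)"
        by (intro AE_I2 tendsto_intros box_indicator_limit)
      show "AE x in lborel. norm (W x * of_real (?u n x)) \<le> norm (W x)" for n
      proof (rule AE_I2)
        fix x
        have "\<bar>?u n x\<bar> \<le> 1" by (simp add: infdist_nonneg)
        then show "norm (W x * of_real (?u n x)) \<le> norm (W x)"
          unfolding norm_mult norm_of_real by (simp add: mult_left_le)
      qed
    qed measurable
    moreover have "(LINT x|lborel. W x * of_real (?u n x)) = 0" for n
    proof -
      obtain R where R: "\<And>x. x \<in> box a b \<Longrightarrow> norm x \<le> R"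
        using bounded_box[of a b] by (auto simp: bounded_iff)
      show ?thesis
      proof (rule cs)
        show "continuous_on UNIV (?u n)" by (intro continuous_intros)
        fix x :: "real ^ 'd" assume "norm x \<ge> R + 1"
        then have "x \<in> - box a b" using R[of x] by auto
        then show "?u n x = 0" by simp
      qed
    qed
    ultimately have "(LINT x|lborel. W x * of_real (indicator (box a b) x)) = 0"
      by (simp add: LIMSEQ_const_iff)
    then show "(LINT x:box a b|lborel. W x) = 0"
      by (simp add: set_lebesgue_integral_def scaleR_conv_of_real mult.commute)
  qed
  then have "AE x in lebesgue. W x = 0" by (rule AE_completion)
  \<comment> \<open>The Gaussian weight has no zeros and can be divided out.\<close>
  then show ?thesis using eq' by eventually_elim simp
qed

subsection \<open>Gaussian integrals of Hermite functions\<close>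

text \<open>With \<open>w = y + \<i>\<eta>\<close>, completing the square by
  \<open>x = y / 2 + t / sqrt 2\<close> leaves the standard normal density times an oscillation. Its
  integral is the characteristic function of the normal distribution at
  \<open>\<eta> / sqrt 2\<close>.\<close>

lemma gauss_exp_has_integral:
  fixes w :: complex
  shows "integrable lborel (\<lambda>x :: real. exp (of_real (- x\<^sup>2) + w * of_real x))"
    and "(LINT x|lborel. exp (of_real (- x\<^sup>2) + w * of_real x)) = of_real (sqrt pi) * exp (w\<^sup>2 / 4)"
proof -
  define y \<eta> where "y = Re w" and "\<eta> = Im w"
  have w: "w = of_real y + \<i> * of_real \<eta>" by (simp add: y_def \<eta>_def complex_eq)
  let ?f = "\<lambda>x :: real. exp (of_real (- x\<^sup>2) + w * of_real x)"
  let ?g = "\<lambda>t. std_normal_density t *\<^sub>R iexp (\<eta> / sqrt 2 * t)"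
  let ?c = "of_real (sqrt (2 * pi)) * exp (of_real (y\<^sup>2 / 4) + \<i> * of_real (\<eta> * y / 2)) :: complex"
  have fg: "?f (y / 2 + (1 / sqrt 2) * t) = ?c * ?g t" for t
  proof -
    have s: "(sqrt 2)\<^sup>2 = (2::real)" by simp
    have 1: "- (y / 2 + (1 / sqrt 2) * t)\<^sup>2 + y * (y / 2 + (1 / sqrt 2) * t) = y\<^sup>2 / 4 - t\<^sup>2 / 2"
      by (simp add: power2_sum power_divide field_simps power2_eq_square)
    have "of_real (- (y / 2 + (1 / sqrt 2) * t)\<^sup>2) + w * of_real (y / 2 + (1 / sqrt 2) * t)
       = of_real (- (y / 2 + (1 / sqrt 2) * t)\<^sup>2 + y * (y / 2 + (1 / sqrt 2) * t))
         + \<i> * of_real (\<eta> * (y / 2 + (1 / sqrt 2) * t))"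
      unfolding w by (simp add: algebra_simps) (simp only: add_divide_distrib)
    also have "\<dots> = (of_real (y\<^sup>2 / 4) + \<i> * of_real (\<eta> * y / 2)) + (of_real (- t\<^sup>2 / 2) + \<i> * of_real (\<eta> / sqrt 2 * t))"
      unfolding 1 by (simp add: algebra_simps)
    finally have "?f (y / 2 + (1 / sqrt 2) * t)
       = exp (of_real (y\<^sup>2 / 4) + \<i> * of_real (\<eta> * y / 2)) * (of_real (exp (- t\<^sup>2 / 2)) * iexp (\<eta> / sqrt 2 * t))"
      by (simp only: exp_add exp_of_real)
    then show ?thesis
      by (simp add: std_normal_density_def scaleR_conv_of_real)
  qed
  have ig: "integrable lborel ?g"
  proof (rule Bochner_Integration.integrable_bound)
    show "integrable lborel std_normal_density" by simp
  qed (auto simp: norm_mult)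
  have int_g: "(LINT t|lborel. ?g t) = exp (- \<eta>\<^sup>2 / 4)"
  proof -
    have "char std_normal_distribution (\<eta> / sqrt 2) = (LINT t|lborel. ?g t)"
      unfolding char_def by (subst integral_density) auto
    then show ?thesis
      by (simp add: char_std_normal_distribution power_divide)
  qed
  have ig': "integrable lborel (\<lambda>t. ?f (y / 2 + (1 / sqrt 2) * t))"
    unfolding fg using ig by (intro integrable_mult_right)
  show "integrable lborel ?f"
    using ig' by (subst (asm) lborel_integrable_real_affine_iff) auto
  have "(LINT x|lborel. ?f x) = \<bar>1 / sqrt 2\<bar> *\<^sub>R (LINT t|lborel. ?f (y / 2 + (1 / sqrt 2) * t))"
    by (rule lborel_integral_real_affine) simp
  also have "\<dots> = (1 / sqrt 2) *\<^sub>R (?c * exp (- \<eta>\<^sup>2 / 4))"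
    unfolding fg integral_mult_right_zero int_g by simp
  also have "\<dots> = of_real (sqrt pi) * (exp (of_real (y\<^sup>2 / 4) + \<i> * of_real (\<eta> * y / 2)) * exp (of_real (- \<eta>\<^sup>2 / 4)))"
    unfolding exp_of_real[of "- \<eta>\<^sup>2 / 4"] by (simp add: scaleR_conv_of_real real_sqrt_mult)
  also have "\<dots> = of_real (sqrt pi) * exp (w\<^sup>2 / 4)"
  proof -
    have "(of_real (y\<^sup>2 / 4) + \<i> * of_real (\<eta> * y / 2)) + of_real (- \<eta>\<^sup>2 / 4) = w\<^sup>2 / 4"
      unfolding w by (simp add: power2_sum power_mult_distrib field_simps)
    then show ?thesis by (simp only: exp_add[symmetric])
  qed
  finally show "(LINT x|lborel. ?f x) = of_real (sqrt pi) * exp (w\<^sup>2 / 4)" .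
qed

lemma hpoly_gauss_bound:
  fixes w :: complex
  shows "\<exists>C>0. \<forall>t. norm (of_real (hpoly n t) * exp (of_real (- t\<^sup>2) + w * of_real t)) \<le> C * exp (- (1 / 2) * t\<^sup>2)"
proof -
  obtain C where C: "C > 0" "\<And>t. \<bar>hpoly n t\<bar> \<le> C * exp (1 / 4 * (norm t)\<^sup>2)"
    using poly_gauss_bound[OF rpf_hpoly[OF real_polynomial_function.intros(1)[OF bounded_linear_ident]], of "1 / 4" n]
    by auto
  show ?thesis
  proof (intro exI[of _ "C * exp ((Re w)\<^sup>2)"] conjI allI)
    fix t :: real
    \<comment> \<open>Of the decay \<open>exp (- t^2)\<close>, one quarter of the exponent absorbs
      the polynomial and another quarter the linear term \<open>Re w * t\<close>; half of it is
      left.\<close>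
    have "0 \<le> (Re w - t / 2)\<^sup>2" by simp
    then have "1 / 4 * t\<^sup>2 + (- t\<^sup>2 + Re w * t) \<le> (Re w)\<^sup>2 + (- (1 / 2) * t\<^sup>2)"
      by (simp add: power2_diff power_divide field_simps)
    then have "exp (1 / 4 * t\<^sup>2 + (- t\<^sup>2 + Re w * t)) \<le> exp ((Re w)\<^sup>2 + (- (1 / 2) * t\<^sup>2))" by simp
    then have e: "C * (exp (1 / 4 * t\<^sup>2) * exp (- t\<^sup>2 + Re w * t)) \<le> C * (exp ((Re w)\<^sup>2) * exp (- (1 / 2) * t\<^sup>2))"
      using C by (simp only: exp_add) simp
    have "norm (of_real (hpoly n t) * exp (of_real (- t\<^sup>2) + w * of_real t)) = \<bar>hpoly n t\<bar> * exp (- t\<^sup>2 + Re w * t)"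
      by (simp add: norm_mult)
    also have "\<dots> \<le> (C * exp (1 / 4 * t\<^sup>2)) * exp (- t\<^sup>2 + Re w * t)"
      using C(2)[of t] by (intro mult_right_mono) auto
    also have "\<dots> \<le> C * exp ((Re w)\<^sup>2) * exp (- (1 / 2) * t\<^sup>2)"
      using e by (simp only: mult.assoc)
    finally show "norm (of_real (hpoly n t) * exp (of_real (- t\<^sup>2) + w * of_real t)) \<le> C * exp ((Re w)\<^sup>2) * exp (- (1 / 2) * t\<^sup>2)" .
  qed (use C in auto)
qed

lemma hpoly_gauss_integrable:
  fixes w :: complex
  shows "integrable lborel (\<lambda>t. of_real (hpoly n t) * exp (of_real (- t\<^sup>2) + w * of_real t))"
proof -
  obtain C where C: "C > 0" "\<And>t. norm (of_real (hpoly n t) * exp (of_real (- t\<^sup>2) + w * of_real t)) \<le> C * exp (- (1 / 2) * t\<^sup>2)"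
    using hpoly_gauss_bound by blast
  show ?thesis
  proof (rule Bochner_Integration.integrable_bound)
    show "integrable lborel (\<lambda>t :: real. C * exp (- (1 / 2) * t\<^sup>2))"
      by (intro integrable_mult_right integrable_gauss_real) simp
    show "AE t in lborel. norm (of_real (hpoly n t) * exp (of_real (- t\<^sup>2) + w * of_real t)) \<le> norm (C * exp (- (1 / 2) * t\<^sup>2))"
      using C by (intro AE_I2) (metis abs_of_nonneg norm_ge_zero order_trans real_norm_def)
  qed measurable
qed

text \<open>From \<open>H_n' - 2 t H_n = - H_{n+1}\<close>, the function \<open>?f\<close> is the
  derivative of \<open>?F\<close>, which vanishes at both infinities. So its integral is 0, and
  raising the index by one multiplies the integral by \<open>w\<close>.\<close>

lemma hpoly_gauss_integral:
  fixes w :: complex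
  shows "(LINT t|lborel. of_real (hpoly n t) * exp (of_real (- t\<^sup>2) + w * of_real t))
    = w ^ n * (of_real (sqrt pi) * exp (w\<^sup>2 / 4))"
proof (induction n)
  case 0
  then show ?case using gauss_exp_has_integral[of w] by simp
next
  case (Suc n)
  let ?E = "\<lambda>t :: real. exp (of_real (- t\<^sup>2) + w * of_real t)"
  let ?F = "\<lambda>t. of_real (hpoly n t) * ?E t"
  let ?f = "\<lambda>t. w * (of_real (hpoly n t) * ?E t) - of_real (hpoly (Suc n) t) * ?E t"
  obtain C where C: "C > 0" "\<And>t. norm (?F t) \<le> C * exp (- (1 / 2) * t\<^sup>2)"
    using hpoly_gauss_bound by blast
  have int: "integrable lborel ?f"
    by (intro Bochner_Integration.integrable_diff integrable_mult_right hpoly_gauss_integrable)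
  have "(LBINT t=-\<infinity>..\<infinity>. ?f t) = 0 - 0"
  proof (rule interval_integral_FTC_integrable)
    fix t :: real
    have "(?F has_vector_derivative
       (of_real (hpoly n t) * (?E t * (of_real (- (2 * t)) + w)) + of_real (2 * real n * hpoly (n - 1) t) * ?E t)) (at t)"
    proof -
      have 1: "((\<lambda>t. of_real (hpoly n t) :: complex) has_vector_derivative of_real (2 * real n * hpoly (n - 1) t)) (at t)"
        by (rule has_vector_derivative_of_real[OF hpoly_deriv])
      have "((\<lambda>t :: real. - t\<^sup>2) has_field_derivative - (2 * t)) (at t)"
        by (rule derivative_eq_intros refl | simp)+
      then have 2: "((\<lambda>t. of_real (- t\<^sup>2) :: complex) has_vector_derivative of_real (- (2 * t))) (at t)"
        by (rule has_vector_derivative_of_real)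
      have 3: "((\<lambda>t. w * of_real t) has_vector_derivative w * of_real 1) (at t)"
        by (intro has_vector_derivative_mult_right has_vector_derivative_of_real DERIV_ident)
      have "((\<lambda>t. of_real (- t\<^sup>2) + w * of_real t) has_vector_derivative (of_real (- (2 * t)) + w)) (at t)"
        using has_vector_derivative_add[OF 2 3] by simp
      from field_vector_diff_chain_at[OF this DERIV_exp]
      have "(?E has_vector_derivative (?E t * (of_real (- (2 * t)) + w))) (at t)"
        by (simp add: o_def mult.commute)
      from has_vector_derivative_mult[OF 1 this] show ?thesis .
    qed
    moreover have "of_real (hpoly n t) * (?E t * (of_real (- (2 * t)) + w)) + of_real (2 * real n * hpoly (n - 1) t) * ?E t = ?f t"
      by (simp add: algebra_simps)
    ultimately show "(?F has_vector_derivative ?f t) (at t)" by metis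
    show "isCont ?f t"
      using continuous_hpoly[of UNIV] by (intro continuous_intros) (auto simp: continuous_on_eq_continuous_at)
  next
    show "set_integrable lborel (einterval (-\<infinity>) \<infinity>) ?f"
      using int by (simp add: set_integrable_def)
    have "((\<lambda>t. C * exp (- (1 / 2) * t\<^sup>2)) \<longlongrightarrow> 0) at_bot" by real_asymp
    then have "(?F \<longlongrightarrow> 0) at_bot"
      by (rule Lim_null_comparison[rotated]) (use C in auto)
    then show "((?F \<circ> real_of_ereal) \<longlongrightarrow> 0) (at_right (-\<infinity>))"
      by (simp add: ereal_tendsto_simps)
    have "((\<lambda>t. C * exp (- (1 / 2) * t\<^sup>2)) \<longlongrightarrow> 0) at_top" by real_asymp
    then have "(?F \<longlongrightarrow> 0) at_top"
      by (rule Lim_null_comparison[rotated]) (use C in auto)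
    then show "((?F \<circ> real_of_ereal) \<longlongrightarrow> 0) (at_left \<infinity>)"
      by (simp add: ereal_tendsto_simps)
  qed simp
  then have "(LINT t|lborel. ?f t) = 0"
    by (simp add: interval_lebesgue_integral_def set_lebesgue_integral_def)
  then have "w * (LINT t|lborel. ?F t) - (LINT t|lborel. of_real (hpoly (Suc n) t) * ?E t) = 0"
    by (simp only: Bochner_Integration.integral_diff[OF integrable_mult_right[OF hpoly_gauss_integrable]
        hpoly_gauss_integrable] integral_mult_right_zero)
  then show ?case using Suc.IH by (simp add: mult.assoc)
qed

subsection \<open>Isometries preserve Lebesgue measure\<close>

text \<open>The image measure is translation invariant, hence a multiple of Lebesgue measure by Fubini;
  the unit ball determines the factor.\<close>

lemma lborel_distr_isometry:
  fixes T :: "'a::euclidean_space \<Rightarrow> 'b::euclidean_space"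
  assumes T: "linear T" and iso: "\<And>x. norm (T x) = norm x" and dim: "DIM('a) = DIM('b)"
  shows "distr lborel borel T = lborel"
proof -
  have [measurable]: "T \<in> borel_measurable borel"
    using T by (intro borel_measurable_continuous_onI linear_continuous_on)
      (simp add: linear_conv_bounded_linear)
  have inj: "inj T"
    using T iso by (simp add: linear_injective_0) (metis norm_eq_zero)
  have surj: "surj T"
  proof -
    have "dim (range T) = DIM('b)"
      using dim_image_eq[OF T, of UNIV] inj dim by (simp add: inj_on_subset)
    then show ?thesis
      using dim_eq_full linear_subspace_image[OF T subspace_UNIV] span_eq_iff by metis
  qed
  \<comment> \<open>The condition on \<open>c\<close> covers both the translations and the
    reflection used below.\<close>
  have nn_aff: "(\<integral>\<^sup>+x. f (a + c *\<^sub>R x) \<partial>lborel) = (\<integral>\<^sup>+x. f x \<partial>lborel)"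
    if [measurable]: "f \<in> borel_measurable borel" and c: "\<bar>c\<bar> = 1"
    for f :: "'c::euclidean_space \<Rightarrow> ennreal" and a c
  proof -
    have "c \<noteq> 0" using c by auto
    then have "(\<integral>\<^sup>+x. f x \<partial>lborel)
       = (\<integral>\<^sup>+x. f x \<partial>density (distr lborel borel (\<lambda>x. a + c *\<^sub>R x)) (\<lambda>_. \<bar>c\<bar>^DIM('c)))"
      using lborel_affine[of c a] by simp
    then show ?thesis
      using c by (simp add: nn_integral_density nn_integral_distr)
  qed
  let ?M = "distr lborel borel T"
  show ?thesis
  proof (rule measure_eqI)
    fix A assume "A \<in> sets ?M"
    then have A[measurable]: "A \<in> sets borel" by simp
    define B where "B = ball (0::'b) 1"
    have [measurable]: "B \<in> sets borel" by (simp add: B_def)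
    have TB: "T -` B = ball 0 1"
      by (auto simp: B_def iso)
    have mB: "emeasure ?M B = emeasure lborel B"
      using dim by (simp add: emeasure_distr TB) (simp add: B_def emeasure_ball)
    have M: "emeasure ?M C = (\<integral>\<^sup>+x. indicator C (T x) \<partial>lborel)"
      if [measurable]: "C \<in> sets borel" for C
    proof -
      have "emeasure ?M C = (\<integral>\<^sup>+x. indicator C x \<partial>?M)" by simp
      also have "\<dots> = (\<integral>\<^sup>+x. indicator C (T x) \<partial>lborel)" by (rule nn_integral_distr) measurable
      finally show ?thesis .
    qed
    \<comment> \<open>The classical uniqueness argument for invariant measures: translating
      \<open>x\<close> by a preimage of \<open>y\<close>, then \<open>y\<close> by
      \<open>T x\<close>, and finally reflecting \<open>x\<close> exchanges the measures in which
      \<open>A\<close> and \<open>B\<close> are taken.\<close>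
    have "emeasure ?M A * emeasure lborel B
       = (\<integral>\<^sup>+y. (\<integral>\<^sup>+x. indicator A (T x) * indicator B y \<partial>lborel) \<partial>lborel)"
      by (simp add: nn_integral_multc nn_integral_cmult nn_integral_cmult_indicator M)
    also have "\<dots> = (\<integral>\<^sup>+y. (\<integral>\<^sup>+x. indicator A (T x + y) * indicator B y \<partial>lborel) \<partial>lborel)"
    proof (rule nn_integral_cong)
      fix y :: 'b
      obtain z where z: "y = T z" using surj by auto
      have "(\<integral>\<^sup>+x. indicator A (T x) * indicator B y \<partial>lborel)
        = (\<integral>\<^sup>+x. indicator A (T (z + 1 *\<^sub>R x)) * indicator B y \<partial>lborel)"
        by (subst nn_aff) auto
      then show "(\<integral>\<^sup>+x. indicator A (T x) * indicator B y \<partial>lborel)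
        = (\<integral>\<^sup>+x. indicator A (T x + y) * indicator B y \<partial>lborel)"
        by (simp add: z linear_add[OF T] add.commute)
    qed
    also have "\<dots> = (\<integral>\<^sup>+x. (\<integral>\<^sup>+y. indicator A (T x + y) * indicator B y \<partial>lborel) \<partial>lborel)"
      by (rule lborel_pair.Fubini') measurable
    also have "\<dots> = (\<integral>\<^sup>+x. (\<integral>\<^sup>+y. indicator A y * indicator B (y - T x) \<partial>lborel) \<partial>lborel)"
    proof (rule nn_integral_cong)
      fix x :: 'a
      have "(\<integral>\<^sup>+y. indicator A y * indicator B (y - T x) \<partial>lborel)
        = (\<integral>\<^sup>+y. indicator A (T x + 1 *\<^sub>R y) * indicator B (T x + 1 *\<^sub>R y - T x) \<partial>lborel)"
        by (subst nn_aff[of "\<lambda>y. indicator A y * indicator B (y - T x)"]) auto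
      then show "(\<integral>\<^sup>+y. indicator A (T x + y) * indicator B y \<partial>lborel)
        = (\<integral>\<^sup>+y. indicator A y * indicator B (y - T x) \<partial>lborel)"
        by simp
    qed
    also have "\<dots> = (\<integral>\<^sup>+y. (\<integral>\<^sup>+x. indicator A y * indicator B (y - T x) \<partial>lborel) \<partial>lborel)"
      by (rule lborel_pair.Fubini') measurable
    also have "\<dots> = (\<integral>\<^sup>+y. (\<integral>\<^sup>+x. indicator A y * indicator B (T x) \<partial>lborel) \<partial>lborel)"
    proof (rule nn_integral_cong)
      fix y :: 'b
      obtain z where z: "y = T z" using surj by auto
      have "(\<integral>\<^sup>+x. indicator A y * indicator B (T x) \<partial>lborel)
        = (\<integral>\<^sup>+x. indicator A y * indicator B (T (z + (-1) *\<^sub>R x)) \<partial>lborel)"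
        by (subst nn_aff[of "\<lambda>x. indicator A y * indicator B (T x)"]) auto
      then show "(\<integral>\<^sup>+x. indicator A y * indicator B (y - T x) \<partial>lborel)
        = (\<integral>\<^sup>+x. indicator A y * indicator B (T x) \<partial>lborel)"
        by (simp add: z linear_diff[OF T])
    qed
    also have "\<dots> = emeasure lborel A * emeasure ?M B"
      by (simp add: nn_integral_multc nn_integral_cmult nn_integral_cmult_indicator M)
    finally have eq: "emeasure ?M A * emeasure lborel B = emeasure lborel A * emeasure lborel B"
      by (simp only: mB)
    have "emeasure lborel B \<noteq> 0" "emeasure lborel B \<noteq> \<infinity>"
      using unit_ball_vol_pos[of "real DIM('b)", THEN less_imp_neq] by (auto simp: B_def emeasure_ball)
    then show "emeasure ?M A = emeasure lborel A"
      using eq by (auto simp: mult.commute[of _ "emeasure lborel B"] ennreal_mult_cancel_left)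
  qed simp
qed

subsection \<open>The weights \<open>theta\<close>\<close>

text \<open>A finite set of multi-indices lies in a cube, and over a cube the sum of products is a
  product of sums.\<close>

lemma summable_on_prod_vec:
  fixes f :: "nat \<Rightarrow> real"
  assumes f: "\<And>n. 0 \<le> f n" and sum: "summable f"
  shows "(\<lambda>\<alpha> :: 'd::finite multi_index. \<Prod>j\<in>UNIV. f (\<alpha> $ j)) summable_on UNIV"
proof (rule nonneg_bdd_above_summable_on)
  show "0 \<le> (\<Prod>j\<in>UNIV. f (\<alpha> $ j))" for \<alpha> :: "'d multi_index"
    using f by (simp add: prod_nonneg)
  show "bdd_above (sum (\<lambda>\<alpha> :: 'd multi_index. \<Prod>j\<in>UNIV. f (\<alpha> $ j)) ` {F. F \<subseteq> UNIV \<and> finite F})"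
  proof (rule bdd_aboveI2)
    fix F :: "'d multi_index set" assume "F \<in> {F. F \<subseteq> UNIV \<and> finite F}"
    then have fin: "finite F" by simp
    \<comment> \<open>The sum of all lengths is a crude common bound for the entries.\<close>
    define N where "N = (\<Sum>\<alpha>\<in>F. mi_length \<alpha>)"
    have N: "\<alpha> $ j \<le> N" if "\<alpha> \<in> F" for \<alpha> j
      using member_le_sum[of \<alpha> F mi_length] member_le_sum[of j UNIV "\<lambda>j. \<alpha> $ j"] that fin
      unfolding N_def mi_length_def by simp
    have "(\<Sum>\<alpha>\<in>F. \<Prod>j\<in>UNIV. f (\<alpha> $ j)) = (\<Sum>g\<in>(\<lambda>\<alpha> j. \<alpha> $ j) ` F. \<Prod>j\<in>UNIV. f (g j))"
      by (subst sum.reindex) (auto simp: inj_on_def vec_eq_iff fun_eq_iff)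
    also have "\<dots> \<le> (\<Sum>g\<in>PiE (UNIV::'d set) (\<lambda>_. {..N}). \<Prod>j\<in>UNIV. f (g j))"
      by (rule sum_mono2) (use N f in \<open>auto simp: finite_PiE prod_nonneg\<close>)
    also have "\<dots> = (\<Prod>j\<in>(UNIV::'d set). \<Sum>n\<le>N. f n)"
      by (rule prod_sum_PiE[symmetric]) auto
    also have "\<dots> \<le> (\<Prod>j\<in>(UNIV::'d set). suminf f)"
      using f sum by (intro prod_mono) (auto simp: sum_nonneg intro!: sum_le_suminf)
    finally show "(\<Sum>\<alpha>\<in>F. \<Prod>j\<in>UNIV. f (\<alpha> $ j)) \<le> (\<Prod>j\<in>(UNIV::'d set). suminf f)" .
  qed
qed

text \<open>The logarithm of the left side is at most \<open>n ln n + n ln R\<close>, which is of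
  smaller order than \<open>n powr p\<close> as soon as \<open>p > 1\<close>. With
  \<open>p = 1 / (2 s)\<close> this is where \<open>s < 1 / 2\<close> acts.\<close>

lemma fact_growth_bound:
  fixes \<epsilon> R p :: real
  assumes "0 < \<epsilon>" "0 < R" "1 < p"
  shows "\<exists>C>0. \<forall>n. fact n * R ^ n \<le> C * exp (\<epsilon> * real n powr p)"
proof -
  have "eventually (\<lambda>x :: real. x * ln x + x * ln R \<le> \<epsilon> * x powr p) at_top"
    using assms by real_asymp
  then have "eventually (\<lambda>n. real n * ln (real n) + real n * ln R \<le> \<epsilon> * real n powr p) sequentially"
    using filterlim_real_sequentially by (rule eventually_compose_filterlim)
  then obtain N where N: "\<And>n. n \<ge> N \<Longrightarrow> real n * ln (real n) + real n * ln R \<le> \<epsilon> * real n powr p"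
    by (auto simp: eventually_sequentially)
  have le1: "fact n * R ^ n \<le> exp (\<epsilon> * real n powr p)" if "n \<ge> N" "n > 0" for n
  proof -
    have "fact n * R ^ n \<le> real n ^ n * R ^ n"
      using assms fact_le_power[of n, where 'a=real] by (intro mult_right_mono) auto
    also have "\<dots> = exp (real n * ln (real n) + real n * ln R)"
      using that assms by (simp add: exp_add exp_of_nat_mult)
    also have "\<dots> \<le> exp (\<epsilon> * real n powr p)"
      using N that by simp
    finally show ?thesis .
  qed
  \<comment> \<open>The sum covers the indices up to \<open>N\<close>, the summand 1 the later
    ones.\<close>
  define C where "C = 1 + (\<Sum>n\<le>N. fact n * R ^ n)"
  have nn: "0 \<le> (\<Sum>n\<le>N. fact n * R ^ n)"
    using assms by (intro sum_nonneg) auto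
  show ?thesis
  proof (intro exI[of _ C] conjI allI)
    show "0 < C" using nn by (simp add: C_def)
    fix n
    have 1: "1 \<le> exp (\<epsilon> * real n powr p)"
      using assms by simp
    show "fact n * R ^ n \<le> C * exp (\<epsilon> * real n powr p)"
    proof (cases "n \<le> N")
      case True
      then have "fact n * R ^ n \<le> (\<Sum>n\<le>N. fact n * R ^ n)"
        using assms by (intro member_le_sum) auto
      then have "fact n * R ^ n \<le> C" by (simp add: C_def)
      also have "\<dots> \<le> C * exp (\<epsilon> * real n powr p)"
        using 1 nn by (simp add: C_def)
      finally show ?thesis .
    next
      case False
      then have "fact n * R ^ n \<le> 1 * exp (\<epsilon> * real n powr p)"
        using le1[of n] by simp
      also have "\<dots> \<le> C * exp (\<epsilon> * real n powr p)"
        using nn by (intro mult_right_mono) (auto simp: C_def)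
      finally show ?thesis .
    qed
  qed
qed

text \<open>Half of the exponent of \<open>theta\<close> is sacrificed to the factorials and powers;
  the other half is the exponent that belongs to the doubled \<open>r\<close>.\<close>

lemma theta_factorial_bound:
  fixes r :: "real ^ 'd::finite"
  assumes r: "pos_vec r" and s: "0 < s" "s < 1 / 2" and R: "0 < R"
  shows "\<exists>C>0. \<forall>\<alpha>. theta s r \<alpha> * (mi_fact \<alpha> * R ^ mi_length \<alpha>) \<le> C * theta s (2 *\<^sub>R r) \<alpha>"
proof -
  let ?p = "1 / (2 * s)"
  have "\<exists>C>0. \<forall>n. fact n * R ^ n \<le> C * exp (1 / (2 * r $ j) * real n powr ?p)" for j
    using r s R by (intro fact_growth_bound) (auto simp: pos_vec_def)
  then obtain C where C: "\<And>j. 0 < C j"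
    "\<And>j n. fact n * R ^ n \<le> C j * exp (1 / (2 * r $ j) * real n powr ?p)"
    by metis
  show ?thesis
  proof (intro exI[of _ "\<Prod>j\<in>UNIV. C j"] conjI allI)
    show "0 < (\<Prod>j\<in>UNIV. C j)" using C by (simp add: prod_pos)
    fix \<alpha> :: "'d multi_index"
    have "mi_fact \<alpha> * R ^ mi_length \<alpha> = (\<Prod>j\<in>UNIV. fact (\<alpha> $ j) * R ^ (\<alpha> $ j))"
      by (simp add: mi_fact_def mi_length_def power_sum prod.distrib)
    also have "\<dots> \<le> (\<Prod>j\<in>UNIV. C j * exp (1 / (2 * r $ j) * real (\<alpha> $ j) powr ?p))"
      using C R by (intro prod_mono) auto
    also have "\<dots> = (\<Prod>j\<in>UNIV. C j) * exp (\<Sum>j\<in>UNIV. 1 / (2 * r $ j) * real (\<alpha> $ j) powr ?p)"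
      by (simp add: prod.distrib exp_sum)
    finally have "theta s r \<alpha> * (mi_fact \<alpha> * R ^ mi_length \<alpha>)
       \<le> theta s r \<alpha> * ((\<Prod>j\<in>UNIV. C j) * exp (\<Sum>j\<in>UNIV. 1 / (2 * r $ j) * real (\<alpha> $ j) powr ?p))"
      by (intro mult_left_mono) (auto simp: theta_def)
    also have "\<dots> = (\<Prod>j\<in>UNIV. C j) * theta s (2 *\<^sub>R r) \<alpha>"
    proof -
      have 1: "(\<Sum>j\<in>UNIV. 1 / r $ j * real (\<alpha> $ j) powr ?p)
         = 2 * (\<Sum>j\<in>UNIV. 1 / (2 * r $ j) * real (\<alpha> $ j) powr ?p)"
        by (simp add: sum_distrib_left)
      show ?thesis
        unfolding theta_def 1
        by (simp add: mult_exp_exp mult.left_commute)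
    qed
    finally show "theta s r \<alpha> * (mi_fact \<alpha> * R ^ mi_length \<alpha>) \<le> (\<Prod>j\<in>UNIV. C j) * theta s (2 *\<^sub>R r) \<alpha>" .
  qed
qed

lemma theta_le_1: "pos_vec r \<Longrightarrow> theta s r \<alpha> \<le> 1"
  unfolding theta_def pos_vec_def by (auto intro!: sum_nonneg divide_nonneg_nonneg dest: less_imp_le)

lemma mi_fact_pos: "0 < mi_fact \<alpha>"
  by (simp add: mi_fact_def prod_pos)

lemma mi_fact_ge_1: "1 \<le> mi_fact \<alpha>"
  by (simp add: mi_fact_def prod_ge_1)

lemma theta_power_summable:
  fixes r :: "real ^ 'd::finite"
  assumes r: "pos_vec r" and s: "0 < s" "s < 1 / 2" and R: "0 < R"
  shows "(\<lambda>\<alpha>. theta s r \<alpha> * R ^ mi_length \<alpha>) summable_on UNIV"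
proof -
  \<comment> \<open>Doubling the base leaves a spare factor \<open>2 ^ mi_length \<alpha>\<close>,
    whose inverse is summable.\<close>
  obtain C where C: "C > 0" "\<And>\<alpha>. theta s r \<alpha> * (mi_fact \<alpha> * (2 * R) ^ mi_length \<alpha>) \<le> C * theta s (2 *\<^sub>R r) \<alpha>"
    using theta_factorial_bound[OF r s, of "2 * R"] R by auto
  have pos2: "pos_vec (2 *\<^sub>R r)" using r by (simp add: pos_vec_def)
  have le: "theta s r \<alpha> * R ^ mi_length \<alpha> \<le> C * (\<Prod>j\<in>UNIV. (1 / 2) ^ (\<alpha> $ j))" for \<alpha>
  proof -
    have "theta s r \<alpha> * R ^ mi_length \<alpha> * 2 ^ mi_length \<alpha>
        \<le> theta s r \<alpha> * R ^ mi_length \<alpha> * 2 ^ mi_length \<alpha> * mi_fact \<alpha>"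
      using mi_fact_ge_1[of \<alpha>] R by (simp add: theta_def)
    also have "\<dots> \<le> C * theta s (2 *\<^sub>R r) \<alpha>"
      using C(2)[of \<alpha>] by (simp add: power_mult_distrib mult_ac)
    also have "\<dots> \<le> C * 1"
      using C(1) theta_le_1[OF pos2, of s \<alpha>] by (intro mult_left_mono) auto
    finally have "theta s r \<alpha> * R ^ mi_length \<alpha> \<le> C / 2 ^ mi_length \<alpha>"
      by (simp add: field_simps)
    also have "\<dots> = C * (\<Prod>j\<in>UNIV. (1 / 2) ^ (\<alpha> $ j))"
      by (simp add: mi_length_def power_sum prod_dividef power_one_over)
    finally show ?thesis .
  qed
  have "(\<lambda>\<alpha> :: 'd multi_index. C * (\<Prod>j\<in>UNIV. (1 / 2) ^ (\<alpha> $ j))) summable_on UNIV"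
    by (intro summable_on_cmult_right summable_on_prod_vec) (auto intro!: summable_geometric)
  then show ?thesis
    by (rule summable_on_comparison_test) (use le R in \<open>auto simp: theta_def\<close>)
qed

subsection \<open>Time-frequency shifts of the Gaussian\<close>

definition reT :: "complex ^ 'd \<Rightarrow> real ^ 'd" where "reT w = (\<chi> j. Re (w $ j))"
definition imT :: "complex ^ 'd \<Rightarrow> real ^ 'd" where "imT w = (\<chi> j. Im (w $ j))"
definition cnjT :: "complex ^ 'd \<Rightarrow> complex ^ 'd" where "cnjT w = (\<chi> j. cnj (w $ j))"

lemma reT_nth [simp]: "reT w $ j = Re (w $ j)" by (simp add: reT_def)
lemma imT_nth [simp]: "imT w $ j = Im (w $ j)" by (simp add: imT_def)
lemma cnjT_nth [simp]: "cnjT w $ j = cnj (w $ j)" by (simp add: cnjT_def)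

lemma continuous_reT [continuous_intros]: "continuous_on A reT"
  unfolding reT_def[abs_def] by (intro continuous_intros)
lemma continuous_imT [continuous_intros]: "continuous_on A imT"
  unfolding imT_def[abs_def] by (intro continuous_intros)
lemma continuous_cnjT [continuous_intros]: "continuous_on A cnjT"
  unfolding cnjT_def[abs_def] by (intro continuous_intros)

lemma measurable_reT [measurable]: "reT \<in> borel_measurable (borel :: (complex ^ 'd::finite) measure)"
  by (intro borel_measurable_continuous_onI continuous_intros)
lemma measurable_imT [measurable]: "imT \<in> borel_measurable (borel :: (complex ^ 'd::finite) measure)"
  by (intro borel_measurable_continuous_onI continuous_intros)
lemma measurable_cnjT [measurable]: "cnjT \<in> borel_measurable (borel :: (complex ^ 'd::finite) measure)"
  by (intro borel_measurable_continuous_onI continuous_intros)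

lemma norm_power2_cvec: "(norm (w :: complex ^ 'd::finite))\<^sup>2 = (\<Sum>j\<in>UNIV. (norm (w $ j))\<^sup>2)"
  by (simp add: power2_norm_eq_inner inner_vec_def)

lemma norm_reT_le: "norm (reT (w :: complex ^ 'd::finite)) \<le> norm w"
proof -
  have "(Re z)\<^sup>2 \<le> (norm z)\<^sup>2" for z by (simp add: cmod_power2)
  then have "(norm (reT w))\<^sup>2 \<le> (norm w)\<^sup>2"
    unfolding norm_power2_vec norm_power2_cvec reT_nth by (intro sum_mono)
  then show ?thesis by simp
qed

text \<open>The integral kernel of \<open>stft_adj gauss\<close>, with position and frequency joined
  to one complex vector.\<close>

definition atom :: "complex ^ 'd::finite \<Rightarrow> real ^ 'd \<Rightarrow> complex" where
  "atom w x = gauss (x - reT w) * exp (\<i> * of_real (x \<bullet> imT w))"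

lemma measurable_atom [measurable]:
  "(\<lambda>(w, x). atom (w :: complex ^ 'd::finite) x) \<in> borel_measurable (borel \<Otimes>\<^sub>M borel)"
  unfolding atom_def gauss_def by measurable

text \<open>Expanding the square reduces the integrand to that of
  \<open>hpoly_gauss_integral\<close>. The phase \<open>Re w * Im w / 2\<close> is the imaginary
  part of \<open>w^2 / 4\<close>; the phase in the theorem is there to cancel it.\<close>

lemma hfun_atom_integral:
  fixes w :: complex and n :: nat
  defines "f \<equiv> \<lambda>t. of_real (pi powr (- 1 / 4) * exp (- (t - Re w)\<^sup>2 / 2)) * exp (\<i> * of_real (t * Im w)) * of_real (hfun n t)"
  shows "integrable lborel f"
    and "(LINT t|lborel. f t) = of_real ((2 ^ n * fact n) powr (- 1 / 2)) * w ^ n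
      * (of_real (exp (- (norm w)\<^sup>2 / 4)) * exp (\<i> * of_real (Re w * Im w) / 2))"
proof -
  let ?c = "(2 ^ n * fact n) powr (- 1 / 2) :: real"
  let ?g = "\<lambda>t. of_real (hpoly n t) * exp (of_real (- t\<^sup>2) + w * of_real t)"
  have f: "f t = of_real (?c * pi powr (- 1 / 2) * exp (- (Re w)\<^sup>2 / 2)) * ?g t" for t
  proof -
    have w: "w * of_real t = of_real (Re w * t) + \<i> * of_real (t * Im w)"
      by (simp add: complex_eq_iff)
    have 1: "exp (of_real (- t\<^sup>2) + w * of_real t) = of_real (exp (- t\<^sup>2 + Re w * t)) * exp (\<i> * of_real (t * Im w))"
      unfolding w by (simp only: exp_of_real[symmetric] exp_add[symmetric] of_real_add add.assoc)
    have "- (t - Re w)\<^sup>2 / 2 + - t\<^sup>2 / 2 = - (Re w)\<^sup>2 / 2 + (- t\<^sup>2 + Re w * t)"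
      by (simp add: power2_diff field_simps)
    then have 2: "exp (- (t - Re w)\<^sup>2 / 2) * exp (- t\<^sup>2 / 2) = exp (- (Re w)\<^sup>2 / 2) * exp (- t\<^sup>2 + Re w * t)"
      by (simp only: exp_add[symmetric])
    have 3: "pi powr (- 1 / 4) * pi powr (- 1 / 4) = pi powr (- 1 / 2)"
      by (simp flip: powr_add)
    have "f t = of_real (?c * (pi powr (- 1 / 4) * pi powr (- 1 / 4)) * hpoly n t * (exp (- (t - Re w)\<^sup>2 / 2) * exp (- t\<^sup>2 / 2)))
        * exp (\<i> * of_real (t * Im w))"
      unfolding f_def hfun_def by (simp only: of_real_mult mult_ac)
    also have "\<dots> = of_real (?c * pi powr (- 1 / 2) * exp (- (Re w)\<^sup>2 / 2)) * ?g t"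
      unfolding 1 2 3 by (simp only: of_real_mult mult_ac)
    finally show ?thesis .
  qed
  show "integrable lborel f"
    unfolding f by (intro integrable_mult_right hpoly_gauss_integrable)
  have "(LINT t|lborel. f t) = of_real (?c * pi powr (- 1 / 2) * exp (- (Re w)\<^sup>2 / 2)) * (w ^ n * (of_real (sqrt pi) * exp (w\<^sup>2 / 4)))"
    unfolding f integral_mult_right_zero hpoly_gauss_integral ..
  also have "\<dots> = of_real ?c * w ^ n * of_real (pi powr (- 1 / 2) * sqrt pi) * (exp (of_real (- (Re w)\<^sup>2 / 2)) * exp (w\<^sup>2 / 4))"
    unfolding exp_of_real by (simp only: of_real_mult mult_ac)
  also have "pi powr (- 1 / 2) * sqrt pi = 1"
    by (simp add: powr_half_sqrt[symmetric] flip: powr_add)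
  also have "exp (of_real (- (Re w)\<^sup>2 / 2)) * exp (w\<^sup>2 / 4) = of_real (exp (- (norm w)\<^sup>2 / 4)) * exp (\<i> * of_real (Re w * Im w) / 2)"
  proof -
    have "of_real (- (Re w)\<^sup>2 / 2) + w\<^sup>2 / 4 = of_real (- (norm w)\<^sup>2 / 4) + \<i> * of_real (Re w * Im w) / 2"
      by (simp add: complex_eq_iff cmod_power2 Re_power2 Im_power2 field_simps)
    then show ?thesis by (simp only: exp_add[symmetric] exp_of_real[symmetric])
  qed
  finally show "(LINT t|lborel. f t) = of_real ?c * w ^ n
      * (of_real (exp (- (norm w)\<^sup>2 / 4)) * exp (\<i> * of_real (Re w * Im w) / 2))"
    by simp
qed

definition mi_const :: "'d::finite multi_index \<Rightarrow> real" where
  "mi_const \<alpha> = (2 ^ mi_length \<alpha> * mi_fact \<alpha>) powr (- 1 / 2)"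

lemma mi_const_prod: "mi_const \<alpha> = (\<Prod>j\<in>UNIV. (2 ^ (\<alpha> $ j) * fact (\<alpha> $ j)) powr (- 1 / 2))"
  unfolding mi_const_def mi_norm_prod by (simp add: prod_powr_distrib)

lemma atom_hermite_integral:
  fixes w :: "complex ^ 'd::finite"
  shows "(LINT x|lborel. atom w x * of_real (hermite_fun \<alpha> x))
    = of_real (mi_const \<alpha>) * monomial w \<alpha> * (of_real (exp (- (norm w)\<^sup>2 / 4)) * exp (\<i> * of_real (reT w \<bullet> imT w) / 2))"
proof -
  let ?f = "\<lambda>j t. of_real (pi powr (- 1 / 4) * exp (- (t - Re (w $ j))\<^sup>2 / 2)) * exp (\<i> * of_real (t * Im (w $ j))) * of_real (hfun (\<alpha> $ j) t)"
  have e: "atom w x * of_real (hermite_fun \<alpha> x) = (\<Prod>j\<in>UNIV. ?f j (x $ j))" for x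
  proof -
    have 1: "pi powr (- real CARD('d) / 4) = (\<Prod>j\<in>(UNIV::'d set). pi powr (- 1 / 4))"
      by (simp add: powr_powr powr_realpow[symmetric])
    have 2: "exp (- (norm (x - reT w))\<^sup>2 / 2) = (\<Prod>j\<in>UNIV. exp (- (x $ j - Re (w $ j))\<^sup>2 / 2))"
      by (simp add: norm_power2_vec sum_divide_distrib exp_sum flip: sum_negf)
    have 3: "exp (\<i> * of_real (x \<bullet> imT w)) = (\<Prod>j\<in>UNIV. exp (\<i> * of_real (x $ j * Im (w $ j))))"
      by (simp add: inner_vec_def sum_distrib_left exp_sum)
    show ?thesis
      unfolding atom_def gauss_def 1 2 3 hermite_fun_prod by (simp add: prod.distrib)
  qed
  have "(LINT x|lborel. atom w x * of_real (hermite_fun \<alpha> x)) = (\<Prod>j\<in>UNIV. (LINT t|lborel. ?f j t))"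
    unfolding e by (rule integral_prod_vec[OF hfun_atom_integral(1)])
  also have "\<dots> = (\<Prod>j\<in>UNIV. of_real ((2 ^ (\<alpha> $ j) * fact (\<alpha> $ j)) powr (- 1 / 2)) * (w $ j) ^ (\<alpha> $ j)
      * (of_real (exp (- (norm (w $ j))\<^sup>2 / 4)) * exp (\<i> * of_real (Re (w $ j) * Im (w $ j)) / 2)))"
    unfolding hfun_atom_integral(2) ..
  also have "\<dots> = of_real (mi_const \<alpha>) * monomial w \<alpha> * (of_real (exp (- (norm w)\<^sup>2 / 4)) * exp (\<i> * of_real (reT w \<bullet> imT w) / 2))"
  proof -
    have 1: "exp (- (norm w)\<^sup>2 / 4) = (\<Prod>j\<in>UNIV. exp (- (norm (w $ j))\<^sup>2 / 4))"
      by (simp add: norm_power2_cvec sum_divide_distrib exp_sum flip: sum_negf)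
    have 2: "exp (\<i> * of_real (reT w \<bullet> imT w) / 2) = (\<Prod>j\<in>UNIV. exp (\<i> * of_real (Re (w $ j) * Im (w $ j)) / 2))"
      by (simp add: inner_vec_def sum_distrib_left sum_divide_distrib exp_sum)
    show ?thesis
      unfolding mi_const_prod monomial_def 1 2 by (simp add: prod.distrib)
  qed
  finally show ?thesis .
qed

lemma hermite_fun_bound: "\<exists>C>0. \<forall>x. \<bar>hermite_fun (\<alpha> :: 'd::finite multi_index) x\<bar> \<le> C * exp (- (1 / 4) * (norm x)\<^sup>2)"
proof -
  obtain K where K: "K > 0"
    "\<And>x. hermite_fun \<alpha> x = K * ((\<Prod>j\<in>UNIV. hpoly (\<alpha> $ j) (x $ j)) * exp (- (1 / 2) * (norm x)\<^sup>2))"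
    using hermite_fun_eq by blast
  obtain C where C: "C > 0" "\<And>x. \<bar>\<Prod>j\<in>UNIV. hpoly (\<alpha> $ j) (x $ j)\<bar> \<le> C * exp (1 / 4 * (norm x)\<^sup>2)"
    using poly_gauss_bound[OF rpf_hpoly_prod, of "1 / 4"] by auto
  show ?thesis
  proof (intro exI[of _ "K * C"] conjI allI)
    fix x
    have "\<bar>hermite_fun \<alpha> x\<bar> = K * (\<bar>\<Prod>j\<in>UNIV. hpoly (\<alpha> $ j) (x $ j)\<bar> * exp (- (1 / 2) * (norm x)\<^sup>2))"
      using K by (simp add: abs_mult)
    also have "\<dots> \<le> K * ((C * exp (1 / 4 * (norm x)\<^sup>2)) * exp (- (1 / 2) * (norm x)\<^sup>2))"
      using K C by (intro mult_left_mono mult_right_mono) auto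
    also have "\<dots> = K * C * exp (- (1 / 4) * (norm x)\<^sup>2)"
      by (simp add: mult.assoc mult_exp_exp)
    finally show "\<bar>hermite_fun \<alpha> x\<bar> \<le> K * C * exp (- (1 / 4) * (norm x)\<^sup>2)" .
  qed (use K C in auto)
qed

lemma measurable_hermite_fun [measurable]: "hermite_fun \<alpha> \<in> borel_measurable borel"
  unfolding hermite_fun_prod[abs_def] hfun_def by measurable

lemma square_integrable_hermite:
  "square_integrable D \<Longrightarrow> integrable lebesgue (\<lambda>x. D x * cnj (of_real (hermite_fun \<alpha> x)))"
proof -
  assume D: "square_integrable D"
  obtain C where C: "\<And>x. \<bar>hermite_fun \<alpha> x\<bar> \<le> C * exp (- (1 / 4) * (norm x)\<^sup>2)"
    using hermite_fun_bound by blast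
  show ?thesis
    by (rule square_integrable_gauss_integrable[OF D, of _ "1 / 4" C]) (use C in auto)
qed

lemma square_integrable_diff:
  assumes "square_integrable f" "square_integrable g"
  shows "square_integrable (\<lambda>x. f x - g x)"
  unfolding square_integrable_def
proof
  have [measurable]: "f \<in> borel_measurable lebesgue" "g \<in> borel_measurable lebesgue"
    using assms by (auto simp: square_integrable_def)
  show "(\<lambda>x. f x - g x) \<in> borel_measurable lebesgue" by measurable
  show "integrable lebesgue (\<lambda>x. (norm (f x - g x))\<^sup>2)"
  proof (rule Bochner_Integration.integrable_bound)
    show "integrable lebesgue (\<lambda>x. 2 * (norm (f x))\<^sup>2 + 2 * (norm (g x))\<^sup>2)"
      using assms by (auto simp: square_integrable_def)
    show "AE x in lebesgue. norm ((norm (f x - g x))\<^sup>2) \<le> norm (2 * (norm (f x))\<^sup>2 + 2 * (norm (g x))\<^sup>2)"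
    proof (rule AE_I2)
      fix x
      have "(norm (f x - g x))\<^sup>2 \<le> (norm (f x) + norm (g x))\<^sup>2"
        by (intro power_mono norm_triangle_ineq4) auto
      also have "\<dots> \<le> 2 * (norm (f x))\<^sup>2 + 2 * (norm (g x))\<^sup>2"
        using zero_le_power2[of "norm (f x) - norm (g x)"] by (simp add: power2_sum power2_diff)
      finally show "norm ((norm (f x - g x))\<^sup>2) \<le> norm (2 * (norm (f x))\<^sup>2 + 2 * (norm (g x))\<^sup>2)" by simp
    qed
  qed measurable
qed

lemma hermite_coeff_diff:
  assumes "square_integrable f" "square_integrable g"
  shows "hermite_coeff (\<lambda>x. f x - g x) \<alpha> = hermite_coeff f \<alpha> - hermite_coeff g \<alpha>"
  using assms[THEN square_integrable_hermite, of \<alpha>]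
  unfolding hermite_coeff_def left_diff_distrib by (rule Bochner_Integration.integral_diff)

lemma square_integrable_if_gauss_bound:
  fixes G :: "real ^ 'd::finite \<Rightarrow> complex"
  assumes [measurable]: "G \<in> borel_measurable borel" and a: "a > 0"
    and G: "\<And>x. norm (G x) \<le> C * exp (- a * (norm x)\<^sup>2)"
  shows "square_integrable G"
  unfolding square_integrable_def
proof
  show "G \<in> borel_measurable lebesgue" by (simp add: measurable_completion)
  have "integrable lborel (\<lambda>x. (norm (G x))\<^sup>2)"
  proof (rule Bochner_Integration.integrable_bound)
    show "integrable lborel (\<lambda>x :: real ^ 'd. C\<^sup>2 * exp (- (2 * a) * (norm x)\<^sup>2))"
      using a by (intro integrable_mult_right integrable_gauss_vec) simp
    show "AE x in lborel. norm ((norm (G x))\<^sup>2) \<le> norm (C\<^sup>2 * exp (- (2 * a) * (norm x)\<^sup>2))"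
    proof (rule AE_I2)
      fix x
      have "(norm (G x))\<^sup>2 \<le> (C * exp (- a * (norm x)\<^sup>2))\<^sup>2"
        by (intro power_mono G) auto
      also have "\<dots> = C\<^sup>2 * exp (- (2 * a) * (norm x)\<^sup>2)"
        by (simp add: power_mult_distrib power2_eq_square[of "exp _"] mult_exp_exp)
      finally show "norm ((norm (G x))\<^sup>2) \<le> norm (C\<^sup>2 * exp (- (2 * a) * (norm x)\<^sup>2))" by simp
    qed
  qed measurable
  then show "integrable lebesgue (\<lambda>x. (norm (G x))\<^sup>2)"
    by (subst integrable_completion) auto
qed

subsection \<open>Radial cut-offs and power series\<close>

definition rotate_coord :: "'d::finite \<Rightarrow> complex \<Rightarrow> complex ^ 'd \<Rightarrow> complex ^ 'd" where
  "rotate_coord j u w = (\<chi> i. if i = j then u * w $ i else w $ i)"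

lemma rotate_nth: "rotate_coord j u w $ i = (if i = j then u * w $ i else w $ i)"
  by (simp add: rotate_coord_def)

lemma norm_rotate_nth: "norm u = 1 \<Longrightarrow> norm (rotate_coord j u w $ i) = norm (w $ i)"
  by (simp add: rotate_nth norm_mult)

lemma norm_rotate: "norm u = 1 \<Longrightarrow> norm (rotate_coord j u w) = norm w"
proof -
  assume "norm u = 1"
  then have "(norm (rotate_coord j u w))\<^sup>2 = (norm w)\<^sup>2"
    unfolding norm_power2_cvec by (simp add: norm_rotate_nth)
  then show ?thesis by simp
qed

lemma linear_rotate: "linear (rotate_coord j u)"
  by (rule linearI) (auto simp: vec_eq_iff rotate_nth algebra_simps)

lemma measurable_rotate [measurable]: "rotate_coord j u \<in> borel_measurable borel"
  using linear_rotate by (intro borel_measurable_continuous_onI linear_continuous_on)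
    (simp add: linear_conv_bounded_linear)

lemma lborel_distr_rotate: "norm u = 1 \<Longrightarrow> distr lborel borel (rotate_coord j u) = lborel"
  by (rule lborel_distr_isometry[OF linear_rotate norm_rotate]) auto

text \<open>\<open>stft_adj\<close> integrates over pairs, whereas cut-offs and monomials live on
  complex vectors. Being isometric, this map carries one Lebesgue measure to the other.\<close>

definition phase_iso :: "(real ^ 'd::finite) \<times> (real ^ 'd) \<Rightarrow> complex ^ 'd" where
  "phase_iso p = cvec (fst p) (snd p)"

lemma phase_iso_nth: "phase_iso p $ j = Complex (fst p $ j) (snd p $ j)"
  by (simp add: phase_iso_def cvec_def)

lemma reT_phase_iso [simp]: "reT (phase_iso p) = fst p"
  by (simp add: vec_eq_iff phase_iso_nth)
lemma imT_phase_iso [simp]: "imT (phase_iso p) = snd p"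
  by (simp add: vec_eq_iff phase_iso_nth)
lemma cnjT_phase_iso: "cnjT (phase_iso p) = cvec (fst p) (- snd p)"
  by (simp add: vec_eq_iff phase_iso_nth cvec_def complex_eq_iff)

lemma linear_phase_iso: "linear phase_iso"
  by (rule linearI) (auto simp: vec_eq_iff phase_iso_nth complex_eq_iff)

lemma norm_phase_iso: "norm (phase_iso p) = norm p"
proof -
  have "(norm (phase_iso p))\<^sup>2 = (norm p)\<^sup>2"
    by (cases p) (simp add: norm_power2_cvec phase_iso_nth cmod_power2 norm_Pair norm_power2_vec sum.distrib sum_nonneg)
  then show ?thesis by simp
qed

lemma measurable_phase_iso [measurable]: "phase_iso \<in> borel_measurable borel"
  using linear_phase_iso by (intro borel_measurable_continuous_onI linear_continuous_on)
    (simp add: linear_conv_bounded_linear)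

lemma lborel_distr_phase_iso: "distr lborel borel phase_iso = (lborel :: (complex ^ 'd::finite) measure)"
  by (rule lborel_distr_isometry[OF linear_phase_iso norm_phase_iso]) (simp add: DIM_complex)

lemma AE_phase_iso:
  assumes "AE w in lborel. P w"
  shows "AE p in lborel. P (phase_iso p)"
proof (rule AE_distrD[of phase_iso lborel borel])
  show "AE w in distr lborel borel phase_iso. P w"
    unfolding lborel_distr_phase_iso by (rule assms)
qed simp

lemma AE_rotate:
  assumes u: "norm u = 1" and "AE w in lborel. P w"
  shows "AE w in lborel. P (rotate_coord j u w)"
proof (rule AE_distrD[of "rotate_coord j u" lborel borel])
  show "AE w in distr lborel borel (rotate_coord j u). P w"
    unfolding lborel_distr_rotate[OF u] by (rule assms)
qed simp

text \<open>Closed, hence compact, so continuous functions are bounded on it; a single radius bounds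
  monomials by a power of one number.\<close>

definition pdisc :: "real \<Rightarrow> (complex ^ 'd::finite) set" where
  "pdisc T = {w. \<forall>j. norm (w $ j) \<le> T}"

lemma norm_monomial: "norm (monomial (z :: complex ^ 'd::finite) \<alpha>) = (\<Prod>j\<in>UNIV. norm (z $ j) ^ (\<alpha> $ j))"
  by (simp add: monomial_def prod_norm[symmetric] norm_power)

lemma norm_monomial_le: "z \<in> pdisc T \<Longrightarrow> norm (monomial z \<alpha>) \<le> T ^ mi_length \<alpha>"
  unfolding norm_monomial mi_length_def power_sum
  by (intro prod_mono) (auto simp: pdisc_def power_mono)

lemma continuous_monomial [continuous_intros]: "continuous_on A (\<lambda>z :: complex ^ 'd::finite. monomial z \<alpha>)"
  unfolding monomial_def by (intro continuous_intros)

lemma measurable_monomial [measurable]: "(\<lambda>z :: complex ^ 'd::finite. monomial z \<alpha>) \<in> borel_measurable borel"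
  by (intro borel_measurable_continuous_onI continuous_intros)

text \<open>The denominator is at least 1 and is simply dropped: the decay of the coefficients is
  strong enough on its own.\<close>

lemma power_series_term_bound:
  fixes z :: "complex ^ 'd::finite"
  assumes z: "z \<in> pdisc T"
  shows "norm (a * monomial z \<alpha> / of_real (sqrt (mi_fact \<alpha>))) \<le> norm a * T ^ mi_length \<alpha>"
proof -
  have "norm (a * monomial z \<alpha>) \<le> norm a * T ^ mi_length \<alpha>"
    unfolding norm_mult using norm_monomial_le[OF z] by (intro mult_left_mono) auto
  moreover have "norm (a * monomial z \<alpha> / of_real (sqrt (mi_fact \<alpha>))) \<le> norm (a * monomial z \<alpha>)"
    unfolding norm_divide using mi_fact_ge_1[of \<alpha>] by (simp add: divide_le_eq mult_le_cancel_left1)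
  ultimately show ?thesis by linarith
qed

lemma power_series_uniform_limit:
  fixes F0 :: "complex ^ 'd::finite \<Rightarrow> complex"
  assumes F0: "has_coeffs F0 c" and T: "T \<ge> 0"
    and sm: "(\<lambda>\<alpha>. norm (c \<alpha>) * T ^ mi_length \<alpha>) summable_on UNIV"
  shows "uniform_limit (pdisc T) (\<lambda>X z. \<Sum>\<alpha>\<in>X. c \<alpha> * monomial z \<alpha> / of_real (sqrt (mi_fact \<alpha>))) F0 (finite_subsets_at_top UNIV)"
proof (rule Weierstrass_m_test_general'[OF _ _ sm])
  fix \<alpha> and z :: "complex ^ 'd" assume z: "z \<in> pdisc T"
  show "norm (c \<alpha> * monomial z \<alpha> / of_real (sqrt (mi_fact \<alpha>))) \<le> norm (c \<alpha>) * T ^ mi_length \<alpha>"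
    by (rule power_series_term_bound[OF z])
next
  fix z :: "complex ^ 'd"
  show "((\<lambda>\<alpha>. c \<alpha> * monomial z \<alpha> / of_real (sqrt (mi_fact \<alpha>))) has_sum F0 z) UNIV"
    using F0 by (simp add: has_coeffs_def)
qed

lemma power_series_continuous:
  fixes F0 :: "complex ^ 'd::finite \<Rightarrow> complex"
  assumes F0: "has_coeffs F0 c"
    and sm: "\<And>T. T > 0 \<Longrightarrow> (\<lambda>\<alpha>. norm (c \<alpha>) * T ^ mi_length \<alpha>) summable_on UNIV"
  shows "continuous_on UNIV F0"
proof -
  have "isCont F0 z" for z
  proof -
    \<comment> \<open>The extra 1 puts \<open>z\<close> into an open ball inside the polydisc, so
      that continuity on the polydisc yields continuity at \<open>z\<close>.\<close>
    let ?T = "norm z + 1"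
    let ?S = "\<lambda>X z. \<Sum>\<alpha>\<in>X. c \<alpha> * monomial z \<alpha> / of_real (sqrt (mi_fact \<alpha>))"
    have ul: "uniform_limit (pdisc ?T) ?S F0 (finite_subsets_at_top UNIV)"
      by (rule power_series_uniform_limit[OF F0]) (auto intro!: sm add_nonneg_pos)
    have cS: "\<forall>\<^sub>F X in finite_subsets_at_top UNIV. continuous_on (pdisc ?T) (?S X)"
      by (intro always_eventually allI continuous_on_sum continuous_on_divide continuous_on_mult continuous_on_const continuous_monomial)
        (use mi_fact_pos in \<open>auto simp: less_le\<close>)
    have "continuous_on (pdisc ?T) F0"
      by (rule uniform_limit_theorem[OF cS ul]) simp
    moreover have "ball (0 :: complex ^ 'd) ?T \<subseteq> pdisc ?T"
    proof
      fix w :: "complex ^ 'd" assume "w \<in> ball 0 ?T"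
      then show "w \<in> pdisc ?T"
        using Finite_Cartesian_Product.norm_nth_le[of w] by (auto simp: pdisc_def intro: order_trans less_imp_le)
    qed
    ultimately have "continuous_on (ball 0 ?T) F0" by (rule continuous_on_subset)
    then show ?thesis by (simp add: continuous_on_eq_continuous_at)
  qed
  then show ?thesis by (simp add: continuous_at_imp_continuous_on)
qed

lemma compact_pdisc: "compact (pdisc T :: (complex ^ 'd::finite) set)"
  unfolding compact_eq_bounded_closed
proof
  have "norm w \<le> (\<Sum>j\<in>(UNIV::'d set). T)" if "w \<in> pdisc T" for w :: "complex ^ 'd"
  proof -
    have "norm w \<le> (\<Sum>j\<in>UNIV. norm (w $ j))" by (simp add: norm_vec_def L2_set_le_sum)
    also have "\<dots> \<le> (\<Sum>j\<in>(UNIV::'d set). T)" using that by (intro sum_mono) (auto simp: pdisc_def)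
    finally show ?thesis .
  qed
  then show "bounded (pdisc T :: (complex ^ 'd) set)" unfolding bounded_iff by blast
  have "pdisc T = (\<Inter>j. {w :: complex ^ 'd. norm (w $ j) \<le> T})" by (auto simp: pdisc_def)
  also have "closed \<dots>" by (intro closed_INT ballI closed_Collect_le continuous_intros)
  finally show "closed (pdisc T :: (complex ^ 'd) set)" .
qed

lemma measurable_pdisc [measurable]: "pdisc T \<in> sets borel"
  by (intro borel_compact compact_pdisc)

lemma integrable_pdisc: "integrable lborel (indicator (pdisc T :: (complex ^ 'd::finite) set) :: _ \<Rightarrow> real)"
  using compact_pdisc emeasure_compact_finite[of "pdisc T"] by (intro integrable_real_indicator) auto

lemma integrable_bounded_pdisc:
  fixes f :: "complex ^ 'd::finite \<Rightarrow> 'b::{banach,second_countable_topology}"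
  assumes [measurable]: "f \<in> borel_measurable borel"
    and b: "\<And>w. w \<in> pdisc T \<Longrightarrow> norm (f w) \<le> B" and 0: "\<And>w. w \<notin> pdisc T \<Longrightarrow> f w = 0"
  shows "integrable lborel f"
proof (rule Bochner_Integration.integrable_bound)
  show "integrable lborel (\<lambda>w :: complex ^ 'd. \<bar>B\<bar> * indicator (pdisc T) w)"
    by (intro integrable_mult_right integrable_pdisc)
  show "AE w in lborel. norm (f w) \<le> norm (\<bar>B\<bar> * indicator (pdisc T) w)"
    using order_trans[OF b abs_ge_self] 0 by (intro AE_I2) (simp add: indicator_def)
qed simp

text \<open>A Borel representative of a cut-off for which sign, bound and support hold at every
  point, as the pointwise estimates require; radiality and the lower bound stay almost everywhere
  statements. Single radii \<open>t\<close> and \<open>T\<close> replace the vectors of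
  radii.\<close>

locale cutoff =
  fixes k :: "complex ^ 'd::finite \<Rightarrow> real" and B T c t :: real
  assumes k_meas [measurable]: "k \<in> borel_measurable borel"
    and k_nonneg: "\<And>w. 0 \<le> k w" and k_le: "\<And>w. k w \<le> B"
    and k_supp: "\<And>w. w \<notin> pdisc T \<Longrightarrow> k w = 0" and T_pos: "T > 0"
    and k_radial: "\<exists>k0. AE w in lborel. k w = k0 (\<chi> j. norm (w $ j))"
    and t_pos: "t > 0" and c_pos: "c > 0"
    and k_ge: "AE w in lborel. (\<forall>j. norm (w $ j) < t) \<longrightarrow> c \<le> k w"
begin

lemma B_nonneg: "B \<ge> 0"
  using k_nonneg[of 0] k_le[of 0] by linarith

lemma k_rotate: "norm u = 1 \<Longrightarrow> AE w in lborel. k (rotate_coord j u w) = k w"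
proof -
  assume u: "norm u = 1"
  obtain k0 where k0: "AE w in lborel. k w = k0 (\<chi> j. norm (w $ j))" using k_radial by blast
  show ?thesis
    using k0 AE_rotate[OF u k0, of j] by eventually_elim (simp add: norm_rotate_nth[OF u])
qed

text \<open>What a Hermite coefficient of the transform integrates against
  \<open>F0 (cnjT w)\<close> once the phases have cancelled, up to the constant
  \<open>mi_const \<alpha>\<close>.\<close>

definition weight :: "'d multi_index \<Rightarrow> complex ^ 'd \<Rightarrow> complex" where
  "weight \<alpha> w = monomial w \<alpha> * of_real (k w * exp (- (norm w)\<^sup>2 / 4))"

text \<open>Conjugates appear because \<open>F0\<close> is evaluated at
  \<open>x - \<i>\<xi>\<close>; they turn this integral into an inner product of monomials for the
  radial weight.\<close>

definition gram :: "'d multi_index \<Rightarrow> 'd multi_index \<Rightarrow> complex" where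
  "gram \<beta> \<alpha> = (LINT w|lborel. monomial (cnjT w) \<beta> * weight \<alpha> w)"

lemma measurable_weight [measurable]: "weight \<alpha> \<in> borel_measurable borel"
  unfolding weight_def[abs_def] by measurable

lemma weight_bound: "w \<in> pdisc T \<Longrightarrow> norm (weight \<alpha> w) \<le> T ^ mi_length \<alpha> * B"
proof -
  assume w: "w \<in> pdisc T"
  have "k w * exp (- (norm w)\<^sup>2 / 4) \<le> B * 1"
    using k_nonneg k_le B_nonneg by (intro mult_mono) auto
  then have "norm (of_real (k w * exp (- (norm w)\<^sup>2 / 4)) :: complex) \<le> B"
    unfolding norm_of_real using k_nonneg[of w] by (simp add: abs_mult)
  then show ?thesis
    unfolding weight_def norm_mult[of "monomial w \<alpha>"] using norm_monomial_le[OF w] T_pos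
    by (intro mult_mono) auto
qed

lemma weight_supp: "w \<notin> pdisc T \<Longrightarrow> weight \<alpha> w = 0"
  by (simp add: weight_def k_supp)

lemma integrable_weight: "integrable lborel (weight \<alpha>)"
  by (rule integrable_bounded_pdisc[of _ T, OF _ weight_bound weight_supp]) auto

lemma cnjT_pdisc: "w \<in> pdisc T \<Longrightarrow> cnjT w \<in> pdisc T"
  by (simp add: pdisc_def)

lemma integrable_times_weight:
  assumes [measurable]: "f \<in> borel_measurable borel" and f: "\<And>w. w \<in> pdisc T \<Longrightarrow> norm (f w) \<le> C"
  shows "integrable lborel (\<lambda>w. f w * weight \<alpha> w)"
proof (rule integrable_bounded_pdisc)
  fix w :: "complex ^ 'd" assume w: "w \<in> pdisc T"
  show "norm (f w * weight \<alpha> w) \<le> C * (T ^ mi_length \<alpha> * B)"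
    unfolding norm_mult using f[OF w] weight_bound[OF w] order_trans[OF norm_ge_zero f[OF w]]
    by (intro mult_mono) auto
qed (auto simp: weight_supp)

lemma integrable_gram: "integrable lborel (\<lambda>w. monomial (cnjT w) \<beta> * weight \<alpha> w)"
  by (rule integrable_times_weight[of _ "T ^ mi_length \<beta>"]) (auto intro: norm_monomial_le cnjT_pdisc)

text \<open>Rotating the coordinate in which \<open>\<alpha>\<close> and \<open>\<beta>\<close> differ by a suitable root of \<open>- 1\<close>
  changes the sign of the integrand.\<close>

lemma gram_orthogonal:
  assumes "\<beta> \<noteq> \<alpha>"
  shows "gram \<beta> \<alpha> = 0"
proof -
  obtain j where j: "\<beta> $ j \<noteq> \<alpha> $ j" using assms by (auto simp: vec_eq_iff)
  define \<theta> where "\<theta> = pi / (real (\<alpha> $ j) - real (\<beta> $ j))"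
  let ?u = "exp (\<i> * of_real \<theta>)"
  have u: "norm ?u = 1" by simp
  have phase: "cnj ?u ^ (\<beta> $ j) * ?u ^ (\<alpha> $ j) = - 1"
  proof -
    have "cnj ?u ^ (\<beta> $ j) * ?u ^ (\<alpha> $ j) = exp (of_nat (\<beta> $ j) * cnj (\<i> * of_real \<theta>) + of_nat (\<alpha> $ j) * (\<i> * of_real \<theta>))"
      by (simp only: exp_of_nat_mult exp_cnj exp_add)
    also have "of_nat (\<beta> $ j) * cnj (\<i> * of_real \<theta>) + of_nat (\<alpha> $ j) * (\<i> * of_real \<theta>) = \<i> * of_real ((real (\<alpha> $ j) - real (\<beta> $ j)) * \<theta>)"
      by (simp add: algebra_simps)
    also have "(real (\<alpha> $ j) - real (\<beta> $ j)) * \<theta> = pi"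
      using j by (simp add: \<theta>_def)
    finally show ?thesis by simp
  qed
  have mono: "monomial (rotate_coord j ?u w) \<alpha> = ?u ^ (\<alpha> $ j) * monomial w \<alpha>" for w
    unfolding monomial_def rotate_nth
    by (subst (1 2) prod.remove[of UNIV j]) (auto simp: power_mult_distrib intro!: prod.cong)
  have monoc: "monomial (cnjT (rotate_coord j ?u w)) \<beta> = cnj ?u ^ (\<beta> $ j) * monomial (cnjT w) \<beta>" for w
    unfolding monomial_def cnjT_nth rotate_nth
    by (subst (1 2) prod.remove[of UNIV j]) (auto simp: power_mult_distrib intro!: prod.cong)
  let ?h = "\<lambda>w. monomial (cnjT w) \<beta> * weight \<alpha> w"
  have "gram \<beta> \<alpha> = (LINT w|distr lborel borel (rotate_coord j ?u). ?h w)"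
    by (simp only: lborel_distr_rotate[OF u] gram_def)
  also have "\<dots> = (LINT w|lborel. ?h (rotate_coord j ?u w))"
    by (rule integral_distr) measurable
  also have "\<dots> = (LINT w|lborel. - ?h w)"
  proof (rule integral_cong_AE)
    show "AE w in lborel. ?h (rotate_coord j ?u w) = - ?h w"
      using k_rotate[OF u, of j]
    proof eventually_elim
      case (elim w)
      have "?h (rotate_coord j ?u w) = (cnj ?u ^ (\<beta> $ j) * ?u ^ (\<alpha> $ j)) * ?h w"
        unfolding weight_def mono monoc elim norm_rotate[OF u] by (simp only: mult_ac)
      then show ?case unfolding phase by simp
    qed
  qed measurable
  also have "\<dots> = - gram \<beta> \<alpha>" by (simp add: gram_def)
  finally show ?thesis by simp
qed

text \<open>The weight has compact support, on which the series converges uniformly. So it may be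
  integrated termwise, and orthogonality leaves the term of index \<open>\<alpha>\<close>.\<close>

lemma power_series_weight_integral:
  assumes F0: "has_coeffs F0 a"
    and sm: "\<And>T. T > 0 \<Longrightarrow> (\<lambda>\<alpha>. norm (a \<alpha>) * T ^ mi_length \<alpha>) summable_on UNIV"
  shows "(LINT w|lborel. F0 (cnjT w) * weight \<alpha> w) = a \<alpha> / of_real (sqrt (mi_fact \<alpha>)) * gram \<alpha> \<alpha>"
proof -
  have cont: "continuous_on UNIV F0" by (rule power_series_continuous[OF F0 sm])
  have [measurable]: "F0 \<in> borel_measurable borel" by (rule borel_measurable_continuous_onI[OF cont])
  have "bounded (F0 ` pdisc T)"
    using compact_continuous_image[OF continuous_on_subset[OF cont subset_UNIV] compact_pdisc] by (rule compact_imp_bounded)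
  then obtain C where C: "\<And>w. w \<in> pdisc T \<Longrightarrow> norm (F0 w) \<le> C" by (auto simp: bounded_iff)
  have iF: "integrable lborel (\<lambda>w. F0 (cnjT w) * weight \<alpha> w)"
    by (rule integrable_times_weight[of _ C]) (auto intro: C cnjT_pdisc)
  define M where "M = (LINT w|lborel. norm (weight \<alpha> w))"
  have M: "M \<ge> 0" by (simp add: M_def)
  let ?I = "LINT w|lborel. F0 (cnjT w) * weight \<alpha> w" and ?r = "a \<alpha> / of_real (sqrt (mi_fact \<alpha>)) * gram \<alpha> \<alpha>"
  have "norm (?I - ?r) \<le> 0 + e" if "e > 0" for e
  proof -
    define e' where "e' = e / (M + 1)"
    have e': "e' > 0" "e' * M \<le> e" using M that by (auto simp: e'_def field_simps)
    let ?S = "\<lambda>X z. \<Sum>\<beta>\<in>X. a \<beta> * monomial z \<beta> / of_real (sqrt (mi_fact \<beta>))"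
    have "\<forall>\<^sub>F X in finite_subsets_at_top UNIV. \<forall>z\<in>pdisc T. dist (?S X z) (F0 z) < e'"
      using power_series_uniform_limit[OF F0 _ sm[OF T_pos]] T_pos e' unfolding uniform_limit_iff by auto
    \<comment> \<open>With \<open>\<alpha>\<close> in \<open>X\<close>, the partial sum already
      contains the one term that survives.\<close>
    moreover have "\<forall>\<^sub>F X in finite_subsets_at_top UNIV. finite X \<and> \<alpha> \<in> X"
      unfolding eventually_finite_subsets_at_top by (intro exI[of _ "{\<alpha>}"]) auto
    ultimately have "\<forall>\<^sub>F X in finite_subsets_at_top UNIV. (\<forall>z\<in>pdisc T. dist (?S X z) (F0 z) < e') \<and> finite X \<and> \<alpha> \<in> X"
      by (rule eventually_conj)
    from eventually_happens'[OF finite_subsets_at_top_neq_bot this]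
    obtain X where X: "\<And>z. z \<in> pdisc T \<Longrightarrow> dist (?S X z) (F0 z) < e'" "finite X" "\<alpha> \<in> X"
      by blast
    have S: "?S X (cnjT w) * weight \<alpha> w = (\<Sum>\<beta>\<in>X. a \<beta> / of_real (sqrt (mi_fact \<beta>)) * (monomial (cnjT w) \<beta> * weight \<alpha> w))" for w
      unfolding sum_distrib_right by (intro sum.cong) (auto simp: mult_ac)
    have iS: "integrable lborel (\<lambda>w. ?S X (cnjT w) * weight \<alpha> w)"
      unfolding S by (intro Bochner_Integration.integrable_sum integrable_mult_right integrable_gram)
    have "(LINT w|lborel. ?S X (cnjT w) * weight \<alpha> w) = (\<Sum>\<beta>\<in>X. a \<beta> / of_real (sqrt (mi_fact \<beta>)) * gram \<beta> \<alpha>)"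
      unfolding S gram_def
      by (simp only: Bochner_Integration.integral_sum[OF integrable_mult_right[OF integrable_gram]] integral_mult_right_zero)
    also have "\<dots> = (\<Sum>\<beta>\<in>X. if \<beta> = \<alpha> then ?r else 0)"
      by (intro sum.cong) (auto simp: gram_orthogonal)
    also have "\<dots> = ?r" using X by simp
    finally have diff: "?I - ?r = (LINT w|lborel. F0 (cnjT w) * weight \<alpha> w - ?S X (cnjT w) * weight \<alpha> w)"
      using iF iS by simp
    have "norm (?I - ?r) \<le> (LINT w|lborel. norm (F0 (cnjT w) * weight \<alpha> w - ?S X (cnjT w) * weight \<alpha> w))"
      unfolding diff by (rule integral_norm_bound)
    also have "\<dots> \<le> (LINT w|lborel. e' * norm (weight \<alpha> w))"
    proof (rule integral_mono)
      fix w
      show "norm (F0 (cnjT w) * weight \<alpha> w - ?S X (cnjT w) * weight \<alpha> w) \<le> e' * norm (weight \<alpha> w)"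
      proof (cases "w \<in> pdisc T")
        case True
        have "dist (F0 (cnjT w)) (?S X (cnjT w)) < e'"
          by (subst dist_commute) (rule X(1)[OF cnjT_pdisc[OF True]])
        then have "norm (F0 (cnjT w) - ?S X (cnjT w)) \<le> e'"
          unfolding dist_norm by (rule less_imp_le)
        then show ?thesis
          unfolding left_diff_distrib[symmetric] norm_mult by (intro mult_right_mono) auto
      qed (simp add: weight_supp)
    next
      show "integrable lborel (\<lambda>w. norm (F0 (cnjT w) * weight \<alpha> w - ?S X (cnjT w) * weight \<alpha> w))"
        by (intro integrable_norm Bochner_Integration.integrable_diff iF iS)
      show "integrable lborel (\<lambda>w. e' * norm (weight \<alpha> w))"
        by (intro integrable_mult_right integrable_norm integrable_weight)
    qed
    also have "\<dots> = e' * M" by (simp add: M_def)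
    finally show ?thesis using e' by simp
  qed
  then have "norm (?I - ?r) \<le> 0" by (rule field_le_epsilon)
  then show ?thesis by simp
qed

end

section \<open>Estimates for factorials and shifted Gaussians\<close>

lemma power_fact_le_exp: "0 \<le> b \<Longrightarrow> b ^ n / fact n \<le> exp (b :: real)"
proof -
  assume b: "0 \<le> b"
  have sm: "summable (\<lambda>i. b ^ i / fact i)"
    using summable_exp[of b] by (simp add: field_simps)
  have "b ^ n / fact n = (\<Sum>i\<in>{n}. b ^ i / fact i)" by simp
  also have "\<dots> \<le> (\<Sum>i. b ^ i / fact i)"
    using b by (intro sum_le_suminf sm) auto
  also have "\<dots> = exp b" by (simp add: exp_def field_simps)
  finally show ?thesis .
qed

lemma mi_power_fact_bound:
  fixes \<alpha> :: "'d::finite multi_index"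
  assumes "0 \<le> b"
  shows "b ^ mi_length \<alpha> / mi_fact \<alpha> \<le> exp b ^ CARD('d)"
proof -
  have "b ^ mi_length \<alpha> / mi_fact \<alpha> = (\<Prod>j\<in>UNIV. b ^ (\<alpha> $ j) / fact (\<alpha> $ j))"
    by (simp add: mi_length_def mi_fact_def power_sum prod_dividef)
  also have "\<dots> \<le> (\<Prod>j\<in>(UNIV::'d set). exp b)"
    using assms by (intro prod_mono) (auto intro: power_fact_le_exp)
  finally show ?thesis by simp
qed

text \<open>The normalisation of the Hermite functions and that of the power series each contribute
  a square root of \<open>\<alpha>!\<close>; together they give the full factorial in
  \<open>multiplier\<close>.\<close>

lemma mi_const_eq: "mi_const \<alpha> / sqrt (mi_fact \<alpha>) = (1 / sqrt 2) ^ mi_length \<alpha> / mi_fact \<alpha>"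
proof -
  have "mi_const \<alpha> = 1 / sqrt (2 ^ mi_length \<alpha> * mi_fact \<alpha>)"
    using mi_fact_pos[of \<alpha>] by (simp add: mi_const_def powr_minus_divide powr_half_sqrt)
  then show ?thesis
    using mi_fact_pos[of \<alpha>] by (simp add: real_sqrt_mult real_sqrt_power power_divide)
qed

text \<open>From \<open>|x|^2 \<le> 2 |x - Re w|^2 + 2 R^2\<close>: the exponent drops from 1/2 to
  1/4 in exchange for uniformity in \<open>w\<close>.\<close>

lemma atom_bound:
  fixes w :: "complex ^ 'd::finite"
  assumes "norm w \<le> R"
  shows "norm (atom w x) \<le> pi powr (- real CARD('d) / 4) * exp (R\<^sup>2 / 2) * exp (- (1 / 4) * (norm x)\<^sup>2)"
proof -
  have "norm x \<le> norm (x - reT w) + norm (reT w)"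
    using norm_triangle_ineq[of "x - reT w" "reT w"] by simp
  also have "\<dots> \<le> norm (x - reT w) + R"
    using norm_reT_le[of w] assms by simp
  finally have "(norm x)\<^sup>2 \<le> (norm (x - reT w) + R)\<^sup>2" by (intro power_mono) auto
  also have "\<dots> \<le> 2 * (norm (x - reT w))\<^sup>2 + 2 * R\<^sup>2"
    using zero_le_power2[of "norm (x - reT w) - R"] by (simp add: power2_sum power2_diff)
  finally have "- (norm (x - reT w))\<^sup>2 / 2 \<le> R\<^sup>2 / 2 + - (1 / 4) * (norm x)\<^sup>2" by simp
  then have "exp (- (norm (x - reT w))\<^sup>2 / 2) \<le> exp (R\<^sup>2 / 2) * exp (- (1 / 4) * (norm x)\<^sup>2)"
    by (simp only: exp_add[symmetric] exp_le_cancel_iff)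
  then have "pi powr (- real CARD('d) / 4) * exp (- (norm (x - reT w))\<^sup>2 / 2)
     \<le> pi powr (- real CARD('d) / 4) * (exp (R\<^sup>2 / 2) * exp (- (1 / 4) * (norm x)\<^sup>2))"
    by (intro mult_left_mono) auto
  moreover have "norm (atom w x) = pi powr (- real CARD('d) / 4) * exp (- (norm (x - reT w))\<^sup>2 / 2)"
    unfolding atom_def gauss_def norm_mult[of "of_real _"] norm_of_real by (simp add: abs_mult)
  ultimately show ?thesis by (simp only: mult.assoc)
qed

lemma integrable_prod_bound:
  fixes f :: "'a::euclidean_space \<times> 'b::euclidean_space \<Rightarrow> complex"
  assumes [measurable]: "f \<in> borel_measurable (lborel \<Otimes>\<^sub>M lborel)"
    and g: "integrable lborel g" and h: "integrable lborel h"
    and le: "\<And>x y. norm (f (x, y)) \<le> g x * h y"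
  shows "integrable (lborel \<Otimes>\<^sub>M lborel) f"
proof (rule lborel_pair.Fubini_integrable)
  have ify: "integrable lborel (\<lambda>y. f (x, y))" for x
    by (rule Bochner_Integration.integrable_bound[of _ "\<lambda>y. g x * h y"])
      (use h order_trans[OF le abs_ge_self] in \<open>auto intro!: integrable_mult_right AE_I2\<close>)
  then show "AE x in lborel. integrable lborel (\<lambda>y. f (x, y))" by simp
  show "integrable lborel (\<lambda>x. LINT y|lborel. norm (f (x, y)))"
  proof (rule Bochner_Integration.integrable_bound)
    show "integrable lborel (\<lambda>x. g x * (LINT y|lborel. h y))"
      using g by (rule integrable_mult_left)
    show "AE x in lborel. norm (LINT y|lborel. norm (f (x, y))) \<le> norm (g x * (LINT y|lborel. h y))"
    proof (rule AE_I2)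
      fix x
      have "(LINT y|lborel. norm (f (x, y))) \<le> (LINT y|lborel. g x * h y)"
        by (rule integral_mono) (use ify h le in \<open>auto intro!: integrable_mult_right\<close>)
      moreover have "0 \<le> (LINT y|lborel. norm (f (x, y)))" by simp
      ultimately show "norm (LINT y|lborel. norm (f (x, y))) \<le> norm (g x * (LINT y|lborel. h y))"
        by simp
    qed
  qed measurable
qed fact

section \<open>The synthesis operator and its Hermite coefficients\<close>

context cutoff
begin

text \<open>The function \<open>F\<close> of the theorem in the variable \<open>w\<close>, built
  with the Borel cut-off.\<close>

definition phi :: "(complex ^ 'd \<Rightarrow> complex) \<Rightarrow> complex ^ 'd \<Rightarrow> complex" where
  "phi F0 w = F0 (cnjT w) * exp (- \<i> * of_real (reT w \<bullet> imT w) / 2) * of_real (k w)"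

definition synth :: "(complex ^ 'd \<Rightarrow> complex) \<Rightarrow> real ^ 'd \<Rightarrow> complex" where
  "synth F0 x = (LINT w|lborel. phi F0 w * atom w x)"

lemma measurable_phi:
  assumes [measurable]: "F0 \<in> borel_measurable borel"
  shows "phi F0 \<in> borel_measurable borel"
  unfolding phi_def[abs_def] by measurable

lemma phi_bound:
  assumes "continuous_on UNIV F0"
  shows "\<exists>C\<ge>0. \<forall>w. norm (phi F0 w) \<le> C * indicator (pdisc T) w"
proof -
  have "bounded (F0 ` pdisc T)"
    using compact_continuous_image[OF continuous_on_subset[OF assms subset_UNIV] compact_pdisc] by (rule compact_imp_bounded)
  then obtain C where C: "\<And>w. w \<in> pdisc T \<Longrightarrow> norm (F0 w) \<le> C" by (auto simp: bounded_iff)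
  have C0: "C \<ge> 0" using C[of 0] T_pos order_trans[OF norm_ge_zero] by (simp add: pdisc_def)
  show ?thesis
  proof (intro exI[of _ "C * B"] conjI allI)
    fix w
    show "norm (phi F0 w) \<le> C * B * indicator (pdisc T) w"
    proof (cases "w \<in> pdisc T")
      case True
      have "norm (phi F0 w) = norm (F0 (cnjT w)) * k w"
        using k_nonneg[of w] by (simp add: phi_def norm_mult)
      also have "\<dots> \<le> C * B"
        using C[OF cnjT_pdisc[OF True]] k_le k_nonneg C0 by (intro mult_mono) auto
      finally show ?thesis using True by simp
    qed (simp add: phi_def k_supp)
  qed (use C0 B_nonneg in auto)
qed

lemma phi_atom_bound:
  assumes "continuous_on UNIV F0"
  shows "\<exists>C\<ge>0. \<forall>w x. norm (phi F0 w * atom w x) \<le> (C * indicator (pdisc T) w) * exp (- (1 / 4) * (norm x)\<^sup>2)"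
proof -
  obtain C where C: "C \<ge> 0" "\<And>w. norm (phi F0 w) \<le> C * indicator (pdisc T) w"
    using phi_bound[OF assms] by blast
  obtain R where R: "\<And>w :: complex ^ 'd. w \<in> pdisc T \<Longrightarrow> norm w \<le> R"
    using compact_imp_bounded[OF compact_pdisc[of T, where 'd='d]] unfolding bounded_iff by blast
  let ?K = "pi powr (- real CARD('d) / 4) * exp (R\<^sup>2 / 2)"
  show ?thesis
  proof (intro exI[of _ "C * ?K"] conjI allI)
    fix w :: "complex ^ 'd" and x :: "real ^ 'd"
    show "norm (phi F0 w * atom w x) \<le> (C * ?K * indicator (pdisc T) w) * exp (- (1 / 4) * (norm x)\<^sup>2)"
    proof (cases "w \<in> pdisc T")
      case True
      have "norm (phi F0 w) * norm (atom w x) \<le> C * (?K * exp (- (1 / 4) * (norm x)\<^sup>2))"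
        using C(2)[of w] True atom_bound[OF R[OF True], of x] C(1) by (intro mult_mono) auto
      then show ?thesis using True by (simp add: norm_mult mult.assoc)
    qed (simp add: phi_def k_supp)
  qed (use C in auto)
qed

lemma measurable_synth:
  assumes [measurable]: "F0 \<in> borel_measurable borel"
  shows "synth F0 \<in> borel_measurable borel"
proof -
  note measurable_phi[OF assms, measurable]
  have "(\<lambda>x. LINT w|lborel. phi F0 w * atom w x) \<in> borel_measurable borel"
    by (rule lborel.borel_measurable_lebesgue_integral) measurable
  then show ?thesis by (simp add: synth_def[abs_def])
qed

lemma square_integrable_synth:
  assumes F0: "continuous_on UNIV F0"
  shows "square_integrable (synth F0)"
proof -
  have F0m: "F0 \<in> borel_measurable borel" by (rule borel_measurable_continuous_onI[OF F0])
  obtain C where C: "C \<ge> 0" "\<And>w x. norm (phi F0 w * atom w x) \<le> (C * indicator (pdisc T) w) * exp (- (1 / 4) * (norm x)\<^sup>2)"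
    using phi_atom_bound[OF F0] by blast
  let ?M = "LINT w|lborel. C * indicator (pdisc T :: (complex ^ 'd) set) w"
  show ?thesis
  proof (rule square_integrable_if_gauss_bound[OF measurable_synth[OF F0m]])
    fix x :: "real ^ 'd"
    let ?e = "exp (- (1 / 4) * (norm x)\<^sup>2)"
    note measurable_phi[OF F0m, measurable]
    have i: "integrable lborel (\<lambda>w :: complex ^ 'd. (C * indicator (pdisc T) w) * ?e)"
      by (intro integrable_mult_left integrable_mult_right integrable_pdisc)
    have i': "integrable lborel (\<lambda>w. phi F0 w * atom w x)"
      by (rule Bochner_Integration.integrable_bound[OF i])
        (use order_trans[OF C(2) abs_ge_self] in auto)
    have "norm (synth F0 x) \<le> (LINT w|lborel. norm (phi F0 w * atom w x))"
      unfolding synth_def by (rule integral_norm_bound)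
    also have "\<dots> \<le> (LINT w|lborel. (C * indicator (pdisc T :: (complex ^ 'd) set) w) * ?e)"
    proof (rule integral_mono)
      show "integrable lborel (\<lambda>w. norm (phi F0 w * atom w x))" using i' by (rule integrable_norm)
    qed (use i C(2) in auto)
    also have "\<dots> = ?M * ?e" by (rule integral_mult_left_zero)
    finally show "norm (synth F0 x) \<le> ?M * exp (- (1 / 4) * (norm x)\<^sup>2)" .
  qed simp
qed

lemma hermite_coeff_synth_weight:
  assumes F0: "continuous_on UNIV F0"
  shows "hermite_coeff (synth F0) \<alpha> = of_real (mi_const \<alpha>) * (LINT w|lborel. F0 (cnjT w) * weight \<alpha> w)"
proof -
  have F0m [measurable]: "F0 \<in> borel_measurable borel" by (rule borel_measurable_continuous_onI[OF F0])
  note measurable_phi[OF F0m, measurable] measurable_synth[OF F0m, measurable]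
  obtain C where C: "C \<ge> 0" "\<And>w x. norm (phi F0 w * atom w x) \<le> (C * indicator (pdisc T) w) * exp (- (1 / 4) * (norm x)\<^sup>2)"
    using phi_atom_bound[OF F0] by blast
  obtain H where H: "H > 0" "\<And>x. \<bar>hermite_fun \<alpha> x\<bar> \<le> H * exp (- (1 / 4) * (norm x)\<^sup>2)"
    using hermite_fun_bound by blast
  let ?f = "\<lambda>w x. phi F0 w * atom w x * of_real (hermite_fun \<alpha> x)"
  have int: "integrable (lborel \<Otimes>\<^sub>M lborel) (case_prod ?f)"
  proof (rule integrable_prod_bound)
    show "integrable lborel (\<lambda>w :: complex ^ 'd. C * indicator (pdisc T) w)"
      by (intro integrable_mult_right integrable_pdisc)
    show "integrable lborel (\<lambda>x :: real ^ 'd. H * exp (- (1 / 2) * (norm x)\<^sup>2))"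
      by (intro integrable_mult_right integrable_gauss_vec) simp
    fix w :: "complex ^ 'd" and x :: "real ^ 'd"
    have "norm (?f w x) \<le> ((C * indicator (pdisc T) w) * exp (- (1 / 4) * (norm x)\<^sup>2)) * (H * exp (- (1 / 4) * (norm x)\<^sup>2))"
      unfolding norm_mult[of "phi F0 w * atom w x"] norm_of_real using C H by (intro mult_mono) auto
    also have "\<dots> = (C * indicator (pdisc T) w) * (H * (exp (- (1 / 4) * (norm x)\<^sup>2) * exp (- (1 / 4) * (norm x)\<^sup>2)))"
      by (simp only: mult_ac)
    also have "exp (- (1 / 4) * (norm x)\<^sup>2) * exp (- (1 / 4) * (norm x)\<^sup>2) = exp (- (1 / 2) * (norm x)\<^sup>2)"
      by (simp add: mult_exp_exp)
    finally show "norm (case_prod ?f (w, x)) \<le> (C * indicator (pdisc T) w) * (H * exp (- (1 / 2) * (norm x)\<^sup>2))" by simp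
  qed measurable
  have "hermite_coeff (synth F0) \<alpha> = (LINT x|lborel. synth F0 x * of_real (hermite_fun \<alpha> x))"
    unfolding hermite_coeff_def complex_cnj_complex_of_real by (rule integral_completion) measurable
  also have "\<dots> = (LINT x|lborel. LINT w|lborel. ?f w x)"
    unfolding synth_def by (simp only: integral_mult_left_zero)
  also have "\<dots> = (LINT w|lborel. LINT x|lborel. ?f w x)"
    by (rule lborel_pair.Fubini_integral[OF int])
  also have "\<dots> = (LINT w|lborel. of_real (mi_const \<alpha>) * (F0 (cnjT w) * weight \<alpha> w))"
  proof (rule Bochner_Integration.integral_cong[OF refl])
    fix w :: "complex ^ 'd"
    \<comment> \<open>The halved phase of \<open>phi\<close> is exactly inverse to the phase in the
      Hermite coefficients of \<open>atom w\<close>.\<close>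
    have ph: "exp (- \<i> * of_real (reT w \<bullet> imT w) / 2) * exp (\<i> * of_real (reT w \<bullet> imT w) / 2) = 1"
      by (simp flip: exp_add)
    have "(LINT x|lborel. ?f w x) = phi F0 w * (LINT x|lborel. atom w x * of_real (hermite_fun \<alpha> x))"
      by (simp only: mult.assoc integral_mult_right_zero)
    also have "\<dots> = of_real (mi_const \<alpha>) * (F0 (cnjT w) * weight \<alpha> w)
       * (exp (- \<i> * of_real (reT w \<bullet> imT w) / 2) * exp (\<i> * of_real (reT w \<bullet> imT w) / 2))"
      unfolding atom_hermite_integral phi_def weight_def of_real_mult by (simp only: mult_ac)
    finally show "(LINT x|lborel. ?f w x) = of_real (mi_const \<alpha>) * (F0 (cnjT w) * weight \<alpha> w)"
      unfolding ph by simp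
  qed
  also have "\<dots> = of_real (mi_const \<alpha>) * (LINT w|lborel. F0 (cnjT w) * weight \<alpha> w)"
    by (rule integral_mult_right_zero)
  finally show ?thesis .
qed

section \<open>Two-sided bounds for the multiplier\<close>

definition moment :: "'d multi_index \<Rightarrow> real" where
  "moment \<alpha> = (LINT w|lborel. (norm (monomial w \<alpha>))\<^sup>2 * (k w * exp (- (norm w)\<^sup>2 / 4)))"

lemma gram_diag: "gram \<alpha> \<alpha> = of_real (moment \<alpha>)"
proof -
  have c: "monomial (cnjT w) \<alpha> = cnj (monomial w \<alpha>)" for w :: "complex ^ 'd"
    by (simp add: monomial_def)
  have e: "monomial (cnjT w) \<alpha> * weight \<alpha> w = of_real ((norm (monomial w \<alpha>))\<^sup>2 * (k w * exp (- (norm w)\<^sup>2 / 4)))" for w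
  proof -
    have "monomial (cnjT w) \<alpha> * weight \<alpha> w = (monomial w \<alpha> * cnj (monomial w \<alpha>)) * of_real (k w * exp (- (norm w)\<^sup>2 / 4))"
      unfolding c weight_def by (simp only: mult_ac)
    then show ?thesis unfolding complex_norm_square[symmetric] by (simp only: of_real_mult)
  qed
  show ?thesis unfolding gram_def e moment_def by (rule integral_complex_of_real)
qed

definition multiplier :: "'d multi_index \<Rightarrow> real" where
  "multiplier \<alpha> = (1 / sqrt 2) ^ mi_length \<alpha> / mi_fact \<alpha> * moment \<alpha>"

lemma hermite_coeff_synth:
  assumes F0: "has_coeffs F0 a"
    and sm: "\<And>T. T > 0 \<Longrightarrow> (\<lambda>\<alpha>. norm (a \<alpha>) * T ^ mi_length \<alpha>) summable_on UNIV"
  shows "hermite_coeff (synth F0) \<alpha> = a \<alpha> * of_real (multiplier \<alpha>)"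
proof -
  have "continuous_on UNIV F0" by (rule power_series_continuous[OF F0 sm])
  note weight = hermite_coeff_synth_weight[OF this]
  have series: "(LINT w|lborel. F0 (cnjT w) * weight \<alpha> w) = a \<alpha> / of_real (sqrt (mi_fact \<alpha>)) * gram \<alpha> \<alpha>"
    by (rule power_series_weight_integral[OF F0 sm])
  have "hermite_coeff (synth F0) \<alpha> = a \<alpha> * of_real (mi_const \<alpha> / sqrt (mi_fact \<alpha>) * moment \<alpha>)"
    unfolding weight series gram_diag
    by simp
  then show ?thesis unfolding mi_const_eq multiplier_def .
qed

lemma integrable_moment: "integrable lborel (\<lambda>w. (norm (monomial w \<alpha>))\<^sup>2 * (k w * exp (- (norm w)\<^sup>2 / 4)))"
proof (rule integrable_bounded_pdisc)
  fix w :: "complex ^ 'd" assume w: "w \<in> pdisc T"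
  have "k w * exp (- (norm w)\<^sup>2 / 4) \<le> B * 1"
    using k_nonneg k_le B_nonneg by (intro mult_mono) auto
  then have "(norm (monomial w \<alpha>))\<^sup>2 * (k w * exp (- (norm w)\<^sup>2 / 4)) \<le> (T ^ mi_length \<alpha>)\<^sup>2 * B"
    using norm_monomial_le[OF w, of \<alpha>] k_nonneg[of w] T_pos by (intro mult_mono power_mono) auto
  then show "norm ((norm (monomial w \<alpha>))\<^sup>2 * (k w * exp (- (norm w)\<^sup>2 / 4))) \<le> (T ^ mi_length \<alpha>)\<^sup>2 * B"
    using k_nonneg[of w] by (simp add: abs_mult)
qed (auto simp: k_supp)

lemma moment_upper: "moment \<alpha> \<le> (T\<^sup>2) ^ mi_length \<alpha> * (B * measure lborel (pdisc T :: (complex ^ 'd) set))"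
proof -
  have "moment \<alpha> \<le> (LINT w|lborel. (T\<^sup>2) ^ mi_length \<alpha> * B * indicator (pdisc T :: (complex ^ 'd) set) w)"
    unfolding moment_def
  proof (rule integral_mono[OF integrable_moment])
    fix w :: "complex ^ 'd"
    show "(norm (monomial w \<alpha>))\<^sup>2 * (k w * exp (- (norm w)\<^sup>2 / 4)) \<le> (T\<^sup>2) ^ mi_length \<alpha> * B * indicator (pdisc T) w"
    proof (cases "w \<in> pdisc T")
      case True
      have "k w * exp (- (norm w)\<^sup>2 / 4) \<le> B * 1"
        using k_nonneg k_le B_nonneg by (intro mult_mono) auto
      then have "(norm (monomial w \<alpha>))\<^sup>2 * (k w * exp (- (norm w)\<^sup>2 / 4)) \<le> (T ^ mi_length \<alpha>)\<^sup>2 * B"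
        using norm_monomial_le[OF True, of \<alpha>] k_nonneg[of w] T_pos by (intro mult_mono power_mono) auto
      then show ?thesis using True by (simp add: power_mult[symmetric] mult.commute)
    qed (simp add: k_supp)
  qed (intro integrable_mult_right integrable_pdisc)
  then show ?thesis by (simp add: mult.assoc)
qed

lemma moment_lower: "\<exists>K>0. \<forall>\<alpha>. K * (t\<^sup>2 / 4) ^ mi_length \<alpha> \<le> moment \<alpha>"
proof -
  \<comment> \<open>On this ball every coordinate has modulus between \<open>t / 2\<close> and
    \<open>t\<close>. Hence the cut-off is at least \<open>c\<close> almost everywhere there, the
    squared monomial at least \<open>(t^2 / 4) ^ mi_length \<alpha>\<close>, and \<open>?E\<close>
    bounds the Gaussian from below.\<close>
  let ?b = "(\<chi> j. of_real (3 * t / 4)) :: complex ^ 'd"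
  let ?A = "ball ?b (t / 4)"
  let ?E = "exp (- (real CARD('d) * t\<^sup>2) / 4)"
  let ?K = "c * ?E * measure lborel ?A"
  have A: "t / 2 < norm (w $ j)" "norm (w $ j) < t" if "w \<in> ?A" for w j
  proof -
    have "norm (w $ j - of_real (3 * t / 4)) \<le> norm (w - ?b)"
      using Finite_Cartesian_Product.norm_nth_le[of "w - ?b" j] by simp
    also have "\<dots> < t / 4" using that by (simp add: dist_norm norm_minus_commute)
    finally have d: "norm (w $ j - of_real (3 * t / 4)) < t / 4" .
    have n: "norm (of_real (3 * t / 4) :: complex) = 3 * t / 4"
      unfolding norm_of_real using t_pos by simp
    show "t / 2 < norm (w $ j)" "norm (w $ j) < t"
      using norm_triangle_ineq2[of "of_real (3 * t / 4)" "w $ j"] norm_triangle_ineq2[of "w $ j" "of_real (3 * t / 4)"]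
        d n norm_minus_commute[of "w $ j" "of_real (3 * t / 4)"] by linarith+
  qed
  have le: "?K * (t\<^sup>2 / 4) ^ mi_length \<alpha> \<le> moment \<alpha>" for \<alpha>
  proof -
    have fin: "emeasure lborel ?A < \<infinity>" using emeasure_lborel_ball_finite[of ?b "t / 4"] by simp
    have "?K * (t\<^sup>2 / 4) ^ mi_length \<alpha> = (LINT w|lborel. c * ?E * (t\<^sup>2 / 4) ^ mi_length \<alpha> * indicator ?A w)"
      by simp
    also have "\<dots> \<le> moment \<alpha>"
      unfolding moment_def
    proof (rule integral_mono_AE[OF _ integrable_moment])
      show "integrable lborel (\<lambda>w. c * ?E * (t\<^sup>2 / 4) ^ mi_length \<alpha> * indicator ?A w)"
        using fin by (intro integrable_mult_right integrable_real_indicator) auto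
      show "AE w in lborel. c * ?E * (t\<^sup>2 / 4) ^ mi_length \<alpha> * indicator ?A w
          \<le> (norm (monomial w \<alpha>))\<^sup>2 * (k w * exp (- (norm w)\<^sup>2 / 4))"
        using k_ge
      proof eventually_elim
        case (elim w)
        show ?case
        proof (cases "w \<in> ?A")
          case True
          have kc: "c \<le> k w" using elim A[OF True] by blast
          have "(norm w)\<^sup>2 \<le> (\<Sum>j\<in>(UNIV::'d set). t\<^sup>2)"
            unfolding norm_power2_cvec using A[OF True] by (intro sum_mono power_mono) (auto intro: less_imp_le)
          then have E: "?E \<le> exp (- (norm w)\<^sup>2 / 4)" by simp
          have "(t / 2) ^ mi_length \<alpha> \<le> norm (monomial w \<alpha>)"
            unfolding norm_monomial mi_length_def power_sum
            using power_mono[OF less_imp_le[OF A(1)[OF True]]] t_pos by (intro prod_mono) auto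
          then have "((t / 2) ^ mi_length \<alpha>)\<^sup>2 \<le> (norm (monomial w \<alpha>))\<^sup>2"
            using t_pos by (intro power_mono) auto
          moreover have "((t / 2) ^ mi_length \<alpha>)\<^sup>2 = (t\<^sup>2 / 4) ^ mi_length \<alpha>"
            by (simp add: power2_eq_square power_mult_distrib[symmetric])
          ultimately have M: "(t\<^sup>2 / 4) ^ mi_length \<alpha> \<le> (norm (monomial w \<alpha>))\<^sup>2" by simp
          have "(t\<^sup>2 / 4) ^ mi_length \<alpha> * (c * ?E) \<le> (norm (monomial w \<alpha>))\<^sup>2 * (k w * exp (- (norm w)\<^sup>2 / 4))"
            using M kc E c_pos k_nonneg[of w] by (intro mult_mono) auto
          then show ?thesis using True by (simp add: mult.commute)
        qed (use k_nonneg[of w] in simp)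
      qed
    qed
    finally show ?thesis .
  qed
  have "?K > 0" using c_pos t_pos by (simp add: content_ball_pos)
  then show ?thesis using le by blast
qed

text \<open>The moments grow at most geometrically, and in each coordinate
  \<open>b ^ n / fact n \<le> exp b\<close>.\<close>

lemma multiplier_upper: "\<exists>K>0. \<forall>\<alpha>. \<bar>multiplier \<alpha>\<bar> \<le> K"
proof -
  let ?V = "B * measure lborel (pdisc T :: (complex ^ 'd) set)"
  let ?b = "1 / sqrt 2 * T\<^sup>2"
  have V: "?V \<ge> 0" using B_nonneg by simp
  obtain K where K: "K > 0" "\<And>\<alpha>. K * (t\<^sup>2 / 4) ^ mi_length \<alpha> \<le> moment \<alpha>"
    using moment_lower by blast
  show ?thesis
  proof (intro exI[of _ "exp ?b ^ CARD('d) * ?V + 1"] conjI allI)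
    show "0 < exp ?b ^ CARD('d) * ?V + 1" using mult_nonneg_nonneg[OF _ V, of "exp ?b ^ CARD('d)"] by simp
    fix \<alpha>
    have m0: "moment \<alpha> \<ge> 0" using K(1) K(2)[of \<alpha>] by (smt (verit) mult_nonneg_nonneg zero_le_power zero_le_divide_iff zero_le_power2)
    have f: "0 \<le> (1 / sqrt 2) ^ mi_length \<alpha> / mi_fact \<alpha>"
      using mi_fact_pos[of \<alpha>] by simp
    have "\<bar>multiplier \<alpha>\<bar> = (1 / sqrt 2) ^ mi_length \<alpha> / mi_fact \<alpha> * moment \<alpha>"
      unfolding multiplier_def using mult_nonneg_nonneg[OF f m0] by (rule abs_of_nonneg)
    also have "\<dots> \<le> (1 / sqrt 2) ^ mi_length \<alpha> / mi_fact \<alpha> * ((T\<^sup>2) ^ mi_length \<alpha> * ?V)"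
      using moment_upper f by (rule mult_left_mono)
    also have "\<dots> = ?b ^ mi_length \<alpha> / mi_fact \<alpha> * ?V"
      unfolding power_mult_distrib by simp
    also have "\<dots> \<le> exp ?b ^ CARD('d) * ?V"
      using V by (intro mult_right_mono mi_power_fact_bound) auto
    finally show "\<bar>multiplier \<alpha>\<bar> \<le> exp ?b ^ CARD('d) * ?V + 1" by simp
  qed
qed

text \<open>Obtained by inverting the lower bound for the moments. Positivity permits division by
  the multiplier, and the cost of that division has exactly the form that
  \<open>theta_factorial_bound\<close> absorbs.\<close>

lemma multiplier_lower:
  "\<exists>K>0. \<exists>A>0. \<forall>\<alpha>. 0 < multiplier \<alpha> \<and> 1 / multiplier \<alpha> \<le> K * (mi_fact \<alpha> * A ^ mi_length \<alpha>)"
proof -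
  obtain K where K: "K > 0" "\<And>\<alpha>. K * (t\<^sup>2 / 4) ^ mi_length \<alpha> \<le> moment \<alpha>"
    using moment_lower by blast
  let ?a = "1 / sqrt 2 * (t\<^sup>2 / 4)"
  have a: "?a > 0" using t_pos by simp
  show ?thesis
  proof (rule exI[of _ "1 / K"], rule conjI, use K in simp, rule exI[of _ "1 / ?a"], intro conjI allI)
    show "0 < 1 / ?a" by (rule divide_pos_pos[OF _ a]) simp
    fix \<alpha> :: "'d multi_index"
    have "K * ?a ^ mi_length \<alpha> / mi_fact \<alpha> = (1 / sqrt 2) ^ mi_length \<alpha> / mi_fact \<alpha> * (K * (t\<^sup>2 / 4) ^ mi_length \<alpha>)"
      unfolding power_mult_distrib by simp
    also have "\<dots> \<le> multiplier \<alpha>"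
      unfolding multiplier_def using K mi_fact_pos[of \<alpha>] by (intro mult_left_mono) auto
    finally have le: "K * ?a ^ mi_length \<alpha> / mi_fact \<alpha> \<le> multiplier \<alpha>" .
    have pos: "0 < K * ?a ^ mi_length \<alpha> / mi_fact \<alpha>"
      by (rule divide_pos_pos[OF mult_pos_pos[OF K(1) zero_less_power[OF a]] mi_fact_pos])
    show "0 < multiplier \<alpha>" using pos le by linarith
    have "1 / multiplier \<alpha> \<le> 1 / (K * ?a ^ mi_length \<alpha> / mi_fact \<alpha>)"
      by (rule frac_le[OF _ _ pos le]) auto
    also have "\<dots> = 1 / K * (mi_fact \<alpha> * (1 / ?a) ^ mi_length \<alpha>)"
      unfolding power_one_over by simp
    finally show "1 / multiplier \<alpha> \<le> 1 / K * (mi_fact \<alpha> * (1 / ?a) ^ mi_length \<alpha>)" .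
  qed
qed

end

subsection \<open>The equivalence\<close>

text \<open>Clipping a Borel representative to \<open>[0, \<bar>B0\<bar>]\<close> and restricting it
  to a closed polydisc changes it on a null set only. The largest outer and the smallest inner
  radius serve for all coordinates.\<close>

lemma R_infty_cutoff:
  fixes \<kappa> :: "complex ^ 'd::finite \<Rightarrow> real"
  assumes "\<kappa> \<in> R_infty"
  obtains k B T c t where "cutoff k B T c t" "AE z in lborel. \<kappa> z = k z"
proof -
  obtain t1 t2 where t: "pos_vec t1" "pos_vec t2" and \<kappa>: "\<kappa> \<in> R_infty_between t1 t2"
    using assms by (auto simp: R_infty_def)
  have meas: "\<kappa> \<in> borel_measurable lebesgue" and "ess_bounded \<kappa>"
    and nonneg: "AE z in lborel. 0 \<le> \<kappa> z"
    and supp: "AE z in lborel. z \<notin> closure (polydisc t2) \<longrightarrow> \<kappa> z = 0"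
    and radial: "\<exists>k0. AE z in lborel. \<kappa> z = k0 (\<chi> j. norm (z $ j))"
    and lower: "\<exists>c>0. AE z in lborel. z \<in> polydisc t1 \<longrightarrow> c \<le> \<kappa> z"
    using \<kappa> unfolding R_infty_between_def AE_completion_iff by auto
  obtain B0 where "AE z in lborel. norm (\<kappa> z) \<le> B0"
    using \<open>ess_bounded \<kappa>\<close> unfolding ess_bounded_def AE_completion_iff by auto
  then have upper: "AE z in lborel. \<kappa> z \<le> \<bar>B0\<bar>" by eventually_elim auto
  define T where "T = Max (range (\<lambda>j. t2 $ j))"
  define t where "t = Min (range (\<lambda>j. t1 $ j))"
  have T: "t2 $ j \<le> T" for j by (simp add: T_def)
  have tt: "t \<le> t1 $ j" for j by (simp add: t_def)
  have T_pos: "T > 0" using T t(2) by (auto simp: pos_vec_def intro: less_le_trans)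
  have t_pos: "t > 0" using t(1) by (simp add: t_def pos_vec_def)
  have cl: "closure (polydisc t2) \<subseteq> pdisc T"
  proof (rule closure_minimal)
    show "polydisc t2 \<subseteq> pdisc T"
      using order_trans[OF less_imp_le T] by (auto simp: polydisc_def pdisc_def)
  qed (intro compact_imp_closed compact_pdisc)
  obtain k1 where k1 [measurable]: "k1 \<in> borel_measurable lborel" and eq1: "AE z in lborel. \<kappa> z = k1 z"
    using completion_ex_borel_measurable_real[OF meas] by blast
  define k where "k z = indicator (pdisc T) z * max 0 (min \<bar>B0\<bar> (k1 z))" for z
  have eq: "AE z in lborel. \<kappa> z = k z"
    using eq1 nonneg supp upper
  proof eventually_elim
    case (elim z)
    show ?case
    proof (cases "z \<in> pdisc T")
      case False
      then show ?thesis using elim cl by (auto simp: k_def)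
    qed (use elim in \<open>simp add: k_def\<close>)
  qed
  obtain k0 where k0: "AE z in lborel. \<kappa> z = k0 (\<chi> j. norm (z $ j))" using radial by blast
  obtain c where c: "c > 0" "AE z in lborel. z \<in> polydisc t1 \<longrightarrow> c \<le> \<kappa> z" using lower by blast
  have "cutoff k \<bar>B0\<bar> T c t"
  proof
    show "k \<in> borel_measurable borel" unfolding k_def[abs_def] using k1 by measurable
    show "0 \<le> k w" for w by (simp add: k_def)
    show "k w \<le> \<bar>B0\<bar>" for w by (simp add: k_def indicator_def)
    show "k w = 0" if "w \<notin> pdisc T" for w using that by (simp add: k_def)
    show "\<exists>k0. AE w in lborel. k w = k0 (\<chi> j. norm (w $ j))"
      using eq k0 by (intro exI[of _ k0], eventually_elim) simp
    show "AE w in lborel. (\<forall>j. norm (w $ j) < t) \<longrightarrow> c \<le> k w"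
      using eq c(2)
    proof eventually_elim
      case (elim w)
      then show ?case using tt by (auto simp: polydisc_def intro: less_le_trans)
    qed
  qed (use T_pos t_pos c in auto)
  then show ?thesis using that eq by blast
qed

section \<open>The adjoint transform expressed by synthesis\<close>

context cutoff
begin

definition lift :: "(complex ^ 'd \<Rightarrow> complex) \<Rightarrow> (real ^ 'd) \<times> (real ^ 'd) \<Rightarrow> complex" where
  "lift F0 p = phi F0 (phase_iso p)"

lemma lift_eq: "lift F0 (x, \<xi>) = F0 (cvec x (- \<xi>)) * exp (- \<i> * of_real (x \<bullet> \<xi>) / 2) * of_real (k (cvec x \<xi>))"
  by (simp add: lift_def phi_def cnjT_phase_iso) (simp add: phase_iso_def)

lemma measurable_lift:
  assumes "F0 \<in> borel_measurable borel"
  shows "lift F0 \<in> borel_measurable borel"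
proof -
  note measurable_phi[OF assms, measurable]
  show ?thesis unfolding lift_def[abs_def] by measurable
qed

text \<open>A change of \<open>F\<close> on a null set alters no value of the integral, hence
  equality at every point; the isometry \<open>phase_iso\<close> then passes from pairs to complex
  vectors.\<close>

lemma stft_adj_lift:
  assumes F0m: "F0 \<in> borel_measurable borel"
    and F: "AE p in lebesgue. F p = lift F0 p" and Fm: "F \<in> borel_measurable lebesgue"
  shows "stft_adj gauss F = synth F0"
proof
  fix x :: "real ^ 'd"
  note measurable_lift[OF F0m, measurable] measurable_phi[OF F0m, measurable]
  let ?e = "\<lambda>p :: (real ^ 'd) \<times> (real ^ 'd). gauss (x - fst p) * exp (\<i> * of_real (x \<bullet> snd p))"
  have e [measurable]: "?e \<in> borel_measurable borel"
    unfolding gauss_def by (intro borel_measurable_continuous_onI continuous_intros) auto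
  have em: "?e \<in> borel_measurable lebesgue" "lift F0 \<in> borel_measurable lebesgue"
    by (simp_all add: measurable_completion)
  have "stft_adj gauss F x = (LINT p|lebesgue. F p * ?e p)"
    by (simp add: stft_adj_def mult.assoc)
  also have "\<dots> = (LINT p|lebesgue. lift F0 p * ?e p)"
  proof (rule integral_cong_AE)
    show "AE p in lebesgue. F p * ?e p = lift F0 p * ?e p"
      using F by eventually_elim simp
  qed (intro borel_measurable_times Fm em)+
  also have "\<dots> = (LINT p|lborel. lift F0 p * ?e p)"
    by (rule integral_completion) measurable
  also have "\<dots> = (LINT p|lborel. (\<lambda>w. phi F0 w * atom w x) (phase_iso p))"
    by (simp add: lift_def atom_def)
  also have "\<dots> = (LINT w|distr lborel borel phase_iso. phi F0 w * atom w x)"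
    by (rule integral_distr[symmetric]) measurable
  also have "\<dots> = synth F0 x"
    unfolding lborel_distr_phase_iso synth_def ..
  finally show "stft_adj gauss F x = synth F0 x" .
qed

lemma lift_Linfty_compact:
  assumes F0: "continuous_on UNIV F0"
  shows "lift F0 \<in> Linfty_compact"
proof -
  have F0m: "F0 \<in> borel_measurable borel" by (rule borel_measurable_continuous_onI[OF F0])
  obtain C where C: "\<And>w. norm (phi F0 w) \<le> C * indicator (pdisc T) w" "C \<ge> 0"
    using phi_bound[OF F0] by blast
  obtain R where R: "\<And>w :: complex ^ 'd. w \<in> pdisc T \<Longrightarrow> norm w \<le> R"
    using compact_imp_bounded[OF compact_pdisc[of T, where 'd='d]] unfolding bounded_iff by blast
  have "lift F0 \<in> borel_measurable lebesgue"
    using measurable_lift[OF F0m] by (simp add: measurable_completion)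
  moreover have "norm (lift F0 p) \<le> C" for p
    unfolding lift_def by (rule order_trans[OF C(1)]) (use C(2) in \<open>auto simp: indicator_def\<close>)
  then have "ess_bounded (lift F0)"
    unfolding ess_bounded_def by (intro exI[of _ C]) simp
  moreover have "lift F0 p = 0" if "p \<notin> cball 0 R" for p
  proof -
    have "phase_iso p \<notin> pdisc T" using R[of "phase_iso p"] that by (auto simp: norm_phase_iso)
    then show ?thesis using C(1)[of "phase_iso p"] by (simp add: lift_def)
  qed
  then have "\<exists>K. compact K \<and> (AE x in lebesgue. x \<notin> K \<longrightarrow> lift F0 x = 0)"
    by (intro exI[of _ "cball 0 R"]) auto
  ultimately show ?thesis by (simp add: Linfty_compact_def)
qed

text \<open>\<open>Dec\<close> abstracts the decay condition, so that both cases of the theorem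
  share one proof. \<open>Dec_theta\<close> makes the power series converge; \<open>Dec_fact\<close>
  serves both directions, once for the multiplier and once for its inverse.\<close>

theorem synthesis_equivalence:
  fixes Dec :: "('d multi_index \<Rightarrow> complex) \<Rightarrow> bool" and f :: "(real ^ 'd \<Rightarrow> complex) \<Rightarrow> complex"
  assumes \<kappa>: "AE z in lborel. \<kappa> z = k z"
    and s: "0 < s" "s < 1 / 2"
    and Dec_theta: "\<And>a. Dec a \<Longrightarrow> \<exists>r. pos_vec r \<and> (\<exists>C>0. \<forall>\<alpha>. norm (a \<alpha>) \<le> C * theta s r \<alpha>)"
    and Dec_fact: "\<And>a a' K A. Dec a \<Longrightarrow> 0 < K \<Longrightarrow> 0 < A \<Longrightarrow>
        (\<And>\<alpha>. norm (a' \<alpha>) \<le> K * (mi_fact \<alpha> * A ^ mi_length \<alpha>) * norm (a \<alpha>)) \<Longrightarrow> Dec a'"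
  shows "distr_in f {g. square_integrable g \<and> Dec (hermite_coeff g)} \<longleftrightarrow>
    (\<exists>F \<in> Linfty_compact. distr_eq f (fun_distr (stft_adj gauss F)) \<and>
      (\<exists>F0 \<in> {G. \<exists>a. has_coeffs G a \<and> Dec a}. AE (x, \<xi>) in lebesgue.
         F (x, \<xi>) = F0 (cvec x (- \<xi>)) * exp (- \<i> * of_real (x \<bullet> \<xi>) / 2) * of_real (\<kappa> (cvec x \<xi>))))"
proof -
  have sm: "(\<lambda>\<alpha>. norm (a \<alpha>) * R ^ mi_length \<alpha>) summable_on UNIV" if "Dec a" "R > 0" for a R
  proof -
    obtain r C where r: "pos_vec r" and C: "C > 0" "\<And>\<alpha>. norm (a \<alpha>) \<le> C * theta s r \<alpha>"
      using Dec_theta[OF \<open>Dec a\<close>] by blast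
    have "(\<lambda>\<alpha>. C * (theta s r \<alpha> * R ^ mi_length \<alpha>)) summable_on UNIV"
      by (intro summable_on_cmult_right theta_power_summable r s \<open>R > 0\<close>)
    then show ?thesis
    proof (rule summable_on_comparison_test)
      fix \<alpha>
      have "norm (a \<alpha>) * R ^ mi_length \<alpha> \<le> (C * theta s r \<alpha>) * R ^ mi_length \<alpha>"
        using C(2) \<open>R > 0\<close> by (intro mult_right_mono) auto
      then show "norm (a \<alpha>) * R ^ mi_length \<alpha> \<le> C * (theta s r \<alpha> * R ^ mi_length \<alpha>)"
        by (simp only: mult.assoc)
    qed (use \<open>R > 0\<close> in auto)
  qed
  have cont: "continuous_on UNIV F0" if "has_coeffs F0 a" "Dec a" for F0 a
    by (rule power_series_continuous[OF that(1) sm[OF that(2)]])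
  have coeff: "hermite_coeff (synth F0) = (\<lambda>\<alpha>. a \<alpha> * of_real (multiplier \<alpha>))" if "has_coeffs F0 a" "Dec a" for F0 a
    by (rule ext, rule hermite_coeff_synth[OF that(1) sm[OF that(2)]])
  have AE_\<kappa>: "AE p in lebesgue. \<kappa> (cvec (fst p) (snd p)) = k (cvec (fst p) (snd p))"
    using AE_completion[OF AE_phase_iso[OF \<kappa>]] by (simp add: phase_iso_def)
  show ?thesis
  proof
    assume "distr_in f {g. square_integrable g \<and> Dec (hermite_coeff g)}"
    then obtain g where g: "square_integrable g" "Dec (hermite_coeff g)" "distr_eq f (fun_distr g)"
      by (auto simp: distr_in_def)
    obtain K A where K: "K > 0" "A > 0" "\<And>\<alpha>. 0 < multiplier \<alpha>"
      "\<And>\<alpha>. 1 / multiplier \<alpha> \<le> K * (mi_fact \<alpha> * A ^ mi_length \<alpha>)"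
      using multiplier_lower by blast
    \<comment> \<open>These coefficients are forced, since synthesis multiplies coefficients by
      \<open>multiplier\<close>.\<close>
    define a where "a \<alpha> = hermite_coeff g \<alpha> / of_real (multiplier \<alpha>)" for \<alpha>
    have Dec_a: "Dec a"
    proof (rule Dec_fact[OF g(2) K(1,2)])
      fix \<alpha>
      have "norm (a \<alpha>) = 1 / multiplier \<alpha> * norm (hermite_coeff g \<alpha>)"
        using K(3)[of \<alpha>] by (simp add: a_def norm_divide)
      also have "\<dots> \<le> K * (mi_fact \<alpha> * A ^ mi_length \<alpha>) * norm (hermite_coeff g \<alpha>)"
        by (rule mult_right_mono[OF K(4)]) simp
      finally show "norm (a \<alpha>) \<le> K * (mi_fact \<alpha> * A ^ mi_length \<alpha>) * norm (hermite_coeff g \<alpha>)" .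
    qed
    define F0 where "F0 z = (\<Sum>\<^sub>\<infinity>\<alpha>. a \<alpha> * monomial z \<alpha> / of_real (sqrt (mi_fact \<alpha>)))" for z :: "complex ^ 'd"
    have F0: "has_coeffs F0 a"
      unfolding has_coeffs_def
    proof
      fix z :: "complex ^ 'd"
      let ?R = "norm z + 1"
      have z: "z \<in> pdisc ?R"
        using order_trans[OF Finite_Cartesian_Product.norm_nth_le, of z "norm z + 1"] by (simp add: pdisc_def)
      have "(\<lambda>\<alpha>. norm (a \<alpha> * monomial z \<alpha> / of_real (sqrt (mi_fact \<alpha>)))) summable_on UNIV"
      proof (rule Infinite_Sum.abs_summable_on_comparison_test')
        show "(\<lambda>\<alpha>. norm (a \<alpha>) * ?R ^ mi_length \<alpha>) summable_on UNIV"
          by (rule sm[OF Dec_a]) (simp add: add_nonneg_pos)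
        fix \<alpha>
        show "norm (a \<alpha> * monomial z \<alpha> / of_real (sqrt (mi_fact \<alpha>))) \<le> norm (a \<alpha>) * ?R ^ mi_length \<alpha>"
          by (rule power_series_term_bound[OF z])
      qed
      then show "((\<lambda>\<alpha>. a \<alpha> * monomial z \<alpha> / of_real (sqrt (mi_fact \<alpha>))) has_sum F0 z) UNIV"
        unfolding F0_def by (rule has_sum_infsum[OF abs_summable_summable])
    qed
    have F0c: "continuous_on UNIV F0" by (rule cont[OF F0 Dec_a])
    have F0m: "F0 \<in> borel_measurable borel" by (rule borel_measurable_continuous_onI[OF F0c])
    have lift: "lift F0 \<in> Linfty_compact" by (rule lift_Linfty_compact[OF F0c])
    have G: "stft_adj gauss (lift F0) = synth F0"
      by (rule stft_adj_lift[OF F0m]) (use lift in \<open>auto simp: Linfty_compact_def\<close>)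
    have sq: "square_integrable (synth F0)" by (rule square_integrable_synth[OF F0c])
    \<comment> \<open>By the choice of \<open>a\<close>, both functions have the same Hermite
      coefficients, and completeness identifies them.\<close>
    have "AE x in lebesgue. g x - synth F0 x = 0"
    proof (rule hermite_complete[OF square_integrable_diff[OF g(1) sq]])
      fix \<alpha>
      have "multiplier \<alpha> \<noteq> 0" using K(3)[of \<alpha>] by simp
      then show "hermite_coeff (\<lambda>x. g x - synth F0 x) \<alpha> = 0"
        unfolding hermite_coeff_diff[OF g(1) sq] coeff[OF F0 Dec_a] by (simp add: a_def)
    qed
    then have ae: "AE x in lebesgue. g x = synth F0 x" by eventually_elim simp
    have gm: "g \<in> borel_measurable lebesgue" "synth F0 \<in> borel_measurable lebesgue"
      using g(1) sq by (auto simp: square_integrable_def)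
    \<comment> \<open>Equality almost everywhere passes to the distributions; the measurability of
      \<open>\<psi>\<close> comes from its smoothness.\<close>
    have "fun_distr g \<psi> = fun_distr (synth F0) \<psi>" if "\<psi> \<in> schwartz" for \<psi>
    proof -
      have "smooth \<psi>" using that by (simp add: schwartz_def)
      then have "\<psi> differentiable_on UNIV" unfolding smooth_def by (metis partial_derivs.simps(1))
      then have "\<psi> \<in> borel_measurable borel"
        by (intro borel_measurable_continuous_onI differentiable_imp_continuous_on)
      then have \<psi>m: "\<psi> \<in> borel_measurable lebesgue" by (simp add: measurable_completion)
      show ?thesis
        unfolding fun_distr_def
      proof (rule integral_cong_AE)
        show "AE x in lebesgue. g x * \<psi> x = synth F0 x * \<psi> x"
          using ae by eventually_elim simp
      qed (intro borel_measurable_times gm \<psi>m)+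
    qed
    then have "distr_eq f (fun_distr (stft_adj gauss (lift F0)))"
      using g(3) by (simp add: distr_eq_def G)
    moreover have "AE (x, \<xi>) in lebesgue. lift F0 (x, \<xi>)
        = F0 (cvec x (- \<xi>)) * exp (- \<i> * of_real (x \<bullet> \<xi>) / 2) * of_real (\<kappa> (cvec x \<xi>))"
      using AE_\<kappa>
    proof eventually_elim
      case (elim p)
      then show ?case by (cases p) (simp add: lift_eq)
    qed
    ultimately show "\<exists>F \<in> Linfty_compact. distr_eq f (fun_distr (stft_adj gauss F)) \<and>
      (\<exists>F0 \<in> {G. \<exists>a. has_coeffs G a \<and> Dec a}. AE (x, \<xi>) in lebesgue.
         F (x, \<xi>) = F0 (cvec x (- \<xi>)) * exp (- \<i> * of_real (x \<bullet> \<xi>) / 2) * of_real (\<kappa> (cvec x \<xi>)))"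
      using lift F0 Dec_a by blast
  next
    assume "\<exists>F \<in> Linfty_compact. distr_eq f (fun_distr (stft_adj gauss F)) \<and>
      (\<exists>F0 \<in> {G. \<exists>a. has_coeffs G a \<and> Dec a}. AE (x, \<xi>) in lebesgue.
         F (x, \<xi>) = F0 (cvec x (- \<xi>)) * exp (- \<i> * of_real (x \<bullet> \<xi>) / 2) * of_real (\<kappa> (cvec x \<xi>)))"
    then obtain F F0 a where F: "F \<in> Linfty_compact" "distr_eq f (fun_distr (stft_adj gauss F))"
      and F0: "has_coeffs F0 a" and Dec_a: "Dec a"
      and ae: "AE (x, \<xi>) in lebesgue. F (x, \<xi>) = F0 (cvec x (- \<xi>)) * exp (- \<i> * of_real (x \<bullet> \<xi>) / 2) * of_real (\<kappa> (cvec x \<xi>))"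
      by blast
    have F0c: "continuous_on UNIV F0" by (rule cont[OF F0 Dec_a])
    have F0m: "F0 \<in> borel_measurable borel" by (rule borel_measurable_continuous_onI[OF F0c])
    have "AE p in lebesgue. F p = lift F0 p"
      using ae AE_\<kappa>
    proof eventually_elim
      case (elim p)
      then show ?case by (cases p) (simp add: lift_eq)
    qed
    then have G: "stft_adj gauss F = synth F0"
      by (rule stft_adj_lift[OF F0m]) (use F in \<open>simp add: Linfty_compact_def\<close>)
    obtain K where K: "K > 0" "\<And>\<alpha>. \<bar>multiplier \<alpha>\<bar> \<le> K" using multiplier_upper by blast
    have "Dec (hermite_coeff (synth F0))"
    \<comment> \<open>The multiplier is bounded; as \<open>mi_fact \<alpha> \<ge> 1\<close>, the
      bound takes the required form with \<open>A = 1\<close>.\<close>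
    proof (rule Dec_fact[OF Dec_a K(1), of 1])
      fix \<alpha>
      have "norm (hermite_coeff (synth F0) \<alpha>) = \<bar>multiplier \<alpha>\<bar> * norm (a \<alpha>)"
        unfolding coeff[OF F0 Dec_a] by (simp add: norm_mult)
      also have "\<dots> \<le> (K * mi_fact \<alpha>) * norm (a \<alpha>)"
      proof (rule mult_right_mono)
        have "\<bar>multiplier \<alpha>\<bar> \<le> K * 1" using K(2)[of \<alpha>] by simp
        also have "\<dots> \<le> K * mi_fact \<alpha>" using K(1) mi_fact_ge_1 by (intro mult_left_mono) auto
        finally show "\<bar>multiplier \<alpha>\<bar> \<le> K * mi_fact \<alpha>" .
      qed simp
      finally show "norm (hermite_coeff (synth F0) \<alpha>) \<le> K * (mi_fact \<alpha> * 1 ^ mi_length \<alpha>) * norm (a \<alpha>)"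
        by simp
    qed simp
    then show "distr_in f {g. square_integrable g \<and> Dec (hermite_coeff g)}"
      using F(2) square_integrable_synth[OF F0c] unfolding distr_in_def G by blast
  qed
qed

end

theorem proposition4p8:
  fixes \<kappa> :: "complex ^ 'd::finite \<Rightarrow> real"
    and s :: real
    and f :: "(real ^ 'd \<Rightarrow> complex) \<Rightarrow> complex"
  assumes "\<kappa> \<in> R_infty"
    and "0 < s" and "s < 1 / 2"
    and "f \<in> tempered_distr"
  shows "(distr_in f (H_space s) \<longleftrightarrow>
           (\<exists>F \<in> Linfty_compact. distr_eq f (fun_distr (stft_adj gauss F)) \<and>
              (\<exists>F0 \<in> A_space s. AE (x, \<xi>) in lebesgue.
                 F (x, \<xi>) = F0 (cvec x (- \<xi>)) * exp (- \<i> * of_real (x \<bullet> \<xi>) / 2)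
                   * of_real (\<kappa> (cvec x \<xi>)))))
       \<and> (distr_in f (H0_space s) \<longleftrightarrow>
           (\<exists>F \<in> Linfty_compact. distr_eq f (fun_distr (stft_adj gauss F)) \<and>
              (\<exists>F0 \<in> A0_space s. AE (x, \<xi>) in lebesgue.
                 F (x, \<xi>) = F0 (cvec x (- \<xi>)) * exp (- \<i> * of_real (x \<bullet> \<xi>) / 2)
                   * of_real (\<kappa> (cvec x \<xi>)))))"
proof -
  obtain k B T c t where "cutoff k B T c t" and \<kappa>: "AE z in lborel. \<kappa> z = k z"
    using R_infty_cutoff[OF assms(1)] .
  then interpret cutoff k B T c t by simp
  let ?bd = "\<lambda>(a :: 'd multi_index \<Rightarrow> complex) r. \<exists>C>0. \<forall>\<alpha>. norm (a \<alpha>) \<le> C * theta s r \<alpha>"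
  \<comment> \<open>A factor of the form \<open>K * \<alpha>! * A^|\<alpha>|\<close> costs a
    doubling of \<open>r\<close>, whatever \<open>K\<close> and \<open>A\<close> are.\<close>
  have bd: "?bd a' (2 *\<^sub>R r)"
    if r: "pos_vec r" and "?bd a r" and K: "0 < K" "0 < A"
      and a': "\<And>\<alpha>. norm (a' \<alpha>) \<le> K * (mi_fact \<alpha> * A ^ mi_length \<alpha>) * norm (a \<alpha>)"
    for a a' :: "'d multi_index \<Rightarrow> complex" and r K A
  proof -
    obtain C where C: "C > 0" "\<And>\<alpha>. norm (a \<alpha>) \<le> C * theta s r \<alpha>" using \<open>?bd a r\<close> by blast
    obtain C' where C': "C' > 0" "\<And>\<alpha>. theta s r \<alpha> * (mi_fact \<alpha> * A ^ mi_length \<alpha>) \<le> C' * theta s (2 *\<^sub>R r) \<alpha>"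
      using theta_factorial_bound[OF r assms(2,3) K(2)] by blast
    show ?thesis
    proof (intro exI[of _ "K * C * C'"] conjI allI)
      fix \<alpha>
      have "norm (a' \<alpha>) \<le> K * (mi_fact \<alpha> * A ^ mi_length \<alpha>) * (C * theta s r \<alpha>)"
        using C(2) K mi_fact_pos[of \<alpha>] by (intro order_trans[OF a'] mult_left_mono) auto
      also have "\<dots> = K * C * (theta s r \<alpha> * (mi_fact \<alpha> * A ^ mi_length \<alpha>))" by (simp only: mult_ac)
      also have "\<dots> \<le> K * C * (C' * theta s (2 *\<^sub>R r) \<alpha>)"
        using C'(2) K C by (intro mult_left_mono) auto
      finally show "norm (a' \<alpha>) \<le> K * C * C' * theta s (2 *\<^sub>R r) \<alpha>" by (simp only: mult.assoc)
    qed (use K C C' in auto)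
  qed
  have pos2: "pos_vec (c *\<^sub>R r)" if "pos_vec r" "c > 0" for r :: "real ^ 'd" and c :: real
    using that by (simp add: pos_vec_def)
  show ?thesis
  proof
    let ?Dec = "\<lambda>a. \<exists>r. pos_vec r \<and> ?bd a r"
    show "distr_in f (H_space s) \<longleftrightarrow>
           (\<exists>F \<in> Linfty_compact. distr_eq f (fun_distr (stft_adj gauss F)) \<and>
              (\<exists>F0 \<in> A_space s. AE (x, \<xi>) in lebesgue.
                 F (x, \<xi>) = F0 (cvec x (- \<xi>)) * exp (- \<i> * of_real (x \<bullet> \<xi>) / 2)
                   * of_real (\<kappa> (cvec x \<xi>))))"
      unfolding H_space_def A_space_def
    proof (rule synthesis_equivalence[where Dec = ?Dec, OF \<kappa> assms(2,3)])
      fix a a' :: "'d multi_index \<Rightarrow> complex" and K A :: real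
      assume "?Dec a" and K: "0 < K" "0 < A"
        and a': "\<And>\<alpha>. norm (a' \<alpha>) \<le> K * (mi_fact \<alpha> * A ^ mi_length \<alpha>) * norm (a \<alpha>)"
      then obtain r where r: "pos_vec r" "?bd a r" by blast
      \<comment> \<open>The witness is \<open>2 *\<^sub>R r\<close>.\<close>
      show "?Dec a'"
        using bd[OF r K a'] pos2[OF r(1), of 2] by auto
    qed
    let ?Dec0 = "\<lambda>a. \<forall>r. pos_vec r \<longrightarrow> ?bd a r"
    show "distr_in f (H0_space s) \<longleftrightarrow>
           (\<exists>F \<in> Linfty_compact. distr_eq f (fun_distr (stft_adj gauss F)) \<and>
              (\<exists>F0 \<in> A0_space s. AE (x, \<xi>) in lebesgue.
                 F (x, \<xi>) = F0 (cvec x (- \<xi>)) * exp (- \<i> * of_real (x \<bullet> \<xi>) / 2)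
                   * of_real (\<kappa> (cvec x \<xi>))))"
      unfolding H0_space_def A0_space_def
    proof (rule synthesis_equivalence[where Dec = ?Dec0, OF \<kappa> assms(2,3)])
      fix a :: "'d multi_index \<Rightarrow> complex"
      assume a: "?Dec0 a"
      \<comment> \<open>The vector of ones is one admissible choice of \<open>r\<close>.\<close>
      have "pos_vec ((\<chi> j. 1) :: real ^ 'd)" by (simp add: pos_vec_def)
      then show "\<exists>r. pos_vec r \<and> ?bd a r" using a by blast
    next
      fix a a' :: "'d multi_index \<Rightarrow> complex" and K A :: real
      assume a: "?Dec0 a" and K: "0 < K" "0 < A"
        and a': "\<And>\<alpha>. norm (a' \<alpha>) \<le> K * (mi_fact \<alpha> * A ^ mi_length \<alpha>) * norm (a \<alpha>)"
      show "?Dec0 a'"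
      proof (intro allI impI)
        fix r :: "real ^ 'd" assume r: "pos_vec r"
        \<comment> \<open>Starting from half of the given \<open>r\<close>, the doubling ends at
          \<open>r\<close> itself.\<close>
        then have r2: "pos_vec ((1 / 2) *\<^sub>R r)" by (intro pos2) auto
        show "?bd a' r"
          using bd[OF r2 a[rule_format, OF r2] K a'] by simp
      qed
    qed
  qed
qed

end
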